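(* Let $\mathcal A$ be an $A_\infty$-category. There is an $A_\infty$-isomorphism $\mathbb Z\mathcal A*\mathbb Z\simeq\mathbb Z(k[t,t^{-1}]\otimes_k\mathcal A)$. This isomorphism induces a quasi-equivalence $$\mathrm{Tw}(\mathbb Z\mathcal A*\mathbb Z)\ \overset{\sim}{\longrightarrow}\ \mathrm{Tw}(k[t,t^{-1}]\otimes_k\mathcal A).$$
   Context: $k$ is a field and all categories are $k$-linear. $A_\infty$-categories follow Seidel's conventions: graded Hom spaces, structure maps $\mu^d$ of degree $2-d$ ($d\ge 1$), $|a|$ the degree of a homogeneous morphism $a$ and $\|a\|=|a|-1$, with relations $\sum_{m,n}(-1)^{\|a_1\|+\dots+\|a_n\|}\mu^{d-m+1}(a_d,\dots,a_{n+m+1},\mu^m(a_{n+m},\dots,a_{n+1}),a_n,\dots,a_1)=0$. All $A_\infty$-categories are strictly unital and all $A_\infty$-functors are strict and unital. An $A_\infty$-isomorphism is an invertible $A_\infty$-functor; a quasi-equivalence is an $A_\infty$-functor inducing an equivalence on cohomology categories. Category $\mathbb Z\mathcal A$: objects are formal finite direct sums $\bigoplus_{i\in I}X_i[p_i]$ with $X_i\in\mathcal A$, $p_i\in\mathbb Z$; $\mathrm{Hom}_{\mathbb Z\mathcal A}(X[p],Y[q])=\mathrm{Hom}_{\mathrm{gr}\,k}(k[p],k[q])\otimes_k\mathrm{Hom}_{\mathcal A}(X,Y)$ is spanned by elements $s^p_q\otimes a$ of degree $p-q+|a|$, where $s^p_q$ is the identity map $k[p]\to k[q]$, of degree $p-q$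 (morphisms between direct sums are matrices); and $$\mu^d_{\mathbb Z\mathcal A}(s^{p_{d-1}}_{p_d}\otimes a_d,\dots,s^{p_0}_{p_1}\otimes a_1)=(-1)^{\sum_{i<j}(p_{i-1}-p_i)\|a_j\|}\,s^{p_0}_{p_d}\otimes\mu^d_{\mathcal A}(a_d,\dots,a_1).$$ Twisted complexes: objects of $\mathrm{Tw}(\mathcal A)$ are pairs $(X,\delta_X)$ with $X\in\mathbb Z\mathcal A$ and $\delta_X$ a degree $1$ endomorphism of $X$ in $\mathbb Z\mathcal A$ that is strictly lower triangular (in Seidel's sense: $X$ has a finite filtration preserved by $\delta_X$ such that $\delta_X$ induces zero on the graded pieces) and satisfies $\sum_{d>0}\mu^d_{\mathbb Z\mathcal A}(\delta_X,\dots,\delta_X)=0$. Morphism spaces are those of $\mathbb Z\mathcal A$, and $$\mu^d_{\mathrm{Tw}(\mathcal A)}(f_d,\dots,f_1)=\sum_{i_0,\dots,i_d\ge 0}\mu^{d+i_0+\dots+i_d}_{\mathbb Z\mathcal A}(\delta_{X_d}^{\otimes i_d},f_d,\delta_{X_{d-1}}^{\otimes i_{d-1}},f_{d-1},\dots,f_1,\delta_{X_0}^{\otimes i_0}).$$ Shift action and skew category: view $\mathbb Z$ multiplicatively with generator $\sigma$. It acts strictly on $\mathbb Z\mathcal A$ by $\sigma(\bigoplus_iX_i[p_i])=\bigoplus_iX_i[p_i+1]$ and $\sigma(s^p_q\otimes a)=(-1)^{p-q}s^{p+1}_{q+1}\otimes a$. The skew group $A_\infty$-category $\mathbb Z\mathcal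 A*\mathbb Z$ has objects $\{X\}$ for $X\in\mathbb Z\mathcal A$, $\mathrm{Hom}(\{X\},\{Y\})=\bigoplus_{\ell\in\mathbb Z}\mathrm{Hom}_{\mathbb Z\mathcal A}(\sigma^\ell X,Y)$ (with $a:\sigma^\ell X\to Y$ written $a\otimes\sigma^\ell$), and $\mu^n(a_n\otimes g_n,\dots,a_1\otimes g_1)=\mu^n_{\mathbb Z\mathcal A}(a_n,g_na_{n-1},\dots,g_n\cdots g_2a_1)\otimes g_n\cdots g_1$ for $g_i$ powers of $\sigma$. Category $k[t,t^{-1}]\otimes_k\mathcal A$: $k[t,t^{-1}]$ is graded with $|t|=1$; objects are those of $\mathcal A$, $\mathrm{Hom}(X,Y)=k[t,t^{-1}]\otimes_k\mathrm{Hom}_{\mathcal A}(X,Y)$, units $1\otimes\mathrm{id}_X$, and $\mu^d(t^{\alpha_d}\otimes a_d,\dots,t^{\alpha_1}\otimes a_1)=(-1)^{\sum_{i<j}\alpha_i\|a_j\|}\,t^{\alpha_d+\dots+\alpha_1}\otimes\mu^d_{\mathcal A}(a_d,\dots,a_1)$. *)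

theory Defs
  imports
    Complex_Main
    "HOL-Library.Function_Algebras"
    "HOL-Library.Groups_Big_Fun"
begin

section \<open>Strictly unital \<open>A\<^sub>\<infinity>\<close>-categories\<close>

text \<open>
  Graded \<open>Hom\<close> spaces are families of subspaces \<open>Hom C X Y n\<close> (the morphisms of degree \<open>n\<close>) of one
  ambient vector space; the total space is the external direct sum over \<open>n\<close>.  No disjointness is
  assumed, so \<open>Mu\<close> receives, besides the homogeneous morphisms, their end points and degrees.

  All lists are in order of composition, that is, reversed with respect to the usual
  \<open>\<mu>\<^sup>d(a\<^sub>d, \<dots>, a\<^sub>1)\<close>: the latter is \<open>Mu C [X\<^sub>0, \<dots>, X\<^sub>d] [|a\<^sub>1|, \<dots>, |a\<^sub>d|] [a\<^sub>1, \<dots>, a\<^sub>d]\<close>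
  for \<open>a\<^sub>i : X\<^sub>i\<^sub>-\<^sub>1 \<rightarrow> X\<^sub>i\<close>.
\<close>

record ('k, 'o, 'm) ainf =
  Obj :: "'o set"
  Scl :: "'k \<Rightarrow> 'm \<Rightarrow> 'm"
  Hom :: "'o \<Rightarrow> 'o \<Rightarrow> int \<Rightarrow> 'm set"
  Mu :: "'o list \<Rightarrow> int list \<Rightarrow> 'm list \<Rightarrow> 'm"
  Unit :: "'o \<Rightarrow> 'm"

definition minus_one_pow :: "int \<Rightarrow> 'k::field" where
  "minus_one_pow n = (- 1) powi n"

definition composable ::
  "('k, 'o, 'm) ainf \<Rightarrow> 'o list \<Rightarrow> int list \<Rightarrow> 'm list \<Rightarrow> bool" where
  "composable C Xs ns as \<longleftrightarrow>
     as \<noteq> [] \<and> length Xs = length as + 1 \<and> length ns = length as \<and> set Xs \<subseteq> Obj C \<and>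
     (\<forall>i < length as. as ! i \<in> Hom C (Xs ! i) (Xs ! (i + 1)) (ns ! i))"

text \<open>
  The summand of the \<open>A\<^sub>\<infinity>\<close>-relation in which the inner operation \<open>\<mu>\<^sup>m\<close> is applied to
  \<open>a\<^sub>n\<^sub>+\<^sub>m, \<dots>, a\<^sub>n\<^sub>+\<^sub>1\<close>.
\<close>

definition ainf_relation_term ::
  "('k::field, 'o, 'm) ainf \<Rightarrow> 'o list \<Rightarrow> int list \<Rightarrow> 'm list \<Rightarrow> nat \<Rightarrow> nat \<Rightarrow> 'm" where
  "ainf_relation_term C Xs ns as n m =
     Scl C (minus_one_pow (\<Sum>i<n. ns ! i - 1))
       (Mu C
          (take (n + 1) Xs @ drop (n + m) Xs)
          (take n ns @ [sum_list (take m (drop n ns)) + 2 - int m] @ drop (n + m) ns)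
          (take n as
             @ [Mu C (take (m + 1) (drop n Xs)) (take m (drop n ns)) (take m (drop n as))]
             @ drop (n + m) as))"

locale ainf_category =
  fixes C :: "('k::field, 'o, 'm::ab_group_add) ainf"
  assumes scalars: "vector_space (Scl C)"
    and hom_subspace:
      "\<lbrakk>X \<in> Obj C; Y \<in> Obj C\<rbrakk> \<Longrightarrow> module.subspace (Scl C) (Hom C X Y n)"
    and mu_closed:
      "composable C Xs ns as \<Longrightarrow>
         Mu C Xs ns as \<in> Hom C (hd Xs) (last Xs) (sum_list ns + 2 - int (length as))"
    and mu_add:
      "\<lbrakk>composable C Xs ns as; i < length as; b \<in> Hom C (Xs ! i) (Xs ! (i + 1)) (ns ! i)\<rbrakk> \<Longrightarrow>
         Mu C Xs ns (as[i := as ! i + b]) = Mu C Xs ns as + Mu C Xs ns (as[i := b])"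
    and mu_scale:
      "\<lbrakk>composable C Xs ns as; i < length as\<rbrakk> \<Longrightarrow>
         Mu C Xs ns (as[i := Scl C c (as ! i)]) = Scl C c (Mu C Xs ns as)"
    and ainf_relation:
      "composable C Xs ns as \<Longrightarrow>
         (\<Sum>n<length as. \<Sum>m = 1..length as - n. ainf_relation_term C Xs ns as n m) = 0"
    and unit_hom: "X \<in> Obj C \<Longrightarrow> Unit C X \<in> Hom C X X 0"
    and mu1_unit: "X \<in> Obj C \<Longrightarrow> Mu C [X, X] [0] [Unit C X] = 0"
    and mu2_unit_right:
      "\<lbrakk>X \<in> Obj C; Y \<in> Obj C; a \<in> Hom C X Y n\<rbrakk> \<Longrightarrow>
         Mu C [X, X, Y] [0, n] [Unit C X, a] = a"
    and mu2_unit_left: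
      "\<lbrakk>X \<in> Obj C; Y \<in> Obj C; a \<in> Hom C X Y n\<rbrakk> \<Longrightarrow>
         Scl C (minus_one_pow n) (Mu C [X, Y, Y] [n, 0] [a, Unit C Y]) = a"
    and mu_unit_higher:
      "\<lbrakk>composable C Xs ns as; 3 \<le> length as; i < length as; Xs ! (i + 1) = Xs ! i; ns ! i = 0;
         as ! i = Unit C (Xs ! i)\<rbrakk> \<Longrightarrow> Mu C Xs ns as = 0"


section \<open>Strict unital functors\<close>

text \<open>
  A strict functor consists of its action on objects and its linear part \<open>F\<^sup>1\<close> (with \<open>F\<^sup>d = 0\<close> for
  \<open>d \<ge> 2\<close>); the functor equations then say that \<open>F\<^sup>1\<close> commutes with all \<open>\<mu>\<^sup>d\<close>, without signs.
\<close>

record ('o, 'm, 'p, 'n) strict_fun =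
  On_obj :: "'o \<Rightarrow> 'p"
  On_hom :: "'o \<Rightarrow> 'o \<Rightarrow> int \<Rightarrow> 'm \<Rightarrow> 'n"

definition map_morphisms ::
  "('o, 'm, 'p, 'n) strict_fun \<Rightarrow> 'o list \<Rightarrow> int list \<Rightarrow> 'm list \<Rightarrow> 'n list" where
  "map_morphisms F Xs ns as =
     map (\<lambda>i. On_hom F (Xs ! i) (Xs ! (i + 1)) (ns ! i) (as ! i)) [0..<length as]"

locale ainf_functor =
  fixes C :: "('k::field, 'o, 'm::ab_group_add) ainf"
    and D :: "('k, 'p, 'n::ab_group_add) ainf"
    and F :: "('o, 'm, 'p, 'n) strict_fun"
  assumes on_obj: "X \<in> Obj C \<Longrightarrow> On_obj F X \<in> Obj D"
    and on_hom:
      "\<lbrakk>X \<in> Obj C; Y \<in> Obj C; a \<in> Hom C X Y n\<rbrakk> \<Longrightarrow>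
         On_hom F X Y n a \<in> Hom D (On_obj F X) (On_obj F Y) n"
    and on_hom_add:
      "\<lbrakk>X \<in> Obj C; Y \<in> Obj C; a \<in> Hom C X Y n; b \<in> Hom C X Y n\<rbrakk> \<Longrightarrow>
         On_hom F X Y n (a + b) = On_hom F X Y n a + On_hom F X Y n b"
    and on_hom_scale:
      "\<lbrakk>X \<in> Obj C; Y \<in> Obj C; a \<in> Hom C X Y n\<rbrakk> \<Longrightarrow>
         On_hom F X Y n (Scl C c a) = Scl D c (On_hom F X Y n a)"
    and on_mu:
      "composable C Xs ns as \<Longrightarrow>
         On_hom F (hd Xs) (last Xs) (sum_list ns + 2 - int (length as)) (Mu C Xs ns as) =
         Mu D (map (On_obj F) Xs) ns (map_morphisms F Xs ns as)"
    and on_unit: "X \<in> Obj C \<Longrightarrow> On_hom F X X 0 (Unit C X) = Unit D (On_obj F X)"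

definition comp_fun ::
  "('p, 'n, 'q, 'l) strict_fun \<Rightarrow> ('o, 'm, 'p, 'n) strict_fun \<Rightarrow> ('o, 'm, 'q, 'l) strict_fun" where
  "comp_fun G F =
     \<lparr>On_obj = \<lambda>X. On_obj G (On_obj F X),
      On_hom = \<lambda>X Y n a. On_hom G (On_obj F X) (On_obj F Y) n (On_hom F X Y n a)\<rparr>"

definition is_identity_on ::
  "('k, 'o, 'm) ainf \<Rightarrow> ('o, 'm, 'o, 'm) strict_fun \<Rightarrow> bool" where
  "is_identity_on C F \<longleftrightarrow>
     (\<forall>X \<in> Obj C. On_obj F X = X) \<and>
     (\<forall>X \<in> Obj C. \<forall>Y \<in> Obj C. \<forall>n. \<forall>a \<in> Hom C X Y n. On_hom F X Y n a = a)"

definition ainf_isomorphism ::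
  "('k::field, 'o, 'm::ab_group_add) ainf \<Rightarrow> ('k, 'p, 'n::ab_group_add) ainf \<Rightarrow>
     ('o, 'm, 'p, 'n) strict_fun \<Rightarrow> bool" where
  "ainf_isomorphism C D F \<longleftrightarrow>
     ainf_functor C D F \<and>
     (\<exists>G. ainf_functor D C G \<and> is_identity_on C (comp_fun G F) \<and> is_identity_on D (comp_fun F G))"


section \<open>Cohomology categories and quasi-equivalences\<close>

definition cocycles :: "('k, 'o, 'm::zero) ainf \<Rightarrow> 'o \<Rightarrow> 'o \<Rightarrow> int \<Rightarrow> 'm set" where
  "cocycles C X Y n = {a \<in> Hom C X Y n. Mu C [X, Y] [n] [a] = 0}"

definition coboundaries :: "('k, 'o, 'm) ainf \<Rightarrow> 'o \<Rightarrow> 'o \<Rightarrow> int \<Rightarrow> 'm set" where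
  "coboundaries C X Y n = {Mu C [X, Y] [n - 1] [b] | b. b \<in> Hom C X Y (n - 1)}"

definition coh_class :: "('k, 'o, 'm::plus) ainf \<Rightarrow> 'o \<Rightarrow> 'o \<Rightarrow> int \<Rightarrow> 'm \<Rightarrow> 'm set" where
  "coh_class C X Y n a = {a + b | b. b \<in> coboundaries C X Y n}"

definition cohomology :: "('k, 'o, 'm::ab_group_add) ainf \<Rightarrow> 'o \<Rightarrow> 'o \<Rightarrow> int \<Rightarrow> 'm set set" where
  "cohomology C X Y n = coh_class C X Y n ` cocycles C X Y n"

text \<open>
  The map induced by a functor on cohomology classes; the union is over the representatives and
  consists of a single class, since functors preserve coboundaries.
\<close>

definition coh_map ::
  "('k, 'p, 'n::ab_group_add) ainf \<Rightarrow> ('o, 'm, 'p, 'n) strict_fun \<Rightarrow>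
     'o \<Rightarrow> 'o \<Rightarrow> int \<Rightarrow> 'm set \<Rightarrow> 'n set" where
  "coh_map D F X Y n c =
     (\<Union>a \<in> c. coh_class D (On_obj F X) (On_obj F Y) n (On_hom F X Y n a))"

text \<open>
  Composition in the cohomology category is \<open>[b] \<circ> [a] = (-1)\<^bsup>|a|\<^esup> [\<mu>\<^sup>2(b, a)]\<close>, and isomorphisms of
  graded categories have degree \<open>0\<close>, so that the sign disappears.
\<close>

definition coh_isomorphic :: "('k, 'o, 'm::ab_group_add) ainf \<Rightarrow> 'o \<Rightarrow> 'o \<Rightarrow> bool" where
  "coh_isomorphic C X Y \<longleftrightarrow>
     (\<exists>u \<in> cocycles C X Y 0. \<exists>v \<in> cocycles C Y X 0.
        coh_class C X X 0 (Mu C [X, Y, X] [0, 0] [u, v]) = coh_class C X X 0 (Unit C X) \<and>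
        coh_class C Y Y 0 (Mu C [Y, X, Y] [0, 0] [v, u]) = coh_class C Y Y 0 (Unit C Y))"

text \<open>
  That the map induced on cohomology is a functor is automatic for an \<open>A\<^sub>\<infinity>\<close>-functor; it is an
  equivalence if it is fully faithful and essentially surjective.
\<close>

definition quasi_equivalence ::
  "('k::field, 'o, 'm::ab_group_add) ainf \<Rightarrow> ('k, 'p, 'n::ab_group_add) ainf \<Rightarrow>
     ('o, 'm, 'p, 'n) strict_fun \<Rightarrow> bool" where
  "quasi_equivalence C D F \<longleftrightarrow>
     ainf_functor C D F \<and>
     (\<forall>X \<in> Obj C. \<forall>Y \<in> Obj C. \<forall>n.
        bij_betw (coh_map D F X Y n)
          (cohomology C X Y n) (cohomology D (On_obj F X) (On_obj F Y) n)) \<and>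
     (\<forall>Z \<in> Obj D. \<exists>X \<in> Obj C. coh_isomorphic D (On_obj F X) Z)"


section \<open>The category \<open>\<int>\<A>\<close> of formal direct sums of shifts\<close>

text \<open>The exponent \<open>\<Sum>\<^sub>i\<^sub><\<^sub>j u\<^sub>i (v\<^sub>j - 1)\<close>, for shifts \<open>u\<^sub>i\<close> and degrees \<open>v\<^sub>j\<close>.\<close>

definition koszul_exponent :: "int list \<Rightarrow> int list \<Rightarrow> int" where
  "koszul_exponent us vs = (\<Sum>j<length vs. \<Sum>i<j. us ! i * (vs ! j - 1))"

text \<open>
  The formal direct sum \<open>X\<^sub>0[p\<^sub>0] \<oplus> X\<^sub>1[p\<^sub>1] \<oplus> \<dots>\<close> is the list \<open>[(X\<^sub>0, p\<^sub>0), (X\<^sub>1, p\<^sub>1), \<dots>]\<close>.  A morphism is a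
  matrix \<open>f\<close> whose entry \<open>f j i\<close> is the \<open>a\<close> in the component \<open>s \<otimes> a\<close> from the \<open>i\<close>-th
  to the \<open>j\<close>-th summand (with \<open>s\<close> the identity map \<open>k[p\<^sub>i] \<rightarrow> k[q\<^sub>j]\<close>), and is \<open>0\<close> outside the index
  range.  As \<open>s \<otimes> a\<close> has degree \<open>p\<^sub>i - q\<^sub>j + |a|\<close>, the entry \<open>a\<close> of a morphism of degree \<open>n\<close> has degree
  \<open>n - (p\<^sub>i - q\<^sub>j)\<close>.
\<close>

type_synonym 'o formal_sum = "('o \<times> int) list"
type_synonym 'm matrix = "nat \<Rightarrow> nat \<Rightarrow> 'm"

abbreviation summand :: "'o formal_sum \<Rightarrow> nat \<Rightarrow> 'o" where
  "summand X i \<equiv> fst (X ! i)"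

abbreviation shift :: "'o formal_sum \<Rightarrow> nat \<Rightarrow> int" where
  "shift X i \<equiv> snd (X ! i)"

definition matrix_paths :: "'o formal_sum list \<Rightarrow> nat \<Rightarrow> nat \<Rightarrow> nat list set" where
  "matrix_paths Xs i j =
     {is. length is = length Xs \<and> (\<forall>k < length Xs. is ! k < length (Xs ! k)) \<and>
          hd is = i \<and> last is = j}"

definition shift_mu_term ::
  "('k::field, 'o, 'm) ainf \<Rightarrow> 'o formal_sum list \<Rightarrow> int list \<Rightarrow> 'm matrix list \<Rightarrow> nat list \<Rightarrow> 'm"
  where
  "shift_mu_term C Xs ns fs is =
     (let d = length fs;
          ps = map (\<lambda>k. shift (Xs ! k) (is ! k)) [0..<d + 1];
          us = map (\<lambda>k. ps ! k - ps ! (k + 1)) [0..<d];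
          ms = map (\<lambda>k. ns ! k - us ! k) [0..<d]
      in Scl C (minus_one_pow (koszul_exponent us ms))
           (Mu C (map (\<lambda>k. summand (Xs ! k) (is ! k)) [0..<d + 1]) ms
              (map (\<lambda>k. (fs ! k) (is ! (k + 1)) (is ! k)) [0..<d])))"

definition shift_cat ::
  "('k::field, 'o, 'm::ab_group_add) ainf \<Rightarrow> ('k, 'o formal_sum, 'm matrix) ainf" where
  "shift_cat C =
     \<lparr>Obj = {X. fst ` set X \<subseteq> Obj C},
      Scl = (\<lambda>c f j i. Scl C c (f j i)),
      Hom = (\<lambda>X Y n. {f. \<forall>j i.
        if i < length X \<and> j < length Y
        then f j i \<in> Hom C (summand X i) (summand Y j) (n - (shift X i - shift Y j))
        else f j i = 0}),
      Mu = (\<lambda>Xs ns fs j i. \<Sum>is \<in> matrix_paths Xs i j. shift_mu_term C Xs ns fs is),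
      Unit = (\<lambda>X j i. if i = j \<and> i < length X then Unit C (summand X i) else 0)\<rparr>"

definition shift_map ::
  "('o, 'm, 'p, 'n::zero) strict_fun \<Rightarrow>
     ('o formal_sum, 'm matrix, 'p formal_sum, 'n matrix) strict_fun" where
  "shift_map F =
     \<lparr>On_obj = map (\<lambda>(x, p). (On_obj F x, p)),
      On_hom = (\<lambda>X Y n f j i.
        if i < length X \<and> j < length Y
        then On_hom F (summand X i) (summand Y j) (n - (shift X i - shift Y j)) (f j i)
        else 0)\<rparr>"

text \<open>
  The identification of \<open>\<int>(\<int>\<A>)\<close> with \<open>\<int>\<A>\<close>, which collects \<open>\<Oplus>\<^sub>i (\<Oplus>\<^sub>u X\<^sub>i\<^sub>u[p\<^sub>i\<^sub>u])[q\<^sub>i]\<close> into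
  \<open>\<Oplus>\<^sub>i\<^sub>,\<^sub>u X\<^sub>i\<^sub>u[p\<^sub>i\<^sub>u + q\<^sub>i]\<close>.  On morphisms it sends \<open>s\<^sup>q\<^sub>q\<^sub>' \<otimes> (s\<^sup>p\<^sub>p\<^sub>' \<otimes> a)\<close>, where \<open>q, q'\<close> are the outer and
  \<open>p, p'\<close> the inner shifts, to \<open>(-1)\<^bsup>q (p - p')\<^esup> s\<^bsup>p+q\<^esup>\<^bsub>p'+q'\<^esub> \<otimes> a\<close>; the sign is what makes it commute with
  the operations \<open>\<mu>\<^sup>d\<close>.
\<close>

text \<open>Position \<open>r\<close> of \<open>concat Xss\<close> is position \<open>u\<close> of \<open>Xss ! i\<close>, for \<open>(i, u) = block_index Xss r\<close>.\<close>

fun block_index :: "'a list list \<Rightarrow> nat \<Rightarrow> nat \<times> nat" where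
  "block_index [] r = (0, r)"
| "block_index (xs # xss) r =
     (if r < length xs then (0, r)
      else (let (i, u) = block_index xss (r - length xs) in (i + 1, u)))"

definition flatten ::
  "('k::field, 'o, 'm::ab_group_add) ainf \<Rightarrow>
     ('o formal_sum formal_sum, 'm matrix matrix, 'o formal_sum, 'm matrix) strict_fun" where
  "flatten C =
     \<lparr>On_obj = (\<lambda>X. concat (map (\<lambda>(Y, q). map (\<lambda>(x, p). (x, p + q)) Y) X)),
      On_hom = (\<lambda>X Y n f r c.
        if c < length (concat (map fst X)) \<and> r < length (concat (map fst Y))
        then (let (i, u) = block_index (map fst X) c;
                  (j, v) = block_index (map fst Y) r
              in Scl C (minus_one_pow (shift X i * (shift (summand X i) u - shift (summand Y j) v)))
                   (f j i v u))
        else 0)\<rparr>"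


section \<open>Twisted complexes\<close>

text \<open>
  In a formal direct sum of shifts each summand has the one-dimensional multiplicity space \<open>k[p\<^sub>i]\<close>,
  so a filtration by graded subspaces of the multiplicity spaces is one by subsets of the summands.
  It is decreasing and starts with all \<open>n\<close> summands.
\<close>

definition strictly_lower_triangular :: "nat \<Rightarrow> 'm::zero matrix \<Rightarrow> bool" where
  "strictly_lower_triangular n \<delta> \<longleftrightarrow>
     (\<exists>(F :: nat \<Rightarrow> nat set) N.
        F 0 = {..<n} \<and> F N = {} \<and> (\<forall>m. F (Suc m) \<subseteq> F m) \<and>
        (\<forall>m. \<forall>i \<in> F m. \<forall>j. \<delta> j i \<noteq> 0 \<longrightarrow> j \<in> F m) \<and>
        (\<forall>m. \<forall>i \<in> F m - F (Suc m). \<forall>j \<in> F m - F (Suc m). \<delta> j i = 0))"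

text \<open>\<open>interleave [w\<^sub>0, \<dots>, w\<^sub>d] [x\<^sub>1, \<dots>, x\<^sub>d]\<close> is the word \<open>w\<^sub>0 x\<^sub>1 w\<^sub>1 \<dots> x\<^sub>d w\<^sub>d\<close>.\<close>

fun interleave :: "'a list list \<Rightarrow> 'a list \<Rightarrow> 'a list" where
  "interleave (w # ws) (x # xs) = w @ x # interleave ws xs"
| "interleave ws [] = concat ws"
| "interleave [] xs = xs"

definition tw_mu_term ::
  "('k::field, 'o, 'm::ab_group_add) ainf \<Rightarrow> ('o formal_sum \<times> 'm matrix) list \<Rightarrow>
     int list \<Rightarrow> 'm matrix list \<Rightarrow> nat list \<Rightarrow> 'm matrix" where
  "tw_mu_term C Ts ns fs is =
     Mu (shift_cat C)
       (concat (map (\<lambda>(T, i). replicate (i + 1) (fst T)) (zip Ts is)))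
       (interleave (map (\<lambda>i. replicate i 1) is) ns)
       (interleave (map (\<lambda>(T, i). replicate i (snd T)) (zip Ts is)) fs)"

text \<open>
  The infinite sums below have only finitely many nonzero terms by triangularity; \<open>Sum_any\<close> is the sum
  of the nonzero terms.
\<close>

definition Tw ::
  "('k::field, 'o, 'm::ab_group_add) ainf \<Rightarrow>
     ('k, 'o formal_sum \<times> 'm matrix, 'm matrix) ainf" where
  "Tw C =
     \<lparr>Obj = {(X, \<delta>).
        X \<in> Obj (shift_cat C) \<and> \<delta> \<in> Hom (shift_cat C) X X 1 \<and>
        strictly_lower_triangular (length X) \<delta> \<and>
        Sum_any (\<lambda>d. if d > 0
          then Mu (shift_cat C) (replicate (d + 1) X) (replicate d 1) (replicate d \<delta>)
          else 0) = 0},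
      Scl = Scl (shift_cat C),
      Hom = (\<lambda>S T. Hom (shift_cat C) (fst S) (fst T)),
      Mu = (\<lambda>Ts ns fs. Sum_any (\<lambda>is. if length is = length Ts then tw_mu_term C Ts ns fs is else 0)),
      Unit = (\<lambda>T. Unit (shift_cat C) (fst T))\<rparr>"

text \<open>
  A functor \<open>H : \<int>\<C> \<rightarrow> \<int>\<D>\<close> (here \<open>\<int>\<close> applied to a functor \<open>\<C> \<rightarrow> \<D>\<close>, or \<^term>\<open>flatten\<close>) extends to twisted
  complexes by \<open>(X, \<delta>) \<mapsto> (H X, H \<delta>)\<close>.
\<close>

definition tw_extend ::
  "('o formal_sum, 'm matrix, 'p formal_sum, 'n matrix) strict_fun \<Rightarrow>
     ('o formal_sum \<times> 'm matrix, 'm matrix, 'p formal_sum \<times> 'n matrix, 'n matrix) strict_fun" where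
  "tw_extend H =
     \<lparr>On_obj = (\<lambda>(X, \<delta>). (On_obj H X, On_hom H X X 1 \<delta>)),
      On_hom = (\<lambda>S T. On_hom H (fst S) (fst T))\<rparr>"

definition tw_map ::
  "('o, 'm, 'p, 'n::zero) strict_fun \<Rightarrow>
     ('o formal_sum \<times> 'm matrix, 'm matrix, 'p formal_sum \<times> 'n matrix, 'n matrix) strict_fun" where
  "tw_map F = tw_extend (shift_map F)"

text \<open>The functor \<open>Tw(\<C>) \<rightarrow> Tw(\<D>)\<close> induced by a functor \<open>\<C> \<rightarrow> \<int>\<D>\<close>, as \<open>Tw(\<C>) \<rightarrow> Tw(\<int>\<D>) \<rightarrow> Tw(\<D>)\<close>.\<close>

definition tw_induced ::
  "('k::field, 'p, 'n::ab_group_add) ainf \<Rightarrow> ('o, 'm, 'p formal_sum, 'n matrix) strict_fun \<Rightarrow>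
     ('o formal_sum \<times> 'm matrix, 'm matrix, 'p formal_sum \<times> 'n matrix, 'n matrix) strict_fun" where
  "tw_induced D F = comp_fun (tw_extend (flatten D)) (tw_map F)"


section \<open>The shift action and the skew group category\<close>

text \<open>
  The action of \<open>\<sigma>\<^sup>l\<close> on \<open>\<int>\<A>\<close>: iterating \<open>\<sigma>(s\<^sup>p\<^sub>q \<otimes> a) = (-1)\<^bsup>p-q\<^esup> s\<^bsup>p+1\<^esup>\<^bsub>q+1\<^esub> \<otimes> a\<close> leaves \<open>p - q\<close> unchanged, so
  the sign is raised to the power \<open>l\<close>.
\<close>

definition shift_action ::
  "('k::field, 'o, 'm) ainf \<Rightarrow> int \<Rightarrow>
     ('o formal_sum, 'm matrix, 'o formal_sum, 'm matrix) strict_fun" where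
  "shift_action C l =
     \<lparr>On_obj = map (\<lambda>(x, p). (x, p + l)),
      On_hom = (\<lambda>X Y n f j i. Scl C (minus_one_pow (l * (shift X i - shift Y j))) (f j i))\<rparr>"

text \<open>
  The skew group category for a strict action \<open>\<sigma>\<close> of the infinite cyclic group, \<open>\<sigma> l\<close> being the action
  of the \<open>l\<close>-th power of the generator.  The object \<open>{X}\<close> is represented by \<open>X\<close>, and
  \<open>\<Sum>\<^sub>l a\<^sub>l \<otimes> \<sigma>\<^sup>l\<close> by the finitely supported function \<open>l \<mapsto> a\<^sub>l\<close>.
\<close>

definition skew_cat ::
  "('k::field, 'o, 'm::ab_group_add) ainf \<Rightarrow> (int \<Rightarrow> ('o, 'm, 'o, 'm) strict_fun) \<Rightarrow>
     ('k, 'o, int \<Rightarrow> 'm) ainf" where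
  "skew_cat C \<sigma> =
     \<lparr>Obj = Obj C,
      Scl = (\<lambda>c f l. Scl C c (f l)),
      Hom = (\<lambda>X Y n. {f. finite {l. f l \<noteq> 0} \<and> (\<forall>l. f l \<in> Hom C (On_obj (\<sigma> l) X) Y n)}),
      Mu = (\<lambda>Xs ns fs l.
        \<Sum>ls | length ls = length fs \<and> sum_list ls = l \<and> (\<forall>k < length fs. (fs ! k) (ls ! k) \<noteq> 0).
          Mu C
            (map (\<lambda>k. On_obj (\<sigma> (sum_list (drop k ls))) (Xs ! k)) [0..<length fs + 1])
            ns
            (map (\<lambda>k. On_hom (\<sigma> (sum_list (drop (k + 1) ls)))
                        (On_obj (\<sigma> (ls ! k)) (Xs ! k)) (Xs ! (k + 1)) (ns ! k)
                        ((fs ! k) (ls ! k))) [0..<length fs])),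
      Unit = (\<lambda>X l. if l = 0 then Unit C X else 0)\<rparr>"


section \<open>The category \<open>k[t, t\<^sup>-\<^sup>1] \<otimes> \<A>\<close>\<close>

text \<open>
  \<open>\<Sum>\<^sub>\<alpha> t\<^sup>\<alpha> \<otimes> a\<^sub>\<alpha>\<close> is represented by the finitely supported function \<open>\<alpha> \<mapsto> a\<^sub>\<alpha>\<close>; since \<open>|t| = 1\<close>, in
  degree \<open>n\<close> the coefficient \<open>a\<^sub>\<alpha>\<close> has degree \<open>n - \<alpha>\<close>.
\<close>

definition laurent_cat ::
  "('k::field, 'o, 'm::ab_group_add) ainf \<Rightarrow> ('k, 'o, int \<Rightarrow> 'm) ainf" where
  "laurent_cat C =
     \<lparr>Obj = Obj C,
      Scl = (\<lambda>c f \<alpha>. Scl C c (f \<alpha>)),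
      Hom = (\<lambda>X Y n. {f. finite {\<alpha>. f \<alpha> \<noteq> 0} \<and> (\<forall>\<alpha>. f \<alpha> \<in> Hom C X Y (n - \<alpha>))}),
      Mu = (\<lambda>Xs ns fs \<beta>.
        \<Sum>\<alpha>s | length \<alpha>s = length fs \<and> sum_list \<alpha>s = \<beta> \<and> (\<forall>k < length fs. (fs ! k) (\<alpha>s ! k) \<noteq> 0).
          let ms = map (\<lambda>k. ns ! k - \<alpha>s ! k) [0..<length fs]
          in Scl C (minus_one_pow (koszul_exponent \<alpha>s ms))
               (Mu C Xs ms (map (\<lambda>k. (fs ! k) (\<alpha>s ! k)) [0..<length fs]))),
      Unit = (\<lambda>X \<alpha>. if \<alpha> = 0 then Unit C X else 0)\<rparr>"

end

theory Submission
  imports Defs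
begin

text \<open>
  On components, \<open>\<Phi>\<close> sends \<open>(s\<^bsup>p+l\<^esup>\<^bsub>q\<^esub> \<otimes> a) \<otimes> \<sigma>\<^sup>l\<close> to \<open>(-1)\<^bsup>l(l-1)/2\<^esup> s\<^sup>p\<^sub>q \<otimes> (t\<^sup>l \<otimes> a)\<close>.  Comparing the two
  operations, all contributions of the shifts \<open>p\<close> and the degrees cancel modulo 2 and the signs of
  \<open>\<mu>\<^sup>d\<close> differ by \<open>\<Sum>\<^sub>i\<^sub><\<^sub>j l\<^sub>i l\<^sub>j\<close>, which is the defect of additivity of \<open>l(l-1)/2\<close>.

  The induced functor \<open>K : \<int>(\<int>\<A> * \<int>) \<rightarrow> \<int>(k[t, t\<^sup>-\<^sup>1] \<otimes> \<A>)\<close> is bijective on morphism spaces, so it induces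
  a functor of twisted complexes which is bijective on morphism complexes, hence on cohomology.
  It is surjective on objects: a twisted complex \<open>\<Oplus>\<^sub>i X\<^sub>i[p\<^sub>i]\<close> is the image of the one whose summands are
  the unshifted one-element sums \<open>X\<^sub>i[p\<^sub>i] \<in> \<int>\<A>\<close>.
\<close>

text \<open>Only the multilinear and unit axioms are transported from \<open>A\<close> to the
  constructed categories. This shapes the argument: functors are linear on whole function spaces
  instead of on morphism spaces, and injectivity is proved on a larger, degree-free set of matrices
  that contains all values.

  Bijectivity on morphism complexes leaves two gaps. Cohomology classes are cosets only if the
  coboundaries of the target are closed under addition; this needs an additive differential, hence a
  bound on the number of inserted twisting morphisms, which nilpotency of triangular matrices
  supplies. Essential surjectivity asks for an isomorphism in cohomology even between equal objects,
  so the strict unit of a twisted complex has to be shown to be a cocycle that composes with itself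
  to itself.\<close>

lemma minus_one_pow_parity: "minus_one_pow n = (if even n then 1 else - 1 :: 'k::field)"
  unfolding minus_one_pow_def by (simp add: power_int_minus_left)

lemma minus_one_pow_add: "minus_one_pow (a + b) = (minus_one_pow a * minus_one_pow b :: 'k::field)"
  by (simp add: minus_one_pow_parity)

lemma minus_one_pow_square [simp]: "minus_one_pow a * minus_one_pow a = (1 :: 'k::field)"
  by (simp add: minus_one_pow_parity)

lemma minus_one_pow_0 [simp]: "minus_one_pow 0 = (1 :: 'k::field)"
  by (simp add: minus_one_pow_parity)

lemma minus_one_pow_sum:
  "(\<Prod>k\<in>S. minus_one_pow (e k)) = (minus_one_pow (\<Sum>k\<in>S. e k) :: 'k::field)"
  by (induction S rule: infinite_finite_induct) (auto simp: minus_one_pow_add)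

lemma minus_one_pow_cong: "even (a - b) \<Longrightarrow> minus_one_pow a = (minus_one_pow b :: 'k::field)"
  by (auto simp: minus_one_pow_parity)

lemma koszul_exponent_map:
  "koszul_exponent (map u [0..<d]) (map v [0..<d]) = (\<Sum>j<d. \<Sum>i<j. u i * (v j - 1))"
  unfolding koszul_exponent_def by (auto intro!: sum.cong)

lemma koszul_exponent_map':
  "length us = d \<Longrightarrow> koszul_exponent us (map v [0..<d]) = (\<Sum>j<d. \<Sum>i<j. us ! i * (v j - 1))"
  unfolding koszul_exponent_def by (auto intro!: sum.cong)

section \<open>Index sets of the sums: paths through formal sums and compositions of an
  integer\<close>

lemma finite_matrix_paths [simp]: "finite (matrix_paths Xs i j)"
proof (rule finite_subset)
  show "matrix_paths Xs i j \<subseteq>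
      {is. set is \<subseteq> (\<Union>k<length Xs. {..<length (Xs ! k)}) \<and> length is = length Xs}"
    by (fastforce simp: matrix_paths_def in_set_conv_nth)
qed (simp add: finite_lists_length_eq)

lemma matrix_paths_range:
  assumes "is \<in> matrix_paths Xs i j" "Xs \<noteq> []"
  shows "i < length (hd Xs)" "j < length (last Xs)"
proof -
  have "is \<noteq> []" "length is = length Xs" "0 < length Xs"
    using assms by (auto simp: matrix_paths_def)
  then show "i < length (hd Xs)" "j < length (last Xs)"
    using assms by (auto simp: matrix_paths_def hd_conv_nth last_conv_nth)
qed

lemma matrix_paths_cong:
  assumes "length Xs = length Ys" "\<And>k. k < length Xs \<Longrightarrow> length (Xs ! k) = length (Ys ! k)"
  shows "matrix_paths Xs i j = matrix_paths Ys i j"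
  using assms by (auto simp: matrix_paths_def)

text \<open>The set \<open>S k\<close> is the support of the \<open>k\<close>-th argument or any
  larger finite set. Leaving it free lets the sums for different arguments run over one common index
  set.\<close>

definition compositions :: "nat \<Rightarrow> int \<Rightarrow> (nat \<Rightarrow> int set) \<Rightarrow> int list set" where
  "compositions d \<beta> S = {ls. length ls = d \<and> sum_list ls = \<beta> \<and> (\<forall>k<d. ls ! k \<in> S k)}"

lemma finite_compositions:
  assumes "\<And>k. k < d \<Longrightarrow> finite (S k)"
  shows "finite (compositions d \<beta> S)"
proof (rule finite_subset)
  show "compositions d \<beta> S \<subseteq> {ls. set ls \<subseteq> (\<Union>k<d. S k) \<and> length ls = d}"
    by (fastforce simp: compositions_def in_set_conv_nth)
qed (use assms in \<open>simp add: finite_lists_length_eq\<close>)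

text \<open>
  The axioms of an \<open>A\<^sub>\<infinity>\<close>-category other than the relations and the closure of morphism spaces
  under the operations; this part is inherited by \<open>\<int>\<C>\<close> and \<open>k[t, t\<^sup>-\<^sup>1] \<otimes> \<C>\<close> without comparing
  signs of iterated operations.
\<close>

locale multilinear_category =
  fixes C :: "('k::field, 'o, 'm::ab_group_add) ainf"
  assumes scalars: "vector_space (Scl C)"
    and hom_subspace:
      "\<lbrakk>X \<in> Obj C; Y \<in> Obj C\<rbrakk> \<Longrightarrow> module.subspace (Scl C) (Hom C X Y n)"
    and mu_add:
      "\<lbrakk>composable C Xs ns as; i < length as; b \<in> Hom C (Xs ! i) (Xs ! (i + 1)) (ns ! i)\<rbrakk> \<Longrightarrow>
         Mu C Xs ns (as[i := as ! i + b]) = Mu C Xs ns as + Mu C Xs ns (as[i := b])"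
    and mu_scale:
      "\<lbrakk>composable C Xs ns as; i < length as\<rbrakk> \<Longrightarrow>
         Mu C Xs ns (as[i := Scl C c (as ! i)]) = Scl C c (Mu C Xs ns as)"
    and unit_hom: "X \<in> Obj C \<Longrightarrow> Unit C X \<in> Hom C X X 0"
    and mu1_unit: "X \<in> Obj C \<Longrightarrow> Mu C [X, X] [0] [Unit C X] = 0"
    and mu2_unit_right:
      "\<lbrakk>X \<in> Obj C; Y \<in> Obj C; a \<in> Hom C X Y n\<rbrakk> \<Longrightarrow>
         Mu C [X, X, Y] [0, n] [Unit C X, a] = a"
    and mu2_unit_left:
      "\<lbrakk>X \<in> Obj C; Y \<in> Obj C; a \<in> Hom C X Y n\<rbrakk> \<Longrightarrow>
         Scl C (minus_one_pow n) (Mu C [X, Y, Y] [n, 0] [a, Unit C Y]) = a"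
    and mu_unit_higher:
      "\<lbrakk>composable C Xs ns as; 3 \<le> length as; i < length as; Xs ! (i + 1) = Xs ! i; ns ! i = 0;
         as ! i = Unit C (Xs ! i)\<rbrakk> \<Longrightarrow> Mu C Xs ns as = 0"
begin

sublocale vector_space "Scl C"
  by (rule scalars)

lemma hom_zero: "\<lbrakk>X \<in> Obj C; Y \<in> Obj C\<rbrakk> \<Longrightarrow> 0 \<in> Hom C X Y n"
  using hom_subspace subspace_0 by blast

lemma hom_scale: "\<lbrakk>X \<in> Obj C; Y \<in> Obj C; a \<in> Hom C X Y n\<rbrakk> \<Longrightarrow> Scl C c a \<in> Hom C X Y n"
  using hom_subspace subspace_scale by blast

lemma hom_add:
  "\<lbrakk>X \<in> Obj C; Y \<in> Obj C; a \<in> Hom C X Y n; b \<in> Hom C X Y n\<rbrakk> \<Longrightarrow> a + b \<in> Hom C X Y n"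
  using hom_subspace subspace_add by blast

lemma composable_scale:
  assumes "composable C Xs ns (map a [0..<d])"
  shows "composable C Xs ns (map (\<lambda>k. Scl C (c k) (a k)) [0..<d])"
proof -
  have "Scl C (c k) (a k) \<in> Hom C (Xs ! k) (Xs ! (k + 1)) (ns ! k)" if "k < d" for k
    using assms that by (intro hom_scale) (auto simp: composable_def subset_iff)
  then show ?thesis
    using assms by (auto simp: composable_def)
qed

text \<open>Scaling by 0 changes neither the argument, which is 0, nor therefore the value. This
  discards paths through off-diagonal entries of units and compositions outside the
  supports.\<close>

lemma mu_zero:
  assumes "composable C Xs ns as" "i < length as" "as ! i = 0"
  shows "Mu C Xs ns as = 0"
proof -
  have "as[i := Scl C 0 (as ! i)] = as"
    using assms(3) by (metis list_update_id scale_zero_left)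
  then show ?thesis
    using mu_scale[OF assms(1,2), of 0] by simp
qed

text \<open>Collects the signs carried by the single arguments into one factor in front of the
  operation, where exponents can be compared.\<close>

lemma mu_scale_all:
  assumes comp: "composable C Xs ns (map a [0..<d])"
  shows "Mu C Xs ns (map (\<lambda>k. Scl C (c k) (a k)) [0..<d]) =
    Scl C (\<Prod>k<d. c k) (Mu C Xs ns (map a [0..<d]))"
proof -
  \<comment> \<open>In \<open>L e\<close> only the arguments before \<open>e\<close> are scaled, so
    consecutive words differ in one argument.\<close>
  define L where "L e = map (\<lambda>k. Scl C (if k < e then c k else 1) (a k)) [0..<d]" for e
  have "Mu C Xs ns (L e) = Scl C (\<Prod>k<e. c k) (Mu C Xs ns (map a [0..<d]))" if "e \<le> d" for e
    using that
  proof (induction e)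
    case 0
    then show ?case by (simp add: L_def)
  next
    case (Suc e)
    have "L (Suc e) = (L e)[e := Scl C (c e) (L e ! e)]"
      using Suc.prems by (auto simp: L_def nth_list_update intro!: nth_equalityI)
    moreover have "composable C Xs ns (L e)"
      unfolding L_def by (rule composable_scale[OF comp])
    moreover have "e < length (L e)"
      using Suc.prems by (simp add: L_def)
    ultimately have "Mu C Xs ns (L (Suc e)) = Scl C (c e) (Mu C Xs ns (L e))"
      using mu_scale by simp
    then show ?case
      using Suc by (simp add: mult.commute)
  qed
  then have "Mu C Xs ns (L d) = Scl C (\<Prod>k<d. c k) (Mu C Xs ns (map a [0..<d]))"
    by simp
  moreover have "L d = map (\<lambda>k. Scl C (c k) (a k)) [0..<d]"
    by (simp add: L_def)
  ultimately show ?thesis by simp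
qed

end

lemma (in ainf_category) multilinear: "multilinear_category C"
  by (rule multilinear_category.intro)
    (fact scalars hom_subspace mu_add mu_scale unit_hom mu1_unit mu2_unit_right mu2_unit_left
      mu_unit_higher)+

section \<open>\<open>\<int>\<C>\<close>\<close>

lemma shift_cat_simps [simp]:
  "Obj (shift_cat C) = {X. fst ` set X \<subseteq> Obj C}"
  "Scl (shift_cat C) c f = (\<lambda>j i. Scl C c (f j i))"
  "Mu (shift_cat C) Xs ns fs = (\<lambda>j i. \<Sum>is \<in> matrix_paths Xs i j. shift_mu_term C Xs ns fs is)"
  "Unit (shift_cat C) X = (\<lambda>j i. if i = j \<and> i < length X then Unit C (summand X i) else 0)"
  by (simp_all add: shift_cat_def)

lemma shift_cat_hom:
  "f \<in> Hom (shift_cat C) X Y n \<longleftrightarrow>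
    (\<forall>j i. if i < length X \<and> j < length Y
        then f j i \<in> Hom C (summand X i) (summand Y j) (n - (shift X i - shift Y j))
        else f j i = 0)"
  by (simp add: shift_cat_def)

text \<open>The degree of the factor s in the \<open>k\<close>-th matrix entry met by the
  path.\<close>

abbreviation path_drop :: "'o formal_sum list \<Rightarrow> nat list \<Rightarrow> nat \<Rightarrow> int" where
  "path_drop Xs is k \<equiv> shift (Xs ! k) (is ! k) - shift (Xs ! Suc k) (is ! Suc k)"

text \<open>In this form the exponent is a double sum over pairs \<open>i < j\<close>, so that signs
  can be compared by rearranging sums.\<close>

lemma shift_mu_term_eq:
  "shift_mu_term C Xs ns fs is =
    Scl C (minus_one_pow (\<Sum>j<length fs. \<Sum>i<j.
        path_drop Xs is i * (ns ! j - path_drop Xs is j - 1)))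
      (Mu C (map (\<lambda>k. summand (Xs ! k) (is ! k)) [0..<Suc (length fs)])
        (map (\<lambda>k. ns ! k - path_drop Xs is k) [0..<length fs])
        (map (\<lambda>k. (fs ! k) (is ! Suc k) (is ! k)) [0..<length fs]))"
proof -
  let ?ps = "map (\<lambda>k. shift (Xs ! k) (is ! k)) [0..<length fs + 1]"
  have us: "map (\<lambda>k. ?ps ! k - ?ps ! (k + 1)) [0..<length fs] =
      map (\<lambda>k. path_drop Xs is k) [0..<length fs]"
    by (auto simp del: upt_Suc)
  have ms: "map (\<lambda>k. ns ! k - map (\<lambda>k. path_drop Xs is k) [0..<length fs] ! k) [0..<length fs] =
      map (\<lambda>k. ns ! k - path_drop Xs is k) [0..<length fs]"
    by auto
  show ?thesis
    unfolding shift_mu_term_def Let_def us ms unfolding koszul_exponent_map Suc_eq_plus1 ..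
qed

lemma shift_cat_obj_summand:
  "\<lbrakk>X \<in> Obj (shift_cat C); i < length X\<rbrakk> \<Longrightarrow> summand X i \<in> Obj C"
  by (auto simp: image_subset_iff)

text \<open>Along a path the matrices become a composable word of entries. Nothing is assumed about
  \<open>C\<close>, so this also applies with a Laurent category or a category of formal sums in its
  place.\<close>

lemma path_composable:
  assumes comp: "composable (shift_cat C) Xs ns fs" and path: "is \<in> matrix_paths Xs i j"
  shows "composable C (map (\<lambda>k. summand (Xs ! k) (is ! k)) [0..<Suc (length fs)])
        (map (\<lambda>k. ns ! k - path_drop Xs is k) [0..<length fs])
        (map (\<lambda>k. (fs ! k) (is ! Suc k) (is ! k)) [0..<length fs])"
proof -
  have len: "length Xs = length fs + 1" and obj:
      "\<And>k. k < length fs + 1 \<Longrightarrow> Xs ! k \<in> Obj (shift_cat C)"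
    using comp by (auto simp: composable_def subset_iff simp del: shift_cat_simps)
  have idx: "is ! k < length (Xs ! k)" if "k < length fs + 1" for k
    using path that len by (auto simp: matrix_paths_def)
  have "summand (Xs ! k) (is ! k) \<in> Obj C" if "k < length fs + 1" for k
    using obj[OF that] idx[OF that] by (rule shift_cat_obj_summand)
  moreover have "(fs ! k) (is ! Suc k) (is ! k) \<in>
      Hom C (summand (Xs ! k) (is ! k)) (summand (Xs ! Suc k) (is ! Suc k))
        (ns ! k - path_drop Xs is k)" if "k < length fs" for k
  proof -
    have "fs ! k \<in> Hom (shift_cat C) (Xs ! k) (Xs ! Suc k) (ns ! k)"
      using comp that by (auto simp: composable_def)
    then show ?thesis
      using idx[of k] idx[of "k + 1"] that by (auto simp: shift_cat_hom)
  qed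
  ultimately show ?thesis
    using comp by (auto simp: composable_def simp del: upt_Suc shift_cat_simps)
qed

lemma shift_cat_scalars:
  assumes "vector_space (Scl C)"
  shows "vector_space (Scl (shift_cat C))"
proof -
  interpret vector_space "Scl C" by fact
  show ?thesis
    by unfold_locales (auto simp: fun_eq_iff scale_right_distrib scale_left_distrib)
qed

lemma (in multilinear_category) shift_cat_hom_subspace:
  assumes "X \<in> Obj (shift_cat C)" "Y \<in> Obj (shift_cat C)"
  shows "module.subspace (Scl (shift_cat C)) (Hom (shift_cat C) X Y n)"
proof -
  interpret S: vector_space "Scl (shift_cat C)"
    by (rule shift_cat_scalars[OF scalars])
  note obj = shift_cat_obj_summand[OF assms(1)] shift_cat_obj_summand[OF assms(2)]
  show ?thesis
    unfolding S.subspace_def Ball_def shift_cat_hom by (simp add: obj hom_zero hom_add hom_scale)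
qed

lemma mu2_path:
  assumes "is \<in> matrix_paths [X, Y, Z] i j"
  obtains k where "is = [i, k, j]" "i < length X" "k < length Y" "j < length Z"
proof -
  obtain a b c where "is = [a, b, c]"
    using assms by (auto simp: matrix_paths_def length_Suc_conv numeral_3_eq_3)
  with assms that show thesis
    by (auto simp: matrix_paths_def All_less_Suc)
qed

text \<open>Along a single path each axiom becomes the axiom of \<open>C\<close> for the entries
  met. Units are diagonal, so only paths that repeat the index at the place of the unit
  contribute.\<close>

lemma (in multilinear_category) multilinear_shift_cat: "multilinear_category (shift_cat C)"
proof
  interpret S: vector_space "Scl (shift_cat C)"
    by (rule shift_cat_scalars[OF scalars])
  show "Scl (shift_cat C) a (x + y) = Scl (shift_cat C) a x + Scl (shift_cat C) a y"
    "Scl (shift_cat C) (a + b) x = Scl (shift_cat C) a x + Scl (shift_cat C) b x"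
    "Scl (shift_cat C) a (Scl (shift_cat C) b x) = Scl (shift_cat C) (a * b) x"
    "Scl (shift_cat C) 1 x = x" for a b x y
    by (fact S.scale_right_distrib S.scale_left_distrib S.scale_scale S.scale_one)+
  show "S.subspace (Hom (shift_cat C) X Y n)"
    if "X \<in> Obj (shift_cat C)" "Y \<in> Obj (shift_cat C)" for X Y n
    using that by (rule shift_cat_hom_subspace)
next
  fix Xs ns fs i b
  assume comp: "composable (shift_cat C) Xs ns fs" and i: "i < length fs"
    and b: "b \<in> Hom (shift_cat C) (Xs ! i) (Xs ! (i + 1)) (ns ! i)"
  show "Mu (shift_cat C) Xs ns (fs[i := fs ! i + b]) =
      Mu (shift_cat C) Xs ns fs + Mu (shift_cat C) Xs ns (fs[i := b])"
  proof (intro ext)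
    fix r c
    have "shift_mu_term C Xs ns (fs[i := fs ! i + b]) is =
        shift_mu_term C Xs ns fs is + shift_mu_term C Xs ns (fs[i := b]) is"
      if path: "is \<in> matrix_paths Xs c r" for "is"
    proof -
      let ?as = "map (\<lambda>k. (fs ! k) (is ! Suc k) (is ! k)) [0..<length fs]"
      have upd: "map (\<lambda>k. (fs[i := g] ! k) (is ! Suc k) (is ! k)) [0..<length fs] =
          ?as[i := g (is ! Suc i) (is ! i)]" for g
        using i by (auto simp: nth_list_update intro!: nth_equalityI)
      have "is ! i < length (Xs ! i)" "is ! Suc i < length (Xs ! Suc i)"
        using path comp i by (auto simp: matrix_paths_def composable_def)
      then have "b (is ! Suc i) (is ! i) \<in>
          Hom C (summand (Xs ! i) (is ! i)) (summand (Xs ! Suc i) (is ! Suc i))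
            (ns ! i - path_drop Xs is i)"
        using b by (auto simp: shift_cat_hom)
      then show ?thesis
        using mu_add[OF path_composable[OF comp path], of i "b (is ! Suc i) (is ! i)"] i
        by (simp add: shift_mu_term_eq upd scale_right_distrib del: upt_Suc)
    qed
    then show "Mu (shift_cat C) Xs ns (fs[i := fs ! i + b]) r c =
        (Mu (shift_cat C) Xs ns fs + Mu (shift_cat C) Xs ns (fs[i := b])) r c"
      by (simp add: sum.distrib)
  qed
next
  fix Xs ns fs i c
  assume comp: "composable (shift_cat C) Xs ns fs" and i: "i < length fs"
  show "Mu (shift_cat C) Xs ns (fs[i := Scl (shift_cat C) c (fs ! i)]) =
      Scl (shift_cat C) c (Mu (shift_cat C) Xs ns fs)"
  proof (intro ext)
    fix r q
    have "shift_mu_term C Xs ns (fs[i := Scl (shift_cat C) c (fs ! i)]) is =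
        Scl C c (shift_mu_term C Xs ns fs is)"
      if path: "is \<in> matrix_paths Xs q r" for "is"
    proof -
      let ?as = "map (\<lambda>k. (fs ! k) (is ! Suc k) (is ! k)) [0..<length fs]"
      have upd: "map (\<lambda>k. (fs[i := g] ! k) (is ! Suc k) (is ! k)) [0..<length fs] =
          ?as[i := g (is ! Suc i) (is ! i)]" for g
        using i by (auto simp: nth_list_update intro!: nth_equalityI)
      show ?thesis
        using mu_scale[OF path_composable[OF comp path], of i c] i
        by (simp add: shift_mu_term_eq upd mult.commute del: upt_Suc)
    qed
    then show "Mu (shift_cat C) Xs ns (fs[i := Scl (shift_cat C) c (fs ! i)]) r q =
        Scl (shift_cat C) c (Mu (shift_cat C) Xs ns fs) r q"
      by (simp add: scale_sum_right)
  qed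
next
  fix X assume X: "X \<in> Obj (shift_cat C)"
  then show unit: "Unit (shift_cat C) X \<in> Hom (shift_cat C) X X 0"
    unfolding shift_cat_hom
    using shift_cat_obj_summand[OF X] by (auto simp: unit_hom hom_zero simp del: shift_cat_simps(1))
  show "Mu (shift_cat C) [X, X] [0] [Unit (shift_cat C) X] = 0"
  proof (intro ext)
    fix j i
    have "shift_mu_term C [X, X] [0] [Unit (shift_cat C) X] is = 0"
      if path: "is \<in> matrix_paths [X, X] i j" for "is"
    proof -
      have "is = [i, j]"  "i < length X" "j < length X"
        using path by (auto simp: matrix_paths_def length_Suc_conv)
      moreover have "composable (shift_cat C) [X, X] [0] [Unit (shift_cat C) X]"
        using X unit by (simp add: composable_def)
      ultimately show ?thesis
        using mu1_unit[OF shift_cat_obj_summand[OF X]]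
          mu_zero[OF path_composable[OF _ path], of "[0]" "[Unit (shift_cat C) X]" 0]
        by (cases "i = j") (auto simp: shift_mu_term_eq)
    qed
    then show "Mu (shift_cat C) [X, X] [0] [Unit (shift_cat C) X] j i = 0 j i" by simp
  qed
next
  fix X Y f n
  assume X: "X \<in> Obj (shift_cat C)" and Y: "Y \<in> Obj (shift_cat C)"
    and f: "f \<in> Hom (shift_cat C) X Y n"
  have unit: "Unit (shift_cat C) Z \<in> Hom (shift_cat C) Z Z 0" if "Z \<in> Obj (shift_cat C)" for Z
    unfolding shift_cat_hom
    using shift_cat_obj_summand[OF that]
    by (auto simp: unit_hom hom_zero that simp del: shift_cat_simps(1))
  have entry: "f j i \<in> Hom C (summand X i) (summand Y j) (n - (shift X i - shift Y j))"
    if "i < length X" "j < length Y" for i j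
    using f that by (simp add: shift_cat_hom)
  have comp1: "composable (shift_cat C) [X, X, Y] [0, n] [Unit (shift_cat C) X, f]"
    using X Y unit[OF X] f
    by (auto simp: composable_def less_Suc_eq_0_disj simp del: shift_cat_simps)
  have comp2: "composable (shift_cat C) [X, Y, Y] [n, 0] [f, Unit (shift_cat C) Y]"
    using X Y unit[OF Y] f
    by (auto simp: composable_def less_Suc_eq_0_disj simp del: shift_cat_simps)
  show "Mu (shift_cat C) [X, X, Y] [0, n] [Unit (shift_cat C) X, f] = f"
  proof (intro ext)
    fix j i
    let ?P = "matrix_paths [X, X, Y] i j"
    let ?t = "shift_mu_term C [X, X, Y] [0, n] [Unit (shift_cat C) X, f]"
    show "Mu (shift_cat C) [X, X, Y] [0, n] [Unit (shift_cat C) X, f] j i = f j i"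
    proof (cases "i < length X \<and> j < length Y")
      case True
      \<comment> \<open>Any other path passes through an off-diagonal entry of the unit.\<close>
      have "?t is = 0" if path: "is \<in> ?P" and ne: "is \<noteq> [i, i, j]" for "is"
      proof -
        obtain k where k: "is = [i, k, j]" using mu2_path[OF path] by blast
        then show ?thesis
          using mu_zero[OF path_composable[OF comp1 path], of 0] ne
          by (auto simp: shift_mu_term_eq)
      qed
      moreover have "[i, i, j] \<in> ?P"
        using True by (auto simp: matrix_paths_def less_Suc_eq_0_disj)
      ultimately have "(\<Sum>is \<in> ?P. ?t is) = ?t [i, i, j]"
        by (subst sum.mono_neutral_right[of _ "{[i, i, j]}"]) auto
      also have "\<dots> = f j i"
        using mu2_unit_right[OF _ _ entry] True
          shift_cat_obj_summand[OF X, of i] shift_cat_obj_summand[OF Y, of j]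
        by (simp add: shift_mu_term_eq lessThan_Suc numeral_2_eq_2)
      finally show ?thesis by simp
    next
      case False
      then have "?P = {}"
        using matrix_paths_range[of _ "[X, X, Y]" i j] by auto
      then show ?thesis
        using f False by (auto simp: shift_cat_hom)
    qed
  qed
  show "Scl (shift_cat C) (minus_one_pow n)
      (Mu (shift_cat C) [X, Y, Y] [n, 0] [f, Unit (shift_cat C) Y]) = f"
  proof (intro ext)
    fix j i
    let ?P = "matrix_paths [X, Y, Y] i j"
    let ?t = "shift_mu_term C [X, Y, Y] [n, 0] [f, Unit (shift_cat C) Y]"
    show "Scl (shift_cat C) (minus_one_pow n)
      (Mu (shift_cat C) [X, Y, Y] [n, 0] [f, Unit (shift_cat C) Y]) j i = f j i"
    proof (cases "i < length X \<and> j < length Y")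
      case True
      let ?u = "shift X i - shift Y j"
      have "?t is = 0" if path: "is \<in> ?P" and ne: "is \<noteq> [i, j, j]" for "is"
      proof -
        obtain k where k: "is = [i, k, j]" using mu2_path[OF path] by blast
        then show ?thesis
          using mu_zero[OF path_composable[OF comp2 path], of 1] ne
          by (auto simp: shift_mu_term_eq)
      qed
      moreover have "[i, j, j] \<in> ?P"
        using True by (auto simp: matrix_paths_def less_Suc_eq_0_disj)
      ultimately have "(\<Sum>is \<in> ?P. ?t is) = ?t [i, j, j]"
        by (subst sum.mono_neutral_right[of _ "{[i, j, j]}"]) auto
      \<comment> \<open>The factor s of degree \<open>?u\<close> passes a unit, whose reduced degree
        is -1. The resulting exponent \<open>- ?u\<close> turns \<open>n\<close> into the degree
        \<open>n - ?u\<close> of the entry, as the left unit law of \<open>C\<close>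
        requires.\<close>
      also have "\<dots> = Scl C (minus_one_pow (- ?u)) (Mu C
          [summand X i, summand Y j, summand Y j] [n - ?u, 0] [f j i, Unit C (summand Y j)])"
        using True by (simp add: shift_mu_term_eq lessThan_Suc numeral_2_eq_2)
      finally have "Scl C (minus_one_pow n) (\<Sum>is \<in> ?P. ?t is) =
          Scl C (minus_one_pow (n - ?u)) (Mu C
          [summand X i, summand Y j, summand Y j] [n - ?u, 0] [f j i, Unit C (summand Y j)])"
        by (simp add: algebra_simps flip: minus_one_pow_add)
      also have "\<dots> = f j i"
        using mu2_unit_left[OF _ _ entry] True
          shift_cat_obj_summand[OF X, of i] shift_cat_obj_summand[OF Y, of j] by simp
      finally show ?thesis by simp
    next
      case False
      then have "?P = {}"
        using matrix_paths_range[of _ "[X, Y, Y]" i j] by auto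
      then show ?thesis
        using f False by (auto simp: shift_cat_hom)
    qed
  qed
next
  fix Xs ns fs i
  assume comp: "composable (shift_cat C) Xs ns fs" and len: "3 \<le> length fs" and i: "i < length fs"
    and eq: "Xs ! (i + 1) = Xs ! i" "ns ! i = 0" "fs ! i = Unit (shift_cat C) (Xs ! i)"
  have "shift_mu_term C Xs ns fs is = 0" if path: "is \<in> matrix_paths Xs c r" for "is" c r
  \<comment> \<open>A path that stays at its index meets a unit of \<open>C\<close>; a path that
    changes it meets a zero entry.\<close>
  proof (cases "is ! i = is ! Suc i")
    case True
    have "is ! i < length (Xs ! i)"
      using path comp i by (auto simp: matrix_paths_def composable_def)
    then show ?thesis
      using mu_unit_higher[OF path_composable[OF comp path], of i] True i len eq
      by (simp add: shift_mu_term_eq del: upt_Suc)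
  next
    case False
    then show ?thesis
      using mu_zero[OF path_composable[OF comp path], of i] i eq
      by (simp add: shift_mu_term_eq del: upt_Suc)
  qed
  then show "Mu (shift_cat C) Xs ns fs = 0"
    by (auto simp: fun_eq_iff)
qed

section \<open>\<open>k[t, t\<^sup>-\<^sup>1] \<otimes> \<C>\<close>\<close>

text \<open>The exponents of t enter the sign as the degrees of the factors s do in
  \<open>shift_mu_term_eq\<close>. This parallel is what makes the two kinds of shift
  comparable.\<close>

definition laurent_mu_term ::
  "('k::field, 'o, 'm) ainf \<Rightarrow> 'o list \<Rightarrow> int list \<Rightarrow> (int \<Rightarrow> 'm) list \<Rightarrow> int list \<Rightarrow> 'm" where
  "laurent_mu_term C Xs ns fs ls =
    Scl C (minus_one_pow (\<Sum>j<length fs. \<Sum>i<j. ls ! i * (ns ! j - ls ! j - 1)))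
      (Mu C Xs (map (\<lambda>k. ns ! k - ls ! k) [0..<length fs])
        (map (\<lambda>k. (fs ! k) (ls ! k)) [0..<length fs]))"

lemma laurent_cat_simps [simp]:
  "Obj (laurent_cat C) = Obj C"
  "Scl (laurent_cat C) c f = (\<lambda>l. Scl C c (f l))"
  "Unit (laurent_cat C) X = (\<lambda>l. if l = 0 then Unit C X else 0)"
  by (simp_all add: laurent_cat_def)

lemma laurent_cat_hom:
  "f \<in> Hom (laurent_cat C) X Y n \<longleftrightarrow>
    finite {l. f l \<noteq> 0} \<and> (\<forall>l. f l \<in> Hom C X Y (n - l))"
  by (simp add: laurent_cat_def)

lemma laurent_mu:
  "Mu (laurent_cat C) Xs ns fs =
    (\<lambda>\<beta>. \<Sum>ls \<in> compositions (length fs) \<beta> (\<lambda>k. {l. (fs ! k) l \<noteq> 0}). laurent_mu_term C Xs ns fs ls)"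
  by (auto simp: laurent_cat_def laurent_mu_term_def compositions_def Let_def koszul_exponent_map'
      intro!: ext sum.cong)

lemma laurent_term_composable:
  assumes "composable (laurent_cat C) Xs ns fs"
  shows "composable C Xs (map (\<lambda>k. ns ! k - ls ! k) [0..<length fs])
    (map (\<lambda>k. (fs ! k) (ls ! k)) [0..<length fs])"
  using assms by (auto simp: composable_def laurent_cat_hom)

lemma laurent_support_finite:
  assumes "composable (laurent_cat C) Xs ns fs" "k < length fs"
  shows "finite {l. (fs ! k) l \<noteq> 0}"
  using assms by (auto simp: composable_def laurent_cat_hom)

lemma laurent_cat_scalars:
  assumes "vector_space (Scl C)"
  shows "vector_space (Scl (laurent_cat C))"
proof -
  interpret vector_space "Scl C" by fact
  show ?thesis
    by unfold_locales (auto simp: fun_eq_iff scale_right_distrib scale_left_distrib)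
qed

context multilinear_category
begin

lemma laurent_cat_hom_subspace:
  assumes "X \<in> Obj (laurent_cat C)" "Y \<in> Obj (laurent_cat C)"
  shows "module.subspace (Scl (laurent_cat C)) (Hom (laurent_cat C) X Y n)"
proof -
  interpret S: vector_space "Scl (laurent_cat C)"
    by (rule laurent_cat_scalars[OF scalars])
  have "finite {l. f l + g l \<noteq> 0}" if "finite {l. f l \<noteq> 0}" "finite {l. g l \<noteq> 0}" for f g ::
      "int \<Rightarrow> 'm"
    by (rule finite_subset[OF _ finite_UnI[OF that]]) auto
  moreover have "finite {l. Scl C c (f l) \<noteq> 0}" if "finite {l. f l \<noteq> 0}" for c f
    by (rule finite_subset[OF _ that]) auto
  ultimately show ?thesis
    using assms unfolding S.subspace_def Ball_def laurent_cat_hom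
    by (auto simp: hom_zero hom_add hom_scale simp del: scale_eq_0_iff)
qed

text \<open>Supports change under addition and scaling, so the defining sums of the two sides of a
  linearity statement run over different sets. Added compositions have a vanishing argument, and
  over a common superset the sums can be compared term by term.\<close>

lemma laurent_mu_superset:
  assumes comp: "composable (laurent_cat C) Xs ns fs"
    and S: "\<And>k. k < length fs \<Longrightarrow> finite (S k) \<and> {l. (fs ! k) l \<noteq> 0} \<subseteq> S k"
  shows "Mu (laurent_cat C) Xs ns fs \<beta> =
    (\<Sum>ls \<in> compositions (length fs) \<beta> S. laurent_mu_term C Xs ns fs ls)"
  unfolding laurent_mu
proof (rule sum.mono_neutral_left)
  show "finite (compositions (length fs) \<beta> S)"
    by (rule finite_compositions) (use S in auto)
  show "compositions (length fs) \<beta> (\<lambda>k. {l. (fs ! k) l \<noteq> 0}) \<subseteq> compositions (length fs) \<beta> S"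
    using S by (auto simp: compositions_def)
  show "\<forall>ls \<in> compositions (length fs) \<beta> S -
      compositions (length fs) \<beta> (\<lambda>k. {l. (fs ! k) l \<noteq> 0}). laurent_mu_term C Xs ns fs ls = 0"
  proof
    fix ls
    assume "ls \<in> compositions (length fs) \<beta> S -
      compositions (length fs) \<beta> (\<lambda>k. {l. (fs ! k) l \<noteq> 0})"
    then obtain k where "k < length fs" "(fs ! k) (ls ! k) = 0"
      by (auto simp: compositions_def)
    then show "laurent_mu_term C Xs ns fs ls = 0"
      using mu_zero[OF laurent_term_composable[OF comp], of k ls] by (simp add: laurent_mu_term_def)
  qed
qed

lemma multilinear_laurent_cat: "multilinear_category (laurent_cat C)"
proof
  interpret S: vector_space "Scl (laurent_cat C)"
    by (rule laurent_cat_scalars[OF scalars])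
  show "Scl (laurent_cat C) a (x + y) = Scl (laurent_cat C) a x + Scl (laurent_cat C) a y"
    "Scl (laurent_cat C) (a + b) x = Scl (laurent_cat C) a x + Scl (laurent_cat C) b x"
    "Scl (laurent_cat C) a (Scl (laurent_cat C) b x) = Scl (laurent_cat C) (a * b) x"
    "Scl (laurent_cat C) 1 x = x" for a b x y
    by (fact S.scale_right_distrib S.scale_left_distrib S.scale_scale S.scale_one)+
  show sub: "S.subspace (Hom (laurent_cat C) X Y n)"
    if "X \<in> Obj (laurent_cat C)" "Y \<in> Obj (laurent_cat C)" for X Y n
    using that by (rule laurent_cat_hom_subspace)
  have upd: "composable (laurent_cat C) Xs ns (fs[i := b])"
    if "composable (laurent_cat C) Xs ns fs" "i < length fs"
       "b \<in> Hom (laurent_cat C) (Xs ! i) (Xs ! (i + 1)) (ns ! i)" for Xs ns fs i b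
    using that by (auto simp: composable_def nth_list_update)
  show "Mu (laurent_cat C) Xs ns (fs[i := fs ! i + b]) =
      Mu (laurent_cat C) Xs ns fs + Mu (laurent_cat C) Xs ns (fs[i := b])"
    if comp: "composable (laurent_cat C) Xs ns fs" and i: "i < length fs"
      and b: "b \<in> Hom (laurent_cat C) (Xs ! i) (Xs ! (i + 1)) (ns ! i)" for Xs ns fs i b
  proof
    fix \<beta>
    \<comment> \<open>Contains the supports of \<open>fs ! i\<close>, of \<open>b\<close> and of
      their sum.\<close>
    let ?S = "\<lambda>k. {l. (fs ! k) l \<noteq> 0} \<union> (if k = i then {l. b l \<noteq> 0} else {})"
    have fin: "finite (?S k)" if "k < length fs" for k
      using laurent_support_finite[OF comp that] b by (auto simp: laurent_cat_hom)
    have fi: "fs ! i \<in> Hom (laurent_cat C) (Xs ! i) (Xs ! (i + 1)) (ns ! i)"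
      and ob: "Xs ! i \<in> Obj (laurent_cat C)" "Xs ! (i + 1) \<in> Obj (laurent_cat C)"
      using comp i by (auto simp: composable_def subset_iff)
    have sum: "fs ! i + b \<in> Hom (laurent_cat C) (Xs ! i) (Xs ! (i + 1)) (ns ! i)"
      using S.subspace_add[OF sub[OF ob] fi b] .
    have term_eq: "laurent_mu_term C Xs ns (fs[i := fs ! i + b]) ls =
        laurent_mu_term C Xs ns fs ls + laurent_mu_term C Xs ns (fs[i := b]) ls" for ls
    proof -
      let ?as = "map (\<lambda>k. (fs ! k) (ls ! k)) [0..<length fs]"
      have upd: "map (\<lambda>k. (fs[i := g] ! k) (ls ! k)) [0..<length fs] = ?as[i := g (ls ! i)]" for g
        using i by (auto simp: nth_list_update intro!: nth_equalityI)
      show ?thesis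
        using mu_add[OF laurent_term_composable[OF comp], where i = i and b =
            "b (ls ! i)" and ls1 = ls] i b
        by (simp add: laurent_mu_term_def upd scale_right_distrib laurent_cat_hom)
    qed
    have "Mu (laurent_cat C) Xs ns g \<beta> =
        (\<Sum>ls \<in> compositions (length fs) \<beta> ?S. laurent_mu_term C Xs ns g ls)"
      if "g \<in> {fs, fs[i := b], fs[i := fs ! i + b]}" for g
    proof -
      have len: "length g = length fs" using that by auto
      have "composable (laurent_cat C) Xs ns g"
        using that comp upd[OF comp i b] upd[OF comp i sum] by auto
      then show ?thesis
        by (subst laurent_mu_superset[where S = ?S])
          (use that fin i in \<open>auto simp: len nth_list_update\<close>)
    qed
    then show "Mu (laurent_cat C) Xs ns (fs[i := fs ! i + b]) \<beta> =
        (Mu (laurent_cat C) Xs ns fs + Mu (laurent_cat C) Xs ns (fs[i := b])) \<beta>"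
      by (simp add: sum.distrib term_eq)
  qed
  show "Mu (laurent_cat C) Xs ns (fs[i := Scl (laurent_cat C) c (fs ! i)]) =
      Scl (laurent_cat C) c (Mu (laurent_cat C) Xs ns fs)"
    if comp: "composable (laurent_cat C) Xs ns fs" and i: "i < length fs" for Xs ns fs i c
  proof
    fix \<beta>
    \<comment> \<open>The supports before scaling; for \<open>c = 0\<close> the support of the
      scaled argument is smaller.\<close>
    let ?S = "\<lambda>k. {l. (fs ! k) l \<noteq> 0}"
    let ?g = "fs[i := Scl (laurent_cat C) c (fs ! i)]"
    have fi: "fs ! i \<in> Hom (laurent_cat C) (Xs ! i) (Xs ! (i + 1)) (ns ! i)"
      and ob: "Xs ! i \<in> Obj (laurent_cat C)" "Xs ! (i + 1) \<in> Obj (laurent_cat C)"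
      using comp i by (auto simp: composable_def subset_iff)
    have g: "composable (laurent_cat C) Xs ns ?g"
      using upd[OF comp i S.subspace_scale[OF sub[OF ob] fi]] .
    have term_eq: "laurent_mu_term C Xs ns ?g ls = Scl C c (laurent_mu_term C Xs ns fs ls)" for ls
    proof -
      let ?as = "map (\<lambda>k. (fs ! k) (ls ! k)) [0..<length fs]"
      have upd: "map (\<lambda>k. (fs[i := g] ! k) (ls ! k)) [0..<length fs] = ?as[i := g (ls ! i)]" for g
        using i by (auto simp: nth_list_update intro!: nth_equalityI)
      show ?thesis
        using mu_scale[OF laurent_term_composable[OF comp], of i ls c] i
        by (simp add: laurent_mu_term_def upd mult.commute)
    qed
    have "Mu (laurent_cat C) Xs ns ?g \<beta> =
        (\<Sum>ls \<in> compositions (length fs) \<beta> ?S. laurent_mu_term C Xs ns ?g ls)"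
      by (subst laurent_mu_superset[OF g, where S = ?S])
        (use laurent_support_finite[OF comp] i in \<open>auto simp: nth_list_update split: if_splits\<close>)
    also have "\<dots> = Scl (laurent_cat C) c (Mu (laurent_cat C) Xs ns fs) \<beta>"
      unfolding term_eq by (simp add: scale_sum_right laurent_mu)
    finally show "Mu (laurent_cat C) Xs ns ?g \<beta> =
        Scl (laurent_cat C) c (Mu (laurent_cat C) Xs ns fs) \<beta>" .
  qed
  show unit: "Unit (laurent_cat C) X \<in> Hom (laurent_cat C) X X 0" if "X \<in> Obj (laurent_cat C)" for X
  proof -
    have "finite {l. Unit (laurent_cat C) X l \<noteq> 0}"
      by (rule finite_subset[of _ "{0}"]) auto
    then show ?thesis
      using that by (auto simp: laurent_cat_hom unit_hom hom_zero)
  qed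
  show "Mu (laurent_cat C) [X, X] [0] [Unit (laurent_cat C) X] = 0"
    if X: "X \<in> Obj (laurent_cat C)" for X
  proof
    fix \<beta>
    have comp: "composable (laurent_cat C) [X, X] [0] [Unit (laurent_cat C) X]"
      using X unit[OF X] by (simp add: composable_def)
    have "laurent_mu_term C [X, X] [0] [Unit (laurent_cat C) X] ls = 0"
      if "ls \<in> compositions 1 \<beta> (\<lambda>_. {0})" for ls
    proof -
      have "ls = [0]"
        using that by (auto simp: compositions_def length_Suc_conv)
      then show ?thesis
        using mu1_unit X by (simp add: laurent_mu_term_def)
    qed
    then show "Mu (laurent_cat C) [X, X] [0] [Unit (laurent_cat C) X] \<beta> = 0 \<beta>"
      by (subst laurent_mu_superset[OF comp, of "\<lambda>_. {0}"]) auto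
  qed
  show "Mu (laurent_cat C) [X, X, Y] [0, n] [Unit (laurent_cat C) X, f] = f"
    if X: "X \<in> Obj (laurent_cat C)" and Y: "Y \<in> Obj (laurent_cat C)"
      and f: "f \<in> Hom (laurent_cat C) X Y n" for X Y f n
  proof
    fix \<beta>
    let ?fs = "[Unit (laurent_cat C) X, f]"
    \<comment> \<open>With \<open>\<beta>\<close> inserted the only composition is
      \<open>[0, \<beta>]\<close>, whether or not \<open>f \<beta>\<close> vanishes.\<close>
    let ?S = "\<lambda>k :: nat. if k = 0 then {0} else insert \<beta> {l. f l \<noteq> 0}"
    have comp: "composable (laurent_cat C) [X, X, Y] [0, n] ?fs"
      using X Y unit[OF X] f by (auto simp: composable_def less_Suc_eq_0_disj)
    have C: "compositions 2 \<beta> ?S = {[0, \<beta>]}"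
      by (auto simp: compositions_def length_Suc_conv numeral_2_eq_2 All_less_Suc)
    have "Mu (laurent_cat C) [X, X, Y] [0, n] ?fs \<beta> =
        (\<Sum>ls \<in> compositions (length ?fs) \<beta> ?S. laurent_mu_term C [X, X, Y] [0, n] ?fs ls)"
      using f by (intro laurent_mu_superset[OF comp])
        (auto simp: laurent_cat_hom less_Suc_eq_0_disj split: if_splits)
    also have "\<dots> = f \<beta>"
      using mu2_unit_right[of X Y "f \<beta>" "n - \<beta>"] X Y f C
      by (simp add: laurent_mu_term_def lessThan_Suc numeral_2_eq_2 laurent_cat_hom)
    finally show "Mu (laurent_cat C) [X, X, Y] [0, n] ?fs \<beta> = f \<beta>" .
  qed
  show "Scl (laurent_cat C) (minus_one_pow n)
      (Mu (laurent_cat C) [X, Y, Y] [n, 0] [f, Unit (laurent_cat C) Y]) = f"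
    if X: "X \<in> Obj (laurent_cat C)" and Y: "Y \<in> Obj (laurent_cat C)"
      and f: "f \<in> Hom (laurent_cat C) X Y n" for X Y f n
  proof
    fix \<beta>
    let ?fs = "[f, Unit (laurent_cat C) Y]"
    let ?S = "\<lambda>k :: nat. if k = 0 then insert \<beta> {l. f l \<noteq> 0} else {0}"
    have comp: "composable (laurent_cat C) [X, Y, Y] [n, 0] ?fs"
      using X Y unit[OF Y] f by (auto simp: composable_def less_Suc_eq_0_disj)
    have C: "compositions 2 \<beta> ?S = {[\<beta>, 0]}"
      by (auto simp: compositions_def length_Suc_conv numeral_2_eq_2 All_less_Suc)
    have "Mu (laurent_cat C) [X, Y, Y] [n, 0] ?fs \<beta> =
        (\<Sum>ls \<in> compositions (length ?fs) \<beta> ?S. laurent_mu_term C [X, Y, Y] [n, 0] ?fs ls)"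
      using f by (intro laurent_mu_superset[OF comp])
        (auto simp: laurent_cat_hom less_Suc_eq_0_disj split: if_splits)
    also have "\<dots> = Scl C (minus_one_pow (- \<beta>)) (Mu C [X, Y, Y] [n - \<beta>, 0] [f \<beta>, Unit C Y])"
      using C by (simp add: laurent_mu_term_def lessThan_Suc numeral_2_eq_2)
    finally have "Scl C (minus_one_pow n) (Mu (laurent_cat C) [X, Y, Y] [n, 0] ?fs \<beta>) =
        Scl C (minus_one_pow (n - \<beta>)) (Mu C [X, Y, Y] [n - \<beta>, 0] [f \<beta>, Unit C Y])"
      by (simp flip: minus_one_pow_add)
    also have "\<dots> = f \<beta>"
      using mu2_unit_left[of X Y "f \<beta>" "n - \<beta>"] X Y f by (simp add: laurent_cat_hom)
    finally show "Scl (laurent_cat C) (minus_one_pow n)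
      (Mu (laurent_cat C) [X, Y, Y] [n, 0] ?fs) \<beta> = f \<beta>" by simp
  qed
  show "Mu (laurent_cat C) Xs ns fs = 0"
    if comp: "composable (laurent_cat C) Xs ns fs" and len: "3 \<le> length fs" and i: "i < length fs"
      and eq: "Xs ! (i + 1) = Xs ! i" "ns ! i = 0" "fs ! i = Unit (laurent_cat C) (Xs ! i)"
    for Xs ns fs i
  proof -
    have "laurent_mu_term C Xs ns fs ls = 0" for ls
    proof (cases "ls ! i = 0")
      case True
      then show ?thesis
        using mu_unit_higher[OF laurent_term_composable[OF comp], where i = i and ls1 = ls] i len eq
        by (simp add: laurent_mu_term_def)
    next
      case False
      then show ?thesis
        using mu_zero[OF laurent_term_composable[OF comp], of i ls] i eq
        by (simp add: laurent_mu_term_def)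
    qed
    then show ?thesis
      by (simp add: laurent_mu fun_eq_iff)
  qed
qed

end

section \<open>The isomorphism \<open>\<int>\<A> * \<int> \<cong> \<int>(k[t, t\<^sup>-\<^sup>1] \<otimes> \<A>)\<close>\<close>

lemma sum_apply: "(\<Sum>a\<in>S. f a) x = (\<Sum>a\<in>S. f a x)"
  by (induction S rule: infinite_finite_induct) auto

lemma length_map_morphisms [simp]: "length (map_morphisms F Xs ns as) = length as"
  by (simp add: map_morphisms_def)

text \<open>Assumes only that objects and morphism spaces are preserved, so that it can be used
  while the functor equations are still being proved.\<close>

lemma composable_map_morphisms:
  assumes "\<And>X. X \<in> Obj C \<Longrightarrow> On_obj F X \<in> Obj D"
    and "\<And>X Y n a. \<lbrakk>X \<in> Obj C; Y \<in> Obj C; a \<in> Hom C X Y n\<rbrakk> \<Longrightarrow>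
         On_hom F X Y n a \<in> Hom D (On_obj F X) (On_obj F Y) n"
    and "composable C Xs ns as"
  shows "composable D (map (On_obj F) Xs) ns (map_morphisms F Xs ns as)"
  using assms unfolding composable_def map_morphisms_def by (auto simp: subset_iff)

section \<open>The quadratic exponent and the two mutually inverse maps\<close>

definition choose2 :: "int \<Rightarrow> int" where
  "choose2 l = l * (l - 1) div 2"

text \<open>Doubling removes the integer division, which is exact because \<open>l * (l - 1)\<close>
  is even, also for negative \<open>l\<close>.\<close>

lemma choose2_add: "choose2 (a + b) = choose2 a + choose2 b + a * b"
proof -
  have double: "2 * choose2 l = l * (l - 1)" for l
    unfolding choose2_def by simp
  have "2 * choose2 (a + b) = 2 * (choose2 a + choose2 b + a * b)"
    unfolding distrib_left double by (simp add: algebra_simps)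
  then show ?thesis by simp
qed

lemma choose2_0 [simp]: "choose2 0 = 0"
  by (simp add: choose2_def)

lemma choose2_sum:
  "choose2 (\<Sum>k<d. l k) = (\<Sum>k<d. choose2 (l k)) + (\<Sum>j<d. \<Sum>i<j. l i * l j)" for d :: nat
  by (induction d) (simp_all add: choose2_add sum_distrib_right)

text \<open>Apart from the sign only the order of the indices changes: the shift by \<open>l\<close>
  of the source lowers the degree of an entry by \<open>l\<close>, exactly as the factor t^l does.
  The map ignores its objects and degree and is linear on all functions, which
  \<open>shift_map_functor\<close> relies on.\<close>

definition skew_to_laurent ::
  "('k::field, 'o, 'm::ab_group_add) ainf \<Rightarrow>
     ('o formal_sum, int \<Rightarrow> 'm matrix, 'o formal_sum, (int \<Rightarrow> 'm) matrix) strict_fun" where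
  "skew_to_laurent A =
    \<lparr>On_obj = \<lambda>X. X, On_hom = \<lambda>X Y n f j i l. Scl A (minus_one_pow (choose2 l)) (f l j i)\<rparr>"

definition laurent_to_skew ::
  "('k::field, 'o, 'm::ab_group_add) ainf \<Rightarrow>
     ('o formal_sum, (int \<Rightarrow> 'm) matrix, 'o formal_sum, int \<Rightarrow> 'm matrix) strict_fun" where
  "laurent_to_skew A =
    \<lparr>On_obj = \<lambda>X. X, On_hom = \<lambda>X Y n g l j i. Scl A (minus_one_pow (choose2 l)) (g j i l)\<rparr>"

lemma shift_action_obj [simp]:
  "length (On_obj (shift_action A l) X) = length X"
  "i < length X \<Longrightarrow> On_obj (shift_action A l) X ! i = (summand X i, shift X i + l)"
  by (auto simp: shift_action_def split: prod.split)

lemma shift_action_hom [simp]: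
  "On_hom (shift_action A l) X Y n f j i = Scl A (minus_one_pow (l * (shift X i - shift Y j)))
      (f j i)"
  by (simp add: shift_action_def)

abbreviation skew_shift ::
  "('k::field, 'o, 'm::ab_group_add) ainf \<Rightarrow> ('k, 'o formal_sum, int \<Rightarrow> 'm matrix) ainf" where
  "skew_shift A \<equiv> skew_cat (shift_cat A) (shift_action A)"

lemma skew_cat_simps [simp]:
  "Obj (skew_cat C \<sigma>) = Obj C"
  "Scl (skew_cat C \<sigma>) c f = (\<lambda>l. Scl C c (f l))"
  "Unit (skew_cat C \<sigma>) X = (\<lambda>l. if l = 0 then Unit C X else 0)"
  by (simp_all add: skew_cat_def)

lemma skew_cat_hom:
  "f \<in> Hom (skew_cat C \<sigma>) X Y n \<longleftrightarrow>
    finite {l. f l \<noteq> 0} \<and> (\<forall>l. f l \<in> Hom C (On_obj (\<sigma> l) X) Y n)"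
  by (simp add: skew_cat_def)

lemma skew_shift_hom:
  "f \<in> Hom (skew_shift A) X Y n \<longleftrightarrow>
    finite {l. f l \<noteq> 0} \<and>
    (\<forall>l j i. if i < length X \<and> j < length Y
        then f l j i \<in> Hom A (summand X i) (summand Y j) (n - (shift X i - shift Y j) - l)
        else f l j i = 0)"
  by (auto simp: skew_cat_hom shift_cat_hom algebra_simps)

lemma skew_mu:
  "Mu (skew_cat C \<sigma>) Xs ns fs =
    (\<lambda>l. \<Sum>ls \<in> compositions (length fs) l (\<lambda>k. {l. (fs ! k) l \<noteq> 0}).
      Mu C (map (\<lambda>k. On_obj (\<sigma> (sum_list (drop k ls))) (Xs ! k)) [0..<length fs + 1]) ns
        (map (\<lambda>k. On_hom (\<sigma> (sum_list (drop (k + 1) ls)))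
                        (On_obj (\<sigma> (ls ! k)) (Xs ! k)) (Xs ! (k + 1)) (ns ! k)
                        ((fs ! k) (ls ! k))) [0..<length fs]))"
  by (simp add: skew_cat_def compositions_def)

section \<open>Comparison of the signs on both sides of the isomorphism\<close>

lemma sum_list_drop_Suc:
  "k < length ls \<Longrightarrow> sum_list (drop k ls) = ls ! k + sum_list (drop (Suc k) ls)"
  by (metis Cons_nth_drop_Suc sum_list.Cons)

text \<open>The \<open>k\<close>-th argument is acted on by the product of all later group elements.
  Sorting the resulting signs by the later element gives a sum over pairs \<open>i < j\<close>, the
  shape of a Koszul exponent.\<close>

lemma sum_drop_mult:
  fixes w :: "nat \<Rightarrow> int"
  shows "(\<Sum>k<length ls. sum_list (drop (Suc k) ls) * w k) = (\<Sum>j<length ls. \<Sum>i<j. ls ! j * w i)"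
proof (induction ls rule: rev_induct)
  case (snoc l ls)
  then show ?case
    by (simp add: nth_append distrib_right sum.distrib sum_distrib_left)
qed simp

context multilinear_category
begin

text \<open>For a fixed path and fixed powers of \<sigma>, both sides are signed multiples of one
  value of the operation of \<open>C\<close>, so only parities matter. On the left the Koszul sign
  uses the drops \<open>u i + l i\<close>, and the action adds the sum of
  \<open>l j * (u i + l i)\<close>; on the right the outer sign sees the degrees
  \<open>m j + l j\<close>. The terms \<open>u i * l j\<close> agree, and the remaining products
  \<open>l i * l j\<close> meet those of \<open>choose2_sum\<close>, leaving an even number.\<close>

lemma skew_term:
  assumes comp: "composable (skew_shift C) Xs ns fs" and path: "is \<in> matrix_paths Xs i j"
    and ls: "length ls = length fs"
  shows "Scl C (minus_one_pow (choose2 (sum_list ls)))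
      (shift_mu_term C
        (map (\<lambda>k. On_obj (shift_action C (sum_list (drop k ls))) (Xs ! k)) [0..<length fs + 1]) ns
        (map (\<lambda>k. On_hom (shift_action C (sum_list (drop (k + 1) ls)))
                        (On_obj (shift_action C (ls ! k)) (Xs ! k)) (Xs ! (k + 1)) (ns ! k)
                        ((fs ! k) (ls ! k))) [0..<length fs]) is) =
    Scl C (minus_one_pow (\<Sum>j<length fs. \<Sum>i<j.
        path_drop Xs is i * (ns ! j - path_drop Xs is j - 1)))
      (laurent_mu_term C (map (\<lambda>k. summand (Xs ! k) (is ! k)) [0..<Suc (length fs)])
        (map (\<lambda>k. ns ! k - path_drop Xs is k) [0..<length fs])
        (map (\<lambda>k l. Scl C (minus_one_pow (choose2 l)) ((fs ! k) l (is ! Suc k) (is ! k)))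
           [0..<length fs]) ls)"
proof -
  define d where "d = length fs"
  define u where "u k = path_drop Xs is k" for k
  define l where "l k = ls ! k" for k
  \<comment> \<open>The degree in \<open>C\<close> of the entry \<open>a k\<close>, once the degree
    of s and the power of \<sigma> are removed.\<close>
  define m where "m k = ns ! k - u k - l k" for k
  define a where "a k = (fs ! k) (ls ! k) (is ! Suc k) (is ! k)" for k
  let ?Ys = "map (\<lambda>k. On_obj (shift_action C (sum_list (drop k ls))) (Xs ! k)) [0..<length fs + 1]"
  let ?gs = "map (\<lambda>k. On_hom (shift_action C (sum_list (drop (k + 1) ls)))
                        (On_obj (shift_action C (ls ! k)) (Xs ! k)) (Xs ! (k + 1)) (ns ! k)
                        ((fs ! k) (ls ! k))) [0..<length fs]"
  let ?Zs = "map (\<lambda>k. summand (Xs ! k) (is ! k)) [0..<Suc (length fs)]"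
  have len: "length Xs = Suc d" "length ns = d" "length fs = d" "length ls = d"
    using comp ls by (auto simp: composable_def d_def)
  have idx: "is ! k < length (Xs ! k)" if "k < Suc d" for k
    using path that len by (auto simp: matrix_paths_def)
  have hom: "a k \<in> Hom C (?Zs ! k) (?Zs ! Suc k) (m k)" if "k < d" for k
  proof -
    have "fs ! k \<in> Hom (skew_shift C) (Xs ! k) (Xs ! Suc k) (ns ! k)"
      using comp that by (auto simp: composable_def d_def)
    then show ?thesis
      using idx[of k] idx[of "Suc k"] that len
      by (auto simp: skew_shift_hom a_def m_def u_def l_def simp del: upt_Suc)
  qed
  have comp': "composable C ?Zs (map m [0..<d]) (map a [0..<d])"
  proof -
    have "summand (Xs ! k) (is ! k) \<in> Obj C" if "k < Suc d" for k
    proof (rule shift_cat_obj_summand)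
      show "Xs ! k \<in> Obj (shift_cat C)"
        using comp that len nth_mem[of k Xs]
        by (auto simp: composable_def subset_iff simp del: shift_cat_simps)
    qed (use idx that in auto)
    then have "set ?Zs \<subseteq> Obj C"
      using len by (auto simp del: upt_Suc)
    moreover have "d \<noteq> 0"
      using comp by (auto simp: composable_def d_def)
    ultimately show ?thesis
      using hom len unfolding composable_def by (auto simp del: upt_Suc)
  qed
  \<comment> \<open>The source of the \<open>k\<close>-th argument is moved by all powers from
    \<open>k\<close> on, its target by those from \<open>Suc k\<close> on; the difference is
    \<open>l k\<close>.\<close>
  have drop_eq: "path_drop ?Ys is k = u k + l k" if "k < d" for k
    using that idx[of k] idx[of "Suc k"] len sum_list_drop_Suc[of k ls]
    by (simp add: u_def l_def del: upt_Suc)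
  have objs: "map (\<lambda>k. summand (?Ys ! k) (is ! k)) [0..<Suc (length ?gs)] = ?Zs"
    using idx len by (auto simp del: upt_Suc)
  have degs: "map (\<lambda>k. ns ! k - path_drop ?Ys is k) [0..<length ?gs] = map m [0..<d]"
    using drop_eq len by (auto simp: m_def simp del: upt_Suc)
  have entries: "map (\<lambda>k. (?gs ! k) (is ! Suc k) (is ! k)) [0..<length ?gs] =
      map (\<lambda>k. Scl C (minus_one_pow (sum_list (drop (Suc k) ls) * (u k + l k))) (a k)) [0..<d]"
    using idx len by (auto simp: a_def u_def l_def algebra_simps simp del: upt_Suc)
  have "shift_mu_term C ?Ys ns ?gs is =
      Scl C (minus_one_pow (\<Sum>j<d. \<Sum>i<j. (u i + l i) * (m j - 1)))
        (Mu C ?Zs (map m [0..<d])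
          (map (\<lambda>k. Scl C (minus_one_pow (sum_list (drop (Suc k) ls) * (u k + l k))) (a k))
              [0..<d]))"
  proof -
    have "(\<Sum>j<length ?gs. \<Sum>i<j. path_drop ?Ys is i * (ns ! j - path_drop ?Ys is j - 1)) =
        (\<Sum>j<d. \<Sum>i<j. (u i + l i) * (m j - 1))"
      using drop_eq len by (auto intro!: sum.cong simp: m_def simp del: upt_Suc)
    then show ?thesis
      unfolding shift_mu_term_eq objs degs entries by simp
  qed
  also have "Mu C ?Zs (map m [0..<d])
          (map (\<lambda>k. Scl C (minus_one_pow (sum_list (drop (Suc k) ls) * (u k + l k))) (a k))
              [0..<d]) =
      Scl C (minus_one_pow (\<Sum>j<d. \<Sum>i<j. l j * (u i + l i)))
          (Mu C ?Zs (map m [0..<d]) (map a [0..<d]))"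
    unfolding mu_scale_all[OF comp'] minus_one_pow_sum
    using sum_drop_mult[of ls "\<lambda>k. u k + l k"] len by (simp add: l_def)
  finally have lhs: "Scl C (minus_one_pow (choose2 (sum_list ls))) (shift_mu_term C ?Ys ns ?gs is) =
      Scl C (minus_one_pow (choose2 (sum_list ls) + (\<Sum>j<d. \<Sum>i<j. (u i + l i) * (m j - 1)) +
        (\<Sum>j<d. \<Sum>i<j. l j * (u i + l i)))) (Mu C ?Zs (map m [0..<d]) (map a [0..<d]))"
    by (simp only: scale_scale minus_one_pow_add mult.assoc)
  let ?hs = "map (\<lambda>k l. Scl C (minus_one_pow (choose2 l)) ((fs ! k) l (is ! Suc k) (is ! k)))
           [0..<length fs]"
  let ?ns = "map (\<lambda>k. ns ! k - path_drop Xs is k) [0..<length fs]"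
  have degs': "map (\<lambda>k. ?ns ! k - ls ! k) [0..<length ?hs] = map m [0..<d]"
    using len by (auto simp: m_def u_def l_def)
  have entries': "map (\<lambda>k. (?hs ! k) (ls ! k)) [0..<length ?hs] =
      map (\<lambda>k. Scl C (minus_one_pow (choose2 (l k))) (a k)) [0..<d]"
    using len by (auto simp: a_def l_def)
  have "laurent_mu_term C ?Zs ?ns ?hs ls =
      Scl C (minus_one_pow (\<Sum>j<d. \<Sum>i<j. l i * (m j - 1)))
        (Scl C (minus_one_pow (\<Sum>k<d. choose2 (l k))) (Mu C ?Zs (map m [0..<d]) (map a [0..<d])))"
  proof -
    have "(\<Sum>j<length ?hs. \<Sum>i<j. ls ! i * (?ns ! j - ls ! j - 1)) =
        (\<Sum>j<d. \<Sum>i<j. l i * (m j - 1))"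
      using len by (auto intro!: sum.cong simp: m_def l_def u_def)
    then show ?thesis
      unfolding laurent_mu_term_def degs' entries' mu_scale_all[OF comp'] minus_one_pow_sum by simp
  qed
  \<comment> \<open>As a morphism of the Laurent category the entry has degree
    \<open>m j + l j\<close>, because t^l has degree l.\<close>
  moreover have "(\<Sum>j<length fs. \<Sum>i<j. path_drop Xs is i * (ns ! j - path_drop Xs is j - 1)) =
      (\<Sum>j<d. \<Sum>i<j. u i * (m j + l j - 1))"
    by (simp add: u_def l_def m_def d_def)
  ultimately have rhs: "Scl C (minus_one_pow (\<Sum>j<length fs. \<Sum>i<j.
        path_drop Xs is i * (ns ! j - path_drop Xs is j - 1))) (laurent_mu_term C ?Zs ?ns ?hs ls) =
      Scl C (minus_one_pow ((\<Sum>j<d. \<Sum>i<j. u i * (m j + l j - 1)) +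
        (\<Sum>j<d. \<Sum>i<j. l i * (m j - 1)) + (\<Sum>k<d. choose2 (l k))))
        (Mu C ?Zs (map m [0..<d]) (map a [0..<d]))"
    by (simp only: scale_scale minus_one_pow_add mult.assoc)
  have "sum_list ls = (\<Sum>k<d. l k)"
    using len by (simp add: sum_list_sum_nth l_def atLeast0LessThan)
  then have "choose2 (sum_list ls) + (\<Sum>j<d. \<Sum>i<j. (u i + l i) * (m j - 1)) +
        (\<Sum>j<d. \<Sum>i<j. l j * (u i + l i)) - ((\<Sum>j<d. \<Sum>i<j. u i * (m j + l j - 1)) +
        (\<Sum>j<d. \<Sum>i<j. l i * (m j - 1)) + (\<Sum>k<d. choose2 (l k))) =
      2 * (\<Sum>j<d. \<Sum>i<j. l i * l j)"
    by (simp add: choose2_sum algebra_simps sum.distrib sum_subtractf)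
  also have "even \<dots>"
    by simp
  finally show ?thesis
    unfolding lhs rhs by (intro arg_cong[where f = "\<lambda>c. Scl C c _"] minus_one_pow_cong)
qed

section \<open>Morphism spaces and functor equations of the isomorphism\<close>

lemma skew_to_laurent_hom:
  assumes f: "f \<in> Hom (skew_shift C) X Y n"
    and X: "X \<in> Obj (shift_cat C)" and Y: "Y \<in> Obj (shift_cat C)"
  shows "On_hom (skew_to_laurent C) X Y n f \<in> Hom (shift_cat (laurent_cat C)) X Y n"
proof -
  have "finite {l. Scl C (minus_one_pow (choose2 l)) (f l j i) \<noteq> 0}" for j i
    by (rule finite_subset[of _ "{l. f l \<noteq> 0}"]) (use f in \<open>auto simp: skew_shift_hom\<close>)
  then show ?thesis
    using f shift_cat_obj_summand[OF X] shift_cat_obj_summand[OF Y]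
    by (auto simp: shift_cat_hom laurent_cat_hom skew_shift_hom skew_to_laurent_def fun_eq_iff
        intro!: hom_scale)
qed

lemma laurent_to_skew_hom:
  assumes g: "g \<in> Hom (shift_cat (laurent_cat C)) X Y n"
    and X: "X \<in> Obj (shift_cat C)" and Y: "Y \<in> Obj (shift_cat C)"
  shows "On_hom (laurent_to_skew C) X Y n g \<in> Hom (skew_shift C) X Y n"
proof -
  have zero: "g j i = 0" if "\<not> (i < length X \<and> j < length Y)" for j i
    using g that by (auto simp: shift_cat_hom)
  have "g j i \<in> Hom (laurent_cat C) (summand X i) (summand Y j) (n - (shift X i - shift Y j))"
    if "i < length X" "j < length Y" for j i
    using g that by (simp add: shift_cat_hom)
  then have fin: "finite {l. g j i l \<noteq> 0}"
    and entry: "g j i l \<in> Hom C (summand X i) (summand Y j) (n - (shift X i - shift Y j) - l)"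
    if "i < length X" "j < length Y" for j i l
    using that by (auto simp: laurent_cat_hom)
  \<comment> \<open>One finite set of powers serves the whole matrix because there are only finitely
    many entries, each of finite support.\<close>
  have "finite {l. (\<lambda>j i. Scl C (minus_one_pow (choose2 l)) (g j i l)) \<noteq> 0}"
  proof (rule finite_subset)
    show "{l. (\<lambda>j i. Scl C (minus_one_pow (choose2 l)) (g j i l)) \<noteq> 0} \<subseteq>
        (\<Union>i<length X. \<Union>j<length Y. {l. g j i l \<noteq> 0})"
    proof
      fix l assume "l \<in> {l. (\<lambda>j i. Scl C (minus_one_pow (choose2 l)) (g j i l)) \<noteq> 0}"
      then obtain j i where "g j i l \<noteq> 0"
        by (auto simp: fun_eq_iff)
      moreover from this have "i < length X \<and> j < length Y"
        using zero[of i j] by (auto simp: fun_eq_iff)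
      ultimately show "l \<in> (\<Union>i<length X. \<Union>j<length Y. {l. g j i l \<noteq> 0})"
        by auto
    qed
  qed (auto simp: fin)
  moreover have "Scl C (minus_one_pow (choose2 l)) (g j i l) \<in>
      Hom C (summand X i) (summand Y j) (n - (shift X i - shift Y j) - l)"
    if "i < length X" "j < length Y" for j i l
    using that shift_cat_obj_summand[OF X] shift_cat_obj_summand[OF Y] entry
    by (intro hom_scale) auto
  ultimately show ?thesis
    using zero by (simp add: skew_shift_hom laurent_to_skew_def del: scale_eq_0_iff)
qed

text \<open>In the skew category the powers of \<sigma> form the outer sum and the paths the inner
  one; for formal sums over the Laurent category it is the other way round. After the terms are
  matched by \<open>skew_term\<close>, the sums are exchanged.\<close>

lemma skew_to_laurent_mu:
  assumes comp: "composable (skew_shift C) Xs ns fs"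
  shows "On_hom (skew_to_laurent C) X Y n (Mu (skew_shift C) Xs ns fs) =
    Mu (shift_cat (laurent_cat C)) Xs ns (map_morphisms (skew_to_laurent C) Xs ns fs)"
proof (intro ext)
  fix j i \<beta>
  let ?d = "length fs"
  let ?gs = "map_morphisms (skew_to_laurent C) Xs ns fs"
  let ?L = "compositions ?d \<beta> (\<lambda>k. {l. (fs ! k) l \<noteq> 0})"
  let ?P = "matrix_paths Xs i j"
  let ?Ys = "\<lambda>ls. map (\<lambda>k. On_obj (shift_action C (sum_list (drop k ls))) (Xs ! k)) [0..<?d + 1]"
  let ?hs = "\<lambda>ls. map (\<lambda>k. On_hom (shift_action C (sum_list (drop (k + 1) ls)))
                        (On_obj (shift_action C (ls ! k)) (Xs ! k)) (Xs ! (k + 1)) (ns ! k)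
                        ((fs ! k) (ls ! k))) [0..<?d]"
  let ?\<epsilon> = "\<lambda>is. minus_one_pow (\<Sum>j<?d. \<Sum>i<j. path_drop Xs is i * (ns ! j - path_drop Xs is j - 1))"
  let ?Zs = "\<lambda>is. map (\<lambda>k. summand (Xs ! k) (is ! k)) [0..<Suc ?d]"
  let ?ms = "\<lambda>is. map (\<lambda>k. ns ! k - path_drop Xs is k) [0..<?d]"
  let ?as = "\<lambda>is. map (\<lambda>k l. Scl C (minus_one_pow (choose2 l)) ((fs ! k) l (is ! Suc k) (is ! k)))
      [0..<?d]"
  have len: "length Xs = Suc ?d"
    using comp by (simp add: composable_def)
  have comp': "composable (shift_cat (laurent_cat C)) Xs ns ?gs"
    using composable_map_morphisms[OF _ _ comp, of "skew_to_laurent C" "shift_cat (laurent_cat C)"]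
      skew_to_laurent_hom by (simp add: skew_to_laurent_def)
  have paths: "matrix_paths (map (\<lambda>k. On_obj (shift_action C (sum_list (drop k ls))) (Xs ! k))
      [0..<Suc ?d]) i j = ?P" for ls
    by (rule matrix_paths_cong) (auto simp: len simp del: upt_Suc)
  have entries: "map (\<lambda>k. (?gs ! k) (is ! Suc k) (is ! k)) [0..<length ?gs] = ?as is" for "is"
    by (auto simp: map_morphisms_def skew_to_laurent_def)
  have "On_hom (skew_to_laurent C) X Y n (Mu (skew_shift C) Xs ns fs) j i \<beta> =
      (\<Sum>ls\<in>?L. \<Sum>is\<in>?P. Scl C (minus_one_pow (choose2 \<beta>)) (shift_mu_term C (?Ys ls) ns (?hs ls) is))"
    unfolding skew_to_laurent_def skew_mu
    by (simp add: sum_apply paths scale_sum_right del: upt_Suc)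
  also have "\<dots> = (\<Sum>ls\<in>?L. \<Sum>is\<in>?P.
      Scl C (?\<epsilon> is) (laurent_mu_term C (?Zs is) (?ms is) (?as is) ls))"
  proof (intro sum.cong refl)
    fix ls "is" assume "ls \<in> ?L" and path: "is \<in> ?P"
    then have len: "length ls = ?d" and sum: "sum_list ls = \<beta>"
      by (auto simp: compositions_def)
    show "Scl C (minus_one_pow (choose2 \<beta>)) (shift_mu_term C (?Ys ls) ns (?hs ls) is) =
        Scl C (?\<epsilon> is) (laurent_mu_term C (?Zs is) (?ms is) (?as is) ls)"
      using skew_term[OF comp path len] unfolding sum .
  qed
  also have "\<dots> = (\<Sum>is\<in>?P. Scl C (?\<epsilon> is)
      (\<Sum>ls\<in>?L. laurent_mu_term C (?Zs is) (?ms is) (?as is) ls))"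
    by (subst sum.swap) (simp add: scale_sum_right)
  \<comment> \<open>The left sum runs over supports of whole matrices, the operation on the right
    over the possibly smaller supports of the entries along the path.\<close>
  also have "\<dots> = (\<Sum>is\<in>?P. Scl C (?\<epsilon> is) (Mu (laurent_cat C) (?Zs is) (?ms is) (?as is) \<beta>))"
  proof (intro sum.cong refl arg_cong[where f = "Scl C _"])
    fix "is" assume path: "is \<in> ?P"
    have "composable (laurent_cat C) (?Zs is) (?ms is) (?as is)"
      using path_composable[OF comp' path, unfolded entries, unfolded length_map_morphisms] .
    moreover have "finite {l. (fs ! k) l \<noteq> 0}" if "k < ?d" for k
      using comp that by (auto simp: composable_def skew_shift_hom)
    ultimately have "Mu (laurent_cat C) (?Zs is) (?ms is) (?as is) \<beta> =
        (\<Sum>ls \<in> compositions (length (?as is)) \<beta> (\<lambda>k. {l. (fs ! k) l \<noteq> 0}).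
          laurent_mu_term C (?Zs is) (?ms is) (?as is) ls)"
      by (intro laurent_mu_superset) (auto simp: fun_eq_iff)
    then show "(\<Sum>ls\<in>?L. laurent_mu_term C (?Zs is) (?ms is) (?as is) ls) =
        Mu (laurent_cat C) (?Zs is) (?ms is) (?as is) \<beta>"
      by (simp del: upt_Suc)
  qed
  also have "\<dots> = Mu (shift_cat (laurent_cat C)) Xs ns ?gs j i \<beta>"
    unfolding shift_cat_simps shift_mu_term_eq entries by (simp add: sum_apply del: upt_Suc)
  finally show "On_hom (skew_to_laurent C) X Y n (Mu (skew_shift C) Xs ns fs) j i \<beta> =
      Mu (shift_cat (laurent_cat C)) Xs ns ?gs j i \<beta>" .
qed

lemma skew_to_laurent_inverse:
  "On_hom (laurent_to_skew C) X Y n (On_hom (skew_to_laurent C) X' Y' n' f) = f"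
  by (simp add: skew_to_laurent_def laurent_to_skew_def)

lemma laurent_to_skew_inverse:
  "On_hom (skew_to_laurent C) X Y n (On_hom (laurent_to_skew C) X' Y' n' f) = f"
  by (simp add: skew_to_laurent_def laurent_to_skew_def)

lemma skew_to_laurent_functor:
  "ainf_functor (skew_shift C) (shift_cat (laurent_cat C)) (skew_to_laurent C)"
proof
  fix X Y n a
  assume "X \<in> Obj (skew_shift C)" "Y \<in> Obj (skew_shift C)" "a \<in> Hom (skew_shift C) X Y n"
  then show "On_hom (skew_to_laurent C) X Y n a \<in> Hom (shift_cat (laurent_cat C))
      (On_obj (skew_to_laurent C) X) (On_obj (skew_to_laurent C) Y) n"
    using skew_to_laurent_hom by (simp add: skew_to_laurent_def)
next
  fix Xs ns fs assume "composable (skew_shift C) Xs ns fs"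
  then show "On_hom (skew_to_laurent C) (hd Xs) (last Xs) (sum_list ns + 2 - int (length fs))
        (Mu (skew_shift C) Xs ns fs) =
      Mu (shift_cat (laurent_cat C)) (map (On_obj (skew_to_laurent C)) Xs) ns
        (map_morphisms (skew_to_laurent C) Xs ns fs)"
    by (subst skew_to_laurent_mu) (simp_all add: skew_to_laurent_def)
qed (auto simp: skew_to_laurent_def scale_right_distrib fun_eq_iff mult.commute)

text \<open>Compatibility with the operations is carried over from the inverse map, without a second
  computation of signs.\<close>

lemma laurent_to_skew_functor:
  "ainf_functor (shift_cat (laurent_cat C)) (skew_shift C) (laurent_to_skew C)"
proof
  show hom: "On_hom (laurent_to_skew C) X Y n a \<in> Hom (skew_shift C)
      (On_obj (laurent_to_skew C) X) (On_obj (laurent_to_skew C) Y) n"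
    if "X \<in> Obj (shift_cat (laurent_cat C))" "Y \<in> Obj (shift_cat (laurent_cat C))"
      "a \<in> Hom (shift_cat (laurent_cat C)) X Y n" for X Y n a
    using that laurent_to_skew_hom by (simp add: laurent_to_skew_def)
  fix Xs ns gs assume comp: "composable (shift_cat (laurent_cat C)) Xs ns gs"
  let ?fs = "map_morphisms (laurent_to_skew C) Xs ns gs"
  have fs: "composable (skew_shift C) Xs ns ?fs"
    using composable_map_morphisms[OF _ hom comp] by (simp add: laurent_to_skew_def)
  have "map_morphisms (skew_to_laurent C) Xs ns ?fs = gs"
    by (auto simp: map_morphisms_def laurent_to_skew_inverse intro!: nth_equalityI)
  then have "On_hom (laurent_to_skew C) X Y n (Mu (shift_cat (laurent_cat C)) Xs ns gs) =
      Mu (skew_shift C) Xs ns ?fs" for X Y n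
    using skew_to_laurent_mu[OF fs] skew_to_laurent_inverse by metis
  then show "On_hom (laurent_to_skew C) (hd Xs) (last Xs) (sum_list ns + 2 - int (length gs))
        (Mu (shift_cat (laurent_cat C)) Xs ns gs) =
      Mu (skew_shift C) (map (On_obj (laurent_to_skew C)) Xs) ns ?fs"
    by (simp add: laurent_to_skew_def)
qed (auto simp: laurent_to_skew_def scale_right_distrib fun_eq_iff mult.commute)

theorem skew_to_laurent_isomorphism:
  "ainf_isomorphism (skew_shift C) (shift_cat (laurent_cat C)) (skew_to_laurent C)"
  unfolding ainf_isomorphism_def is_identity_on_def comp_fun_def
  using skew_to_laurent_functor laurent_to_skew_functor
  by (intro conjI exI[of _ "laurent_to_skew C"])
    (simp_all add: skew_to_laurent_inverse laurent_to_skew_inverse, simp_all add: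
        skew_to_laurent_def laurent_to_skew_def)

end

section \<open>Functors between categories of formal sums\<close>

lemma path_ends:
  assumes "is \<in> matrix_paths Xs i j" "length Xs = Suc d"
  shows "is ! 0 = i" "is ! d = j" "hd Xs = Xs ! 0" "last Xs = Xs ! d"
proof -
  have "is \<noteq> []" "Xs \<noteq> []" "length is = Suc d"
    using assms by (auto simp: matrix_paths_def)
  then show "is ! 0 = i" "is ! d = j" "hd Xs = Xs ! 0" "last Xs = Xs ! d"
    using assms by (auto simp: matrix_paths_def hd_conv_nth last_conv_nth)
qed

lemma sum_path_drop: "(\<Sum>k<d. p k - p (Suc k)) = p 0 - (p d :: int)" for d :: nat
  by (induction d) auto

lemma comp_functor:
  assumes F: "ainf_functor C D F" and G: "ainf_functor D E G"
  shows "ainf_functor C E (comp_fun G F)"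
proof -
  interpret F: ainf_functor C D F by fact
  interpret G: ainf_functor D E G by fact
  show ?thesis
  proof
    fix Xs ns as assume comp: "composable C Xs ns as"
    then have "Xs \<noteq> []" and len: "length Xs = Suc (length as)"
      by (auto simp: composable_def)
    have comp': "composable D (map (On_obj F) Xs) ns (map_morphisms F Xs ns as)"
      by (rule composable_map_morphisms[OF F.on_obj F.on_hom comp])
    have "map_morphisms (comp_fun G F) Xs ns as =
        map_morphisms G (map (On_obj F) Xs) ns (map_morphisms F Xs ns as)"
      by (auto simp: map_morphisms_def comp_fun_def len)
    then show "On_hom (comp_fun G F) (hd Xs) (last Xs) (sum_list ns + 2 - int (length as))
          (Mu C Xs ns as) =
        Mu E (map (On_obj (comp_fun G F)) Xs) ns (map_morphisms (comp_fun G F) Xs ns as)"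
      using F.on_mu[OF comp] G.on_mu[OF comp'] \<open>Xs \<noteq> []\<close>
      by (simp add: comp_fun_def hd_map last_map comp_def)
  qed (simp_all add: comp_fun_def F.on_obj G.on_obj F.on_hom G.on_hom F.on_hom_add G.on_hom_add
      F.on_hom_scale G.on_hom_scale F.on_unit G.on_unit)
qed

lemma shift_map_obj [simp]:
  "length (On_obj (shift_map F) X) = length X"
  "i < length X \<Longrightarrow> On_obj (shift_map F) X ! i = (On_obj F (summand X i), shift X i)"
  by (auto simp: shift_map_def split: prod.split)

lemma shift_map_hom [simp]:
  "On_hom (shift_map F) X Y n f j i =
    (if i < length X \<and> j < length Y
     then On_hom F (summand X i) (summand Y j) (n - (shift X i - shift Y j)) (f j i) else 0)"
  by (simp add: shift_map_def)

text \<open>Linearity of \<open>F\<close> is required for all arguments because \<open>F\<close> is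
  applied to sums of values of operations, which are not known to lie in morphism spaces of
  \<open>C\<close>.\<close>

lemma shift_map_functor:
  assumes F: "ainf_functor C D F" and D: "vector_space (Scl D)"
    and add: "\<And>X Y n a b. On_hom F X Y n (a + b) = On_hom F X Y n a + On_hom F X Y n b"
    and scale: "\<And>X Y n c a. On_hom F X Y n (Scl C c a) = Scl D c (On_hom F X Y n a)"
  shows "ainf_functor (shift_cat C) (shift_cat D) (shift_map F)"
proof -
  interpret F: ainf_functor C D F by fact
  interpret D: vector_space "Scl D" by fact
  have zero: "On_hom F X Y n 0 = 0" for X Y n
    using add[of X Y n 0 0] by simp
  have sum: "On_hom F X Y n (\<Sum>a\<in>S. f a) = (\<Sum>a\<in>S. On_hom F X Y n (f a))" for X Y n S f
    by (induction S rule: infinite_finite_induct) (auto simp: zero add)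
  have obj: "On_obj (shift_map F) X \<in> Obj (shift_cat D)" if "X \<in> Obj (shift_cat C)" for X
    using that F.on_obj by (auto simp: shift_map_def image_subset_iff split: prod.splits)
  have hom: "On_hom (shift_map F) X Y n f \<in>
      Hom (shift_cat D) (On_obj (shift_map F) X) (On_obj (shift_map F) Y) n"
    if "X \<in> Obj (shift_cat C)" "Y \<in> Obj (shift_cat C)" "f \<in> Hom (shift_cat C) X Y n" for X Y n f
  proof -
    have "f j i \<in> Hom C (summand X i) (summand Y j) (n - (shift X i - shift Y j))"
      if "i < length X" "j < length Y" for j i
      using \<open>f \<in> _\<close> that by (simp add: shift_cat_hom)
    then show ?thesis
      using shift_cat_obj_summand[OF that(1)] shift_cat_obj_summand[OF that(2)]
      by (simp add: shift_cat_hom F.on_hom)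
  qed
  show ?thesis
  proof
    fix X Y n f g assume "f \<in> Hom (shift_cat C) X Y n" "g \<in> Hom (shift_cat C) X Y n"
    show "On_hom (shift_map F) X Y n (f + g) = On_hom (shift_map F) X Y n f +
        On_hom (shift_map F) X Y n g"
      by (auto simp: shift_map_def fun_eq_iff add)
  next
    fix X Y n f c assume "f \<in> Hom (shift_cat C) X Y n"
    show "On_hom (shift_map F) X Y n (Scl (shift_cat C) c f) =
        Scl (shift_cat D) c (On_hom (shift_map F) X Y n f)"
      using D.scale_zero_right
      by (auto simp: shift_map_def fun_eq_iff scale)
  next
    fix X assume X: "X \<in> Obj (shift_cat C)"
    show "On_hom (shift_map F) X X 0 (Unit (shift_cat C) X) =
        Unit (shift_cat D) (On_obj (shift_map F) X)"
      using shift_cat_obj_summand[OF X] F.on_unit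
      by (auto simp: shift_map_def fun_eq_iff zero split: prod.splits)
  next
    fix Xs ns fs assume comp: "composable (shift_cat C) Xs ns fs"
    define d where "d = length fs"
    define N where "N = sum_list ns + 2 - int (length fs)"
    let ?Ys = "map (On_obj (shift_map F)) Xs"
    let ?gs = "map_morphisms (shift_map F) Xs ns fs"
    have len: "length Xs = Suc d" "length ns = d" "length fs = d"
      using comp by (auto simp: composable_def d_def)
    have "On_hom (shift_map F) (hd Xs) (last Xs) N (Mu (shift_cat C) Xs ns fs) j i =
        Mu (shift_cat D) ?Ys ns ?gs j i" for j i
    proof -
      have paths: "matrix_paths ?Ys i j = matrix_paths Xs i j"
        by (rule matrix_paths_cong) auto
      show ?thesis
      proof (cases "i < length (hd Xs) \<and> j < length (last Xs)")
        case True
        let ?n = "N - (shift (hd Xs) i - shift (last Xs) j)"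
        have "On_hom F (summand (hd Xs) i) (summand (last Xs) j) ?n (shift_mu_term C Xs ns fs is) =
            shift_mu_term D ?Ys ns ?gs is" if path: "is \<in> matrix_paths Xs i j" for "is"
        proof -
          let ?Zs = "map (\<lambda>k. summand (Xs ! k) (is ! k)) [0..<Suc (length fs)]"
          let ?ms = "map (\<lambda>k. ns ! k - path_drop Xs is k) [0..<length fs]"
          let ?as = "map (\<lambda>k. (fs ! k) (is ! Suc k) (is ! k)) [0..<length fs]"
          have idx: "is ! k < length (Xs ! k)" if "k < Suc d" for k
            using path that len by (auto simp: matrix_paths_def)
          note ends = path_ends[OF path len(1)]
          have hd: "hd ?Zs = summand (hd Xs) i" and last: "last ?Zs = summand (last Xs) j"
            using ends by (auto simp: hd_map last_map d_def hd_upt simp del: upt_Suc)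
          \<comment> \<open>The drops telescope along the path, so every path yields the degree at
            which \<open>shift_map\<close> applies \<open>F\<close> to the entry of the
            value.\<close>
          have deg: "sum_list ?ms + 2 - int (length ?as) = ?n"
          proof -
            have "sum_list ?ms = (\<Sum>k<d. ns ! k) - (\<Sum>k<d. path_drop Xs is k)"
              by (simp add: sum_list_sum_nth atLeast0LessThan sum_subtractf len)
            also have "(\<Sum>k<d. path_drop Xs is k) = shift (hd Xs) i - shift (last Xs) j"
              using sum_path_drop[where p = "\<lambda>k. shift (Xs ! k) (is ! k)" and d = d] ends by simp
            also have "(\<Sum>k<d. ns ! k) = sum_list ns"
              by (simp add: sum_list_sum_nth atLeast0LessThan len)
            finally show ?thesis
              by (simp add: N_def len)
          qed
          have drop_eq: "path_drop ?Ys is k = path_drop Xs is k" if "k < d" for k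
            using that idx[of k] idx[of "Suc k"] len by simp
          have exponent: "(\<Sum>j<length ?gs. \<Sum>i<j. path_drop ?Ys is i *
              (ns ! j - path_drop ?Ys is j - 1)) =
              (\<Sum>j<length fs. \<Sum>i<j. path_drop Xs is i * (ns ! j - path_drop Xs is j - 1))"
            using drop_eq len by (auto intro!: sum.cong)
          have Zs: "map (\<lambda>k. summand (?Ys ! k) (is ! k)) [0..<Suc (length ?gs)] =
              map (On_obj F) ?Zs"
            using idx len by (auto simp del: upt_Suc)
          have ms: "map (\<lambda>k. ns ! k - path_drop ?Ys is k) [0..<length ?gs] = ?ms"
            using drop_eq len by auto
          have as: "map (\<lambda>k. (?gs ! k) (is ! Suc k) (is ! k)) [0..<length ?gs] =
              map_morphisms F ?Zs ?ms ?as"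
          proof (rule nth_equalityI)
            fix k assume "k < length (map (\<lambda>k. (?gs ! k) (is ! Suc k) (is ! k)) [0..<length ?gs])"
            then have k: "k < d" using len by simp
            then have "is ! k < length (Xs ! k)" "is ! Suc k < length (Xs ! Suc k)"
              using idx[of k] idx[of "Suc k"] by auto
            then show "map (\<lambda>k. (?gs ! k) (is ! Suc k) (is ! k)) [0..<length ?gs] ! k =
                map_morphisms F ?Zs ?ms ?as ! k"
              using k len by (simp add: map_morphisms_def shift_map_def del: upt_Suc)
          qed simp
          show ?thesis
            unfolding shift_mu_term_eq scale exponent Zs ms as
            using F.on_mu[OF path_composable[OF comp path], unfolded hd last deg] by simp
        qed
        then show ?thesis
          using True by (simp add: paths sum)
      next
        case False
        have "?Ys \<noteq> []" "hd ?Ys = On_obj (shift_map F) (hd Xs)" "last ?Ys =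
            On_obj (shift_map F) (last Xs)"
          using len by (auto simp: hd_map last_map simp flip: length_greater_0_conv)
        then have "matrix_paths ?Ys i j = {}"
          using False matrix_paths_range[of _ ?Ys i j] by auto
        then show ?thesis
          using False by auto
      qed
    qed
    then show "On_hom (shift_map F) (hd Xs) (last Xs) (sum_list ns + 2 - int (length fs))
        (Mu (shift_cat C) Xs ns fs) = Mu (shift_cat D) ?Ys ns ?gs"
      unfolding N_def by (intro ext)
  qed (fact obj hom)+
qed

section \<open>The functor \<open>\<int>(\<int>\<C>) \<rightarrow> \<int>\<C>\<close>\<close>

text \<open>Adding the outer shift to a block keeps its length, so the positions of a flattened
  object can be computed from the blocks \<open>map fst X\<close>.\<close>

lemma block_index_cong:
  "map length Xss = map length Yss \<Longrightarrow> block_index Xss r = block_index Yss r"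
proof (induction Xss arbitrary: Yss r)
  case (Cons xs Xss)
  then show ?case by (cases Yss) auto
qed auto

lemma block_index_nth:
  assumes "r < length (concat Xss)"
  shows "fst (block_index Xss r) < length Xss"
    "snd (block_index Xss r) < length (Xss ! fst (block_index Xss r))"
    "concat Xss ! r = Xss ! fst (block_index Xss r) ! snd (block_index Xss r)"
  using assms by (induction Xss arbitrary: r) (auto simp: nth_append split_def Let_def)

lemma block_index_bij:
  "bij_betw (block_index Xss) {..<length (concat Xss)}
      (SIGMA i:{..<length Xss}. {..<length (Xss ! i)})"
proof (rule bij_betwI')
  show "block_index Xss r = block_index Xss s \<longleftrightarrow> r = s"
    if "r \<in> {..<length (concat Xss)}" "s \<in> {..<length (concat Xss)}" for r s
    using that
  proof (induction Xss arbitrary: r s)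
    case (Cons xs Xss)
    have "r - length xs = s - length xs"
      if "block_index Xss (r - length xs) = block_index Xss (s - length xs)"
        "\<not> r < length xs" "\<not> s < length xs"
      using Cons.IH[of "r - length xs" "s - length xs"] Cons.prems that by auto
    then show ?case
      by (auto split: prod.splits if_splits simp: not_less)
  qed auto
  show "block_index Xss r \<in> (SIGMA i:{..<length Xss}. {..<length (Xss ! i)})"
    if "r \<in> {..<length (concat Xss)}" for r
    using block_index_nth[of r Xss] that by (cases "block_index Xss r") auto
  show "\<exists>r\<in>{..<length (concat Xss)}. p = block_index Xss r"
    if "p \<in> (SIGMA i:{..<length Xss}. {..<length (Xss ! i)})" for p
    using that
  proof (induction Xss arbitrary: p)
    case (Cons xs Xss)
    obtain i u where p: "p = (i, u)" by (cases p)
    show ?case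
    proof (cases i)
      case 0
      then show ?thesis
        using Cons.prems p by (intro bexI[of _ u]) auto
    next
      case (Suc i')
      then obtain r where "r < length (concat Xss)" "(i', u) = block_index Xss r"
        using Cons.IH[of "(i', u)"] Cons.prems p by auto
      then show ?thesis
        using Suc p by (intro bexI[of _ "r + length xs"]) (auto split: prod.splits)
    qed
  qed auto
qed

definition blk :: "'o formal_sum formal_sum \<Rightarrow> nat \<Rightarrow> nat" where
  "blk X r = fst (block_index (map fst X) r)"

definition pos :: "'o formal_sum formal_sum \<Rightarrow> nat \<Rightarrow> nat" where
  "pos X r = snd (block_index (map fst X) r)"

lemma flatten_obj_length [simp]:
  "length (On_obj (flatten C) X) = length (concat (map fst X))"
  by (simp add: flatten_def length_concat comp_def split_def)

lemma blk_pos_range: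
  assumes "r < length (concat (map fst X))"
  shows "blk X r < length X" "pos X r < length (summand X (blk X r))"
  using block_index_nth[OF assms] by (auto simp: blk_def pos_def)

lemma flatten_obj_nth:
  assumes "r < length (concat (map fst X))"
  shows "On_obj (flatten C) X ! r =
    (summand (summand X (blk X r)) (pos X r), shift (summand X (blk X r)) (pos X r) +
        shift X (blk X r))"
proof -
  let ?Yss = "map (\<lambda>(Y, q). map (\<lambda>(x, p). (x, p + q)) Y) X"
  have idx: "block_index ?Yss r = block_index (map fst X) r"
    by (rule block_index_cong) auto
  have "r < length (concat ?Yss)"
    using assms by (simp add: length_concat comp_def split_def)
  from block_index_nth(3)[OF this] blk_pos_range[OF assms] show ?thesis
    unfolding idx by (simp add: flatten_def blk_def pos_def split_def)
qed

lemma flatten_hom [simp]: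
  "On_hom (flatten C) X Y n f r c =
    (if c < length (concat (map fst X)) \<and> r < length (concat (map fst Y))
     then Scl C (minus_one_pow (shift X (blk X c) *
         (shift (summand X (blk X c)) (pos X c) - shift (summand Y (blk Y r)) (pos Y r))))
       (f (blk Y r) (blk X c) (pos Y r) (pos X c))
     else 0)"
  by (simp add: flatten_def blk_def pos_def split_def Let_def)

lemma blk_pos_bij:
  "bij_betw (\<lambda>r. (blk X r, pos X r)) {..<length (concat (map fst X))}
    (SIGMA i:{..<length X}. {..<length (summand X i)})"
proof -
  have "(SIGMA i:{..<length X}. {..<length (summand X i)}) =
      (SIGMA i:{..<length (map fst X)}. {..<length (map fst X ! i)})"
    by auto
  then show ?thesis
    using block_index_bij[of "map fst X"] by (simp add: blk_def pos_def)
qed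

definition flat_index :: "'o formal_sum formal_sum \<Rightarrow> nat \<Rightarrow> nat \<Rightarrow> nat" where
  "flat_index X i u = inv_into {..<length (concat (map fst X))} (\<lambda>r. (blk X r, pos X r)) (i, u)"

lemma flat_index:
  assumes "i < length X" "u < length (summand X i)"
  shows "flat_index X i u < length (concat (map fst X))"
    "blk X (flat_index X i u) = i" "pos X (flat_index X i u) = u"
proof -
  have mem: "(i, u) \<in> (\<lambda>r. (blk X r, pos X r)) ` {..<length (concat (map fst X))}"
    using blk_pos_bij[of X] assms by (auto simp: bij_betw_def)
  show "flat_index X i u < length (concat (map fst X))"
    using inv_into_into[OF mem] by (simp add: flat_index_def)
  show "blk X (flat_index X i u) = i" "pos X (flat_index X i u) = u"
    using f_inv_into_f[OF mem] by (simp_all add: flat_index_def)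
qed

lemma flat_index_blk_pos:
  assumes "r < length (concat (map fst X))"
  shows "flat_index X (blk X r) (pos X r) = r"
  unfolding flat_index_def
  using bij_betw_inv_into_left[OF blk_pos_bij[of X], of r] assms by simp

text \<open>A path through flattened sums amounts to a path of blocks together with a path of
  positions inside these blocks. The premise on \<open>g\<close> and \<open>h\<close> hands over all
  index relations, which separates this bijection from the comparison of signs.\<close>

lemma sum_matrix_paths_flatten:
  fixes Xs :: "'o formal_sum formal_sum list"
  assumes d: "length Xs = Suc d"
    and c: "c < length (concat (map fst (hd Xs)))" and r: "r < length (concat (map fst (last Xs)))"
    and g: "\<And>is js us. \<lbrakk>is \<in> matrix_paths (map (On_obj (flatten C)) Xs) c r;
        js \<in> matrix_paths Xs (blk (hd Xs) c) (blk (last Xs) r);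
        us \<in> matrix_paths (map (\<lambda>k. summand (Xs ! k) (js ! k)) [0..<Suc d])
          (pos (hd Xs) c) (pos (last Xs) r);
        \<And>k. k < Suc d \<Longrightarrow> blk (Xs ! k) (is ! k) = js ! k \<and> pos (Xs ! k) (is ! k) = us ! k\<rbrakk> \<Longrightarrow>
      g is = h js us"
  shows "(\<Sum>is \<in> matrix_paths (map (On_obj (flatten C)) Xs) c r. g is) =
    (\<Sum>js \<in> matrix_paths Xs (blk (hd Xs) c) (blk (last Xs) r).
      \<Sum>us \<in> matrix_paths (map (\<lambda>k. summand (Xs ! k) (js ! k)) [0..<Suc d])
          (pos (hd Xs) c) (pos (last Xs) r). h js us)"
    (is "_ = (\<Sum>js \<in> ?J. \<Sum>us \<in> ?U js. _)")
proof -
  let ?P = "matrix_paths (map (On_obj (flatten C)) Xs) c r"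
  have "Xs \<noteq> []" using d by auto
  have "(\<Sum>js \<in> ?J. \<Sum>us \<in> ?U js. h js us) = (\<Sum>(js, us) \<in> (SIGMA js:?J. ?U js). h js us)"
    by (simp add: sum.Sigma)
  also have "\<dots> = (\<Sum>is \<in> ?P. g is)"
  proof (rule sum.reindex_bij_witness[where
        j = "\<lambda>(js, us). map (\<lambda>k. flat_index (Xs ! k) (js ! k) (us ! k)) [0..<Suc d]"
        and i = "\<lambda>is. (map (\<lambda>k. blk (Xs ! k) (is ! k)) [0..<Suc d], map (\<lambda>k. pos (Xs ! k)
            (is ! k)) [0..<Suc d])"])
    fix p assume p: "p \<in> (SIGMA js:?J. ?U js)"
    obtain js us where p_eq: "p = (js, us)" and js: "js \<in> ?J" and us: "us \<in> ?U js"
      using p by auto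
    have len: "length js = Suc d" "length us = Suc d"
      using js us d by (auto simp: matrix_paths_def)
    have idx: "js ! k < length (Xs ! k)" "us ! k < length (summand (Xs ! k) (js ! k))"
        if "k < Suc d" for k
      using js us that d by (auto simp: matrix_paths_def simp del: upt_Suc)
    let ?is = "map (\<lambda>k. flat_index (Xs ! k) (js ! k) (us ! k)) [0..<Suc d]"
    note ends = path_ends[OF js d]
    have "length (map (\<lambda>k. summand (Xs ! k) (js ! k)) [0..<Suc d]) = Suc d"
      by simp
    note uends = path_ends(1,2)[OF us this]
    have "?is \<in> ?P"
    proof -
      have "hd ?is = c"
        using ends uends c by (simp add: hd_map hd_upt flat_index_blk_pos del: upt_Suc)
      moreover have "last ?is = r"
        using ends uends r by (simp add: flat_index_blk_pos)
      moreover have "?is ! k < length (map (On_obj (flatten C)) Xs ! k)" if "k < Suc d" for k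
        using flat_index(1)[OF idx[OF that]] that d by (simp del: upt_Suc)
      ultimately show ?thesis
        using d by (simp add: matrix_paths_def del: upt_Suc)
    qed
    moreover have "blk (Xs ! k) (?is ! k) = js ! k \<and> pos (Xs ! k) (?is ! k) = us ! k"
        if "k < Suc d" for k
      using flat_index(2,3)[OF idx[OF that]] that by (simp del: upt_Suc)
    moreover have "map (\<lambda>k. blk (Xs ! k) (?is ! k)) [0..<Suc d] = js"
      "map (\<lambda>k. pos (Xs ! k) (?is ! k)) [0..<Suc d] = us"
      using flat_index(2,3)[OF idx] len
      by (auto intro!: nth_equalityI simp del: upt_Suc)
    ultimately show "(case p of (js, us) \<Rightarrow> map (\<lambda>k. flat_index (Xs ! k) (js ! k) (us ! k))
        [0..<Suc d]) \<in> ?P"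
      "(map (\<lambda>k. blk (Xs ! k) ((case p of (js, us) \<Rightarrow> map
          (\<lambda>k. flat_index (Xs ! k) (js ! k) (us ! k)) [0..<Suc d]) ! k)) [0..<Suc d],
        map (\<lambda>k. pos (Xs ! k) ((case p of (js, us) \<Rightarrow> map
            (\<lambda>k. flat_index (Xs ! k) (js ! k) (us ! k)) [0..<Suc d]) ! k)) [0..<Suc d]) = p"
      "g (case p of (js, us) \<Rightarrow> map (\<lambda>k. flat_index (Xs ! k) (js ! k) (us ! k)) [0..<Suc d]) =
          (case p of (js, us) \<Rightarrow> h js us)"
      using g[OF _ js us, of ?is] by (simp_all add: p_eq del: upt_Suc)
  next
    fix "is" assume P: "is \<in> ?P"
    have idx: "is ! k < length (concat (map fst (Xs ! k)))" if "k < Suc d" for k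
      using P that d by (simp add: matrix_paths_def)
    have len: "length is = Suc d"
      using P d by (auto simp: matrix_paths_def)
    have "length (map (On_obj (flatten C)) Xs) = Suc d" using d by simp
    note ends = path_ends(1,2)[OF P this]
    have Xends: "hd Xs = Xs ! 0" "last Xs = Xs ! d"
      using d \<open>Xs \<noteq> []\<close> by (auto simp: hd_conv_nth last_conv_nth)
    show "(case (map (\<lambda>k. blk (Xs ! k) (is ! k)) [0..<Suc d], map (\<lambda>k. pos (Xs ! k) (is ! k))
        [0..<Suc d]) of
        (js, us) \<Rightarrow> map (\<lambda>k. flat_index (Xs ! k) (js ! k) (us ! k)) [0..<Suc d]) = is"
      using flat_index_blk_pos[OF idx] len by (auto intro!: nth_equalityI simp del: upt_Suc)
    show "(map (\<lambda>k. blk (Xs ! k) (is ! k)) [0..<Suc d], map (\<lambda>k. pos (Xs ! k) (is ! k)) [0..<Suc d])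
        \<in> (SIGMA js:?J. ?U js)"
      using blk_pos_range[OF idx] ends d
      by (auto simp: matrix_paths_def hd_map hd_upt last_map Xends simp del: upt_Suc)
  qed
  finally show ?thesis ..
qed

context multilinear_category
begin

text \<open>With outer drops \<open>Q\<close> and inner drops \<open>P\<close>, the two nested
  Koszul signs exceed the flattened one by the sum of \<open>Q i * P j\<close> over
  \<open>i < j\<close>. The signs of \<open>flatten\<close> on the arguments,
  \<open>q k * P k\<close>, and on the value, \<open>q 0 * P k\<close> summed over \<open>k\<close>,
  differ by the same amount modulo 2. This is the origin of the exponent in the definition of
  \<open>flatten\<close>.\<close>

lemma flatten_term:
  assumes comp: "composable (shift_cat (shift_cat C)) Xs ns fs"
    and c: "c < length (concat (map fst (hd Xs)))" and r: "r < length (concat (map fst (last Xs)))"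
    and path: "is \<in> matrix_paths (map (On_obj (flatten C)) Xs) c r"
    and js: "js \<in> matrix_paths Xs (blk (hd Xs) c) (blk (last Xs) r)"
    and us: "us \<in> matrix_paths (map (\<lambda>k. summand (Xs ! k) (js ! k)) [0..<Suc (length fs)])
          (pos (hd Xs) c) (pos (last Xs) r)"
    and idx: "\<And>k. k < Suc (length fs) \<Longrightarrow> blk (Xs ! k) (is ! k) = js ! k \<and> pos (Xs ! k) (is ! k) =
        us ! k"
  shows "shift_mu_term C (map (On_obj (flatten C)) Xs) ns (map_morphisms (flatten C) Xs ns fs) is =
    Scl C (minus_one_pow (shift (hd Xs) (blk (hd Xs) c) *
         (shift (summand (hd Xs) (blk (hd Xs) c)) (pos (hd Xs) c) -
          shift (summand (last Xs) (blk (last Xs) r)) (pos (last Xs) r))))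
      (Scl C (minus_one_pow (\<Sum>j<length fs. \<Sum>i<j.
          path_drop Xs js i * (ns ! j - path_drop Xs js j - 1)))
        (shift_mu_term C (map (\<lambda>k. summand (Xs ! k) (js ! k)) [0..<Suc (length fs)])
          (map (\<lambda>k. ns ! k - path_drop Xs js k) [0..<length fs])
          (map (\<lambda>k. (fs ! k) (js ! Suc k) (js ! k)) [0..<length fs]) us))"
proof -
  define d where "d = length fs"
  define q where "q k = shift (Xs ! k) (js ! k)" for k
  define p where "p k = shift (summand (Xs ! k) (js ! k)) (us ! k)" for k
  define P where "P k = p k - p (Suc k)" for k
  define Q where "Q k = q k - q (Suc k)" for k
  define m where "m k = ns ! k - Q k - P k" for k
  define a where "a k = (fs ! k) (js ! Suc k) (js ! k) (us ! Suc k) (us ! k)" for k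
  let ?Ys = "map (On_obj (flatten C)) Xs"
  let ?gs = "map_morphisms (flatten C) Xs ns fs"
  let ?Zs = "map (\<lambda>k. summand (Xs ! k) (js ! k)) [0..<Suc (length fs)]"
  let ?ms = "map (\<lambda>k. ns ! k - path_drop Xs js k) [0..<length fs]"
  let ?as = "map (\<lambda>k. (fs ! k) (js ! Suc k) (js ! k)) [0..<length fs]"
  let ?Os = "map (\<lambda>k. summand (summand (Xs ! k) (js ! k)) (us ! k)) [0..<Suc d]"
  have len: "length Xs = Suc d" "length ns = d" "length fs = d"
    using comp by (auto simp: composable_def d_def)
  have range: "is ! k < length (concat (map fst (Xs ! k)))" if "k < Suc d" for k
    using path that len by (simp add: matrix_paths_def)
  have idx': "blk (Xs ! k) (is ! k) = js ! k" "pos (Xs ! k) (is ! k) = us ! k" if "k < Suc d" for k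
    using idx that by (auto simp: d_def)
  have Zs_drop: "path_drop ?Zs us k = P k" if "k < d" for k
    using that by (simp add: P_def p_def d_def del: upt_Suc)
  have Os: "map (\<lambda>k. summand (?Zs ! k) (us ! k)) [0..<Suc (length ?as)] = ?Os"
    by (auto simp: d_def simp del: upt_Suc)
  have ms: "map (\<lambda>k. ?ms ! k - path_drop ?Zs us k) [0..<length ?as] = map m [0..<d]"
    using Zs_drop by (auto simp: m_def Q_def q_def d_def simp del: upt_Suc)
  have as: "map (\<lambda>k. (?as ! k) (us ! Suc k) (us ! k)) [0..<length ?as] = map a [0..<d]"
    by (auto simp: a_def d_def)
  have comp': "composable C ?Os (map m [0..<d]) (map a [0..<d])"
    using path_composable[OF path_composable[OF comp js] us] unfolding Os ms as .
  have inner: "shift_mu_term C ?Zs ?ms ?as us =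
      Scl C (minus_one_pow (\<Sum>j<d. \<Sum>i<j. P i * (m j - 1)))
          (Mu C ?Os (map m [0..<d]) (map a [0..<d]))"
  proof -
    have "(\<Sum>j<length ?as. \<Sum>i<j. path_drop ?Zs us i * (?ms ! j - path_drop ?Zs us j - 1)) =
        (\<Sum>j<d. \<Sum>i<j. P i * (m j - 1))"
      using Zs_drop by (auto intro!: sum.cong simp: m_def Q_def q_def d_def simp del: upt_Suc)
    then show ?thesis
      unfolding shift_mu_term_eq Os ms as by simp
  qed
  have Ys_drop: "path_drop ?Ys is k = P k + Q k" if "k < d" for k
    using that range[of k] range[of "Suc k"] idx'[of k] idx'[of "Suc k"] len
    by (simp add: flatten_obj_nth P_def Q_def p_def q_def)
  have Os': "map (\<lambda>k. summand (?Ys ! k) (is ! k)) [0..<Suc (length ?gs)] = ?Os"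
    using range idx' len by (auto simp: flatten_obj_nth simp del: upt_Suc)
  have ms': "map (\<lambda>k. ns ! k - path_drop ?Ys is k) [0..<length ?gs] = map m [0..<d]"
    using Ys_drop len by (auto simp: m_def)
  have as': "map (\<lambda>k. (?gs ! k) (is ! Suc k) (is ! k)) [0..<length ?gs] =
      map (\<lambda>k. Scl C (minus_one_pow (q k * P k)) (a k)) [0..<d]"
  proof (rule nth_equalityI)
    fix k assume "k < length (map (\<lambda>k. (?gs ! k) (is ! Suc k) (is ! k)) [0..<length ?gs])"
    then have k: "k < d" using len by simp
    then show "map (\<lambda>k. (?gs ! k) (is ! Suc k) (is ! k)) [0..<length ?gs] ! k =
        map (\<lambda>k. Scl C (minus_one_pow (q k * P k)) (a k)) [0..<d] ! k"
      using range[of k] range[of "Suc k"] idx'[of k] idx'[of "Suc k"] len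
      by (simp add: map_morphisms_def a_def q_def P_def p_def)
  qed (simp add: len)
  have "shift_mu_term C ?Ys ns ?gs is =
      Scl C (minus_one_pow (\<Sum>j<d. \<Sum>i<j. (P i + Q i) * (m j - 1)))
        (Scl C (minus_one_pow (\<Sum>k<d. q k * P k)) (Mu C ?Os (map m [0..<d]) (map a [0..<d])))"
  proof -
    have "(\<Sum>j<length ?gs. \<Sum>i<j. path_drop ?Ys is i * (ns ! j - path_drop ?Ys is j - 1)) =
        (\<Sum>j<d. \<Sum>i<j. (P i + Q i) * (m j - 1))"
      using Ys_drop len by (auto intro!: sum.cong simp: m_def)
    then show ?thesis
      unfolding shift_mu_term_eq Os' ms' as' mu_scale_all[OF comp'] minus_one_pow_sum by simp
  qed
  then have lhs: "shift_mu_term C ?Ys ns ?gs is =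
      Scl C (minus_one_pow ((\<Sum>j<d. \<Sum>i<j. (P i + Q i) * (m j - 1)) + (\<Sum>k<d. q k * P k)))
        (Mu C ?Os (map m [0..<d]) (map a [0..<d]))"
    by (simp only: scale_scale minus_one_pow_add)
  note ends = path_ends[OF js len(1)]
  have "length ?Zs = Suc d" by (simp add: d_def)
  note uends = path_ends(1,2)[OF us this]
  have outer: "(\<Sum>j<length fs. \<Sum>i<j. path_drop Xs js i * (ns ! j - path_drop Xs js j - 1)) =
      (\<Sum>j<d. \<Sum>i<j. Q i * (m j + P j - 1))"
    by (simp add: d_def Q_def q_def m_def)
  \<comment> \<open>The inner drops telescope, so the sign on the value is also a sum over the
    arguments, with the outer shift of the initial block throughout.\<close>
  have head: "shift (hd Xs) (blk (hd Xs) c) *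
         (shift (summand (hd Xs) (blk (hd Xs) c)) (pos (hd Xs) c) -
          shift (summand (last Xs) (blk (last Xs) r)) (pos (last Xs) r)) = (\<Sum>k<d. q 0 * P k)"
    using sum_path_drop[of p d] ends uends by (simp add: q_def p_def P_def flip: sum_distrib_left)
  \<comment> \<open>Telescoping the outer drops turns the cross terms into a single sum over
    \<open>j\<close>.\<close>
  have Q_sum: "(\<Sum>i<j. Q i * P j) = (q 0 - q j) * P j" for j
    using sum_path_drop[of q j] by (simp add: Q_def flip: sum_distrib_right)
  have "(\<Sum>j<d. \<Sum>i<j. (P i + Q i) * (m j - 1)) + (\<Sum>k<d. q k * P k) -
      ((\<Sum>k<d. q 0 * P k) + (\<Sum>j<d. \<Sum>i<j. Q i * (m j + P j - 1)) + (\<Sum>j<d. \<Sum>i<j. P i * (m j - 1))) =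
      (\<Sum>k<d. q k * P k) - (\<Sum>k<d. q 0 * P k) - (\<Sum>j<d. \<Sum>i<j. Q i * P j)"
    by (simp add: algebra_simps sum.distrib sum_subtractf)
  also have "\<dots> = 2 * (\<Sum>k<d. (q k - q 0) * P k)"
    unfolding Q_sum by (simp add: algebra_simps sum.distrib sum_subtractf)
  finally have "even ((\<Sum>j<d. \<Sum>i<j. (P i + Q i) * (m j - 1)) + (\<Sum>k<d. q k * P k) -
      ((\<Sum>k<d. q 0 * P k) + (\<Sum>j<d. \<Sum>i<j. Q i * (m j + P j - 1)) + (\<Sum>j<d. \<Sum>i<j. P i * (m j - 1))))"
    by simp
  from minus_one_pow_cong[OF this, where 'k = 'k] show ?thesis
    unfolding lhs inner outer head by (simp only: scale_scale minus_one_pow_add mult.assoc)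
qed

lemma flatten_mu:
  assumes comp: "composable (shift_cat (shift_cat C)) Xs ns fs"
  shows "On_hom (flatten C) (hd Xs) (last Xs) n (Mu (shift_cat (shift_cat C)) Xs ns fs) =
    Mu (shift_cat C) (map (On_obj (flatten C)) Xs) ns (map_morphisms (flatten C) Xs ns fs)"
proof (intro ext)
  fix r c
  let ?Ys = "map (On_obj (flatten C)) Xs"
  let ?gs = "map_morphisms (flatten C) Xs ns fs"
  have len: "length Xs = Suc (length fs)"
    using comp by (simp add: composable_def)
  show "On_hom (flatten C) (hd Xs) (last Xs) n (Mu (shift_cat (shift_cat C)) Xs ns fs) r c =
      Mu (shift_cat C) ?Ys ns ?gs r c"
  proof (cases "c < length (concat (map fst (hd Xs))) \<and> r < length (concat (map fst (last Xs)))")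
    case True
    then have c: "c < length (concat (map fst (hd Xs)))" and r:
        "r < length (concat (map fst (last Xs)))"
      by auto
    let ?Zs = "\<lambda>js. map (\<lambda>k. summand (Xs ! k) (js ! k)) [0..<Suc (length fs)]"
    let ?U = "\<lambda>js. matrix_paths (?Zs js) (pos (hd Xs) c) (pos (last Xs) r)"
    have inner: "shift_mu_term (shift_cat C) Xs ns fs js (pos (last Xs) r) (pos (hd Xs) c) =
        Scl C (minus_one_pow (\<Sum>j<length fs. \<Sum>i<j.
            path_drop Xs js i * (ns ! j - path_drop Xs js j - 1)))
          (\<Sum>us \<in> ?U js. shift_mu_term C (?Zs js)
            (map (\<lambda>k. ns ! k - path_drop Xs js k) [0..<length fs])
            (map (\<lambda>k. (fs ! k) (js ! Suc k) (js ! k)) [0..<length fs]) us)" for js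
      unfolding shift_mu_term_eq[of "shift_cat C"] shift_cat_simps ..
    have "On_hom (flatten C) (hd Xs) (last Xs) n (Mu (shift_cat (shift_cat C)) Xs ns fs) r c =
        Scl C (minus_one_pow (shift (hd Xs) (blk (hd Xs) c) *
         (shift (summand (hd Xs) (blk (hd Xs) c)) (pos (hd Xs) c) -
          shift (summand (last Xs) (blk (last Xs) r)) (pos (last Xs) r))))
        (\<Sum>js \<in> matrix_paths Xs (blk (hd Xs) c) (blk (last Xs) r).
          shift_mu_term (shift_cat C) Xs ns fs js (pos (last Xs) r) (pos (hd Xs) c))"
      unfolding flatten_hom shift_cat_simps(3)[of "shift_cat C"] sum_apply using True by simp
    also have "\<dots> = (\<Sum>is \<in> matrix_paths ?Ys c r. shift_mu_term C ?Ys ns ?gs is)"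
      unfolding inner scale_sum_right
      by (rule sum_matrix_paths_flatten[OF len c r flatten_term[OF comp c r], symmetric])
    finally show ?thesis by simp
  next
    case False
    have "?Ys \<noteq> []" "hd ?Ys = On_obj (flatten C) (hd Xs)" "last ?Ys = On_obj (flatten C) (last Xs)"
      using len by (auto simp: hd_map last_map simp flip: length_greater_0_conv)
    then have "matrix_paths ?Ys c r = {}"
      using False matrix_paths_range[of _ ?Ys c r] by auto
    then show ?thesis
      using False by auto
  qed
qed

lemma flatten_functor: "ainf_functor (shift_cat (shift_cat C)) (shift_cat C) (flatten C)"
proof
  fix X assume X: "X \<in> Obj (shift_cat (shift_cat C))"
  show "On_obj (flatten C) X \<in> Obj (shift_cat C)"
    using X by (force simp: flatten_def)
  show "On_hom (flatten C) X X 0 (Unit (shift_cat (shift_cat C)) X) =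
      Unit (shift_cat C) (On_obj (flatten C) X)"
  proof (intro ext)
    fix r c
    show "On_hom (flatten C) X X 0 (Unit (shift_cat (shift_cat C)) X) r c =
        Unit (shift_cat C) (On_obj (flatten C) X) r c"
    proof (cases "c < length (concat (map fst X)) \<and> r < length (concat (map fst X)) \<and> r \<noteq> c")
      case True
      \<comment> \<open>A flat position is determined by its block and its position there, so an
        off-diagonal flat entry is off-diagonal at one of the two levels.\<close>
      then have "blk X r \<noteq> blk X c \<or> pos X r \<noteq> pos X c"
        using flat_index_blk_pos[of r X] flat_index_blk_pos[of c X] by auto
      then have "Unit (shift_cat (shift_cat C)) X (blk X r) (blk X c) (pos X r) (pos X c) = 0"
        by auto
      then show ?thesis
        using True unfolding flatten_hom by simp
    next
      case False
      show ?thesis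
      proof (cases "c < length (concat (map fst X)) \<and> r = c")
        case True
        then have "Unit (shift_cat (shift_cat C)) X (blk X r) (blk X c) (pos X r) (pos X c) =
            Unit C (summand (summand X (blk X c)) (pos X c))"
          using blk_pos_range[of c X] by simp
        then show ?thesis
          using True unfolding flatten_hom by (simp add: flatten_obj_nth)
      next
        case False
        then show ?thesis
          using \<open>\<not> (c < _ \<and> r < _ \<and> r \<noteq> c)\<close> unfolding flatten_hom by auto
      qed
    qed
  qed
next
  fix X Y n f
  assume X: "X \<in> Obj (shift_cat (shift_cat C))" and Y: "Y \<in> Obj (shift_cat (shift_cat C))"
    and f: "f \<in> Hom (shift_cat (shift_cat C)) X Y n"
  have entry: "f j i v u \<in> Hom C (summand (summand X i) u) (summand (summand Y j) v)
      (n - (shift X i - shift Y j) - (shift (summand X i) u - shift (summand Y j) v))"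
    if "i < length X" "j < length Y" "u < length (summand X i)" "v < length (summand Y j)"
        for i j u v
  proof -
    have "f j i \<in> Hom (shift_cat C) (summand X i) (summand Y j) (n - (shift X i - shift Y j))"
      using f that by (simp add: shift_cat_hom[of _ "shift_cat C"])
    then show ?thesis
      using that by (simp add: shift_cat_hom)
  qed
  have obj: "summand (summand Z i) u \<in> Obj C" if "Z \<in> Obj (shift_cat (shift_cat C))" "i < length Z"
    "u < length (summand Z i)" for Z i u
    using shift_cat_obj_summand[OF shift_cat_obj_summand[OF that(1,2)] that(3)] .
  have "On_hom (flatten C) X Y n f r c \<in> Hom C (summand (On_obj (flatten C) X) c)
      (summand (On_obj (flatten C) Y) r) (n -
          (shift (On_obj (flatten C) X) c - shift (On_obj (flatten C) Y) r))"
    if "c < length (concat (map fst X))" "r < length (concat (map fst Y))" for r c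
  proof -
    note b = blk_pos_range[OF that(1)] blk_pos_range[OF that(2)]
    show ?thesis
      using hom_scale[OF obj[OF X b(1,2)] obj[OF Y b(3,4)] entry[OF b(1,3,2,4)]] that
      by (simp add: flatten_obj_nth algebra_simps)
  qed
  then show "On_hom (flatten C) X Y n f \<in> Hom (shift_cat C) (On_obj (flatten C) X)
      (On_obj (flatten C) Y) n"
    by (auto simp: shift_cat_hom)
next
  fix Xs ns fs assume "composable (shift_cat (shift_cat C)) Xs ns fs"
  then show "On_hom (flatten C) (hd Xs) (last Xs) (sum_list ns + 2 - int (length fs))
        (Mu (shift_cat (shift_cat C)) Xs ns fs) =
      Mu (shift_cat C) (map (On_obj (flatten C)) Xs) ns (map_morphisms (flatten C) Xs ns fs)"
    by (rule flatten_mu)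
qed (auto simp: fun_eq_iff scale_right_distrib mult.commute)

end

section \<open>Twisted complexes\<close>

text \<open>In contrast to \<open>composable\<close> the empty word is allowed, as an induction over
  words requires.\<close>

definition chain :: "('k, 'o, 'm) ainf \<Rightarrow> 'o list \<Rightarrow> int list \<Rightarrow> 'm list \<Rightarrow> bool" where
  "chain C Xs ns as \<longleftrightarrow> length Xs = Suc (length as) \<and> length ns = length as \<and> set Xs \<subseteq> Obj C \<and>
     (\<forall>i < length as. as ! i \<in> Hom C (Xs ! i) (Xs ! Suc i) (ns ! i))"

lemma composable_chain: "composable C Xs ns as \<longleftrightarrow> as \<noteq> [] \<and> chain C Xs ns as"
  by (auto simp: composable_def chain_def)

lemma chain_Cons [simp]:
  "chain C (X # Y # Xs) (n # ns) (a # as) \<longleftrightarrow> X \<in> Obj C \<and> a \<in> Hom C X Y n \<and> chain C (Y # Xs) ns as"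
  unfolding chain_def by (simp add: All_less_Suc2) blast

lemma chain_single [simp]: "chain C [X] [] [] \<longleftrightarrow> X \<in> Obj C"
  by (simp add: chain_def)

lemma map_morphisms_Nil [simp]: "map_morphisms F Xs ns [] = []"
  by (simp add: map_morphisms_def)

lemma map_morphisms_Cons [simp]:
  "map_morphisms F (X # Y # Xs) (n # ns) (a # as) =
      On_hom F X Y n a # map_morphisms F (Y # Xs) ns as"
  unfolding map_morphisms_def length_Cons upt_conv_Cons[OF zero_less_Suc] map_Suc_upt[symmetric]
  by simp

lemma chain_replicate:
  assumes "X \<in> Obj C" "\<delta> \<in> Hom C X X 1" "chain C (X # Xs) ns as"
  shows "chain C (replicate i X @ X # Xs) (replicate i 1 @ ns) (replicate i \<delta> @ as)"
proof (induction i)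
  case (Suc i)
  then show ?case
    using assms(1,2) by (simp add: replicate_app_Cons_same)
qed (simp add: assms)

lemma map_morphisms_replicate:
  "map_morphisms F (replicate i X @ X # Xs) (replicate i 1 @ ns) (replicate i \<delta> @ as) =
    replicate i (On_hom F X X 1 \<delta>) @ map_morphisms F (X # Xs) ns as"
  by (induction i) (simp_all add: replicate_app_Cons_same)

text \<open>The objects, and below the degrees and morphisms, of the word in
  \<open>tw_mu_term\<close>. As separate functions they satisfy the recursions
  \<open>tw_word_simps\<close>.\<close>

definition tw_objs :: "('o formal_sum \<times> 'm matrix) list \<Rightarrow> nat list \<Rightarrow> 'o formal_sum list" where
  "tw_objs Ts is = concat (map (\<lambda>(T, i). replicate (i + 1) (fst T)) (zip Ts is))"

definition tw_degs :: "nat list \<Rightarrow> int list \<Rightarrow> int list" where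
  "tw_degs is ns = interleave (map (\<lambda>i. replicate i 1) is) ns"

definition tw_mors :: "('o formal_sum \<times> 'm matrix) list \<Rightarrow> nat list \<Rightarrow> 'm matrix list \<Rightarrow> 'm matrix
    list" where
  "tw_mors Ts is fs = interleave (map (\<lambda>(T, i). replicate i (snd T)) (zip Ts is)) fs"

lemma tw_word_simps [simp]:
  "tw_objs [T] [i] = replicate i (fst T) @ [fst T]"
  "tw_objs (T # T' # Ts) (i # i' # is) = replicate i (fst T) @ fst T # tw_objs (T' # Ts) (i' # is)"
  "tw_degs [i] [] = replicate i 1"
  "tw_degs (i # is) (n # ns) = replicate i 1 @ n # tw_degs is ns"
  "tw_mors [T] [i] [] = replicate i (snd T)"
  "tw_mors (T # Ts) (i # is) (f # fs) = replicate i (snd T) @ f # tw_mors Ts is fs"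
  by (simp_all add: tw_objs_def tw_degs_def tw_mors_def replicate_app_Cons_same)

lemma tw_mu_term_word:
  "tw_mu_term C Ts ns fs is = Mu (shift_cat C) (tw_objs Ts is) (tw_degs is ns) (tw_mors Ts is fs)"
  by (simp add: tw_mu_term_def tw_objs_def tw_degs_def tw_mors_def)

lemma tw_objs_Cons: "\<exists>Xs. tw_objs (T # Ts) (i # is) = fst T # Xs"
  by (simp add: tw_objs_def)

definition maurer_cartan :: "('k::field, 'o, 'm::ab_group_add) ainf \<Rightarrow> 'o formal_sum \<Rightarrow> 'm matrix \<Rightarrow>
    'm matrix" where
  "maurer_cartan C X \<delta> = Sum_any (\<lambda>d. if d > 0
          then Mu (shift_cat C) (replicate (d + 1) X) (replicate d 1) (replicate d \<delta>)
          else 0)"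

lemma Tw_simps [simp]:
  "Obj (Tw C) = {T. fst T \<in> Obj (shift_cat C) \<and> snd T \<in> Hom (shift_cat C) (fst T) (fst T) 1 \<and>
        strictly_lower_triangular (length (fst T)) (snd T) \<and> maurer_cartan C (fst T) (snd T) = 0}"
  "Scl (Tw C) = Scl (shift_cat C)"
  "Hom (Tw C) S T = Hom (shift_cat C) (fst S) (fst T)"
  "Mu (Tw C) Ts ns fs = Sum_any (\<lambda>is. if length is =
      length Ts then tw_mu_term C Ts ns fs is else 0)"
  "Unit (Tw C) T = Unit (shift_cat C) (fst T)"
  by (simp_all add: Tw_def split_def maurer_cartan_def del: shift_cat_simps)

lemma tw_extend_simps [simp]:
  "fst (On_obj (tw_extend K) T) = On_obj K (fst T)"
  "snd (On_obj (tw_extend K) T) = On_hom K (fst T) (fst T) 1 (snd T)"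
  "On_hom (tw_extend K) S T = On_hom K (fst S) (fst T)"
  by (simp_all add: tw_extend_def split_def)

text \<open>Each inserted twisting morphism has degree 1 and lengthens the word by 1, so degree
  minus length, and with it the degree of the value, does not depend on \<open>is\<close>. A single
  induction yields all the facts about the words.\<close>

lemma tw_word:
  assumes "chain (Tw C) Ts ns fs" "length is = length Ts"
  shows "chain (shift_cat C) (tw_objs Ts is) (tw_degs is ns) (tw_mors Ts is fs) \<and>
    hd (tw_objs Ts is) = fst (hd Ts) \<and> last (tw_objs Ts is) = fst (last Ts) \<and>
    sum_list (tw_degs is ns) - int (length (tw_mors Ts is fs)) = sum_list ns - int (length fs) \<and>
    map (On_obj K) (tw_objs Ts is) = tw_objs (map (On_obj (tw_extend K)) Ts) is \<and>
    map_morphisms K (tw_objs Ts is) (tw_degs is ns) (tw_mors Ts is fs) =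
      tw_mors (map (On_obj (tw_extend K)) Ts) is (map_morphisms (tw_extend K) Ts ns fs)"
  using assms
proof (induction fs arbitrary: Ts ns "is")
  case Nil
  then obtain T i where "Ts = [T]" "is = [i]" "ns = []"
    by (auto simp: chain_def length_Suc_conv)
  with Nil show ?case
    using chain_replicate[of "fst T" "shift_cat C" "snd T" "[]" "[]" "[]" i]
      map_morphisms_replicate[of K i "fst T" "[]" "[]" "snd T" "[]"]
    by (cases i) (simp_all add: sum_list_replicate del: shift_cat_simps)
next
  case (Cons f fs)
  from Cons.prems obtain T T' Ts' n ns' i i' is'
    where eq: "Ts = T # T' # Ts'" "ns = n # ns'" "is = i # i' # is'"
    by (auto simp: chain_def length_Suc_conv)
  obtain Ys where Ys: "tw_objs (T' # Ts') (i' # is') = fst T' # Ys"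
    using tw_objs_Cons by blast
  have "chain (Tw C) (T' # Ts') ns' fs" and T: "T \<in> Obj (Tw C)" "f \<in> Hom (Tw C) T T' n"
    using Cons.prems by (auto simp: eq simp del: Tw_simps)
  from Cons.IH[OF this(1), of "i' # is'"] Cons.prems(2) eq
  have IH: "chain (shift_cat C) (fst T' # Ys) (tw_degs (i' # is') ns')
      (tw_mors (T' # Ts') (i' # is') fs)"
    "last (fst T' # Ys) = fst (last (T' # Ts'))"
    "sum_list (tw_degs (i' # is') ns') - int (length (tw_mors (T' # Ts') (i' # is') fs)) =
      sum_list ns' - int (length fs)"
    "map (On_obj K) (fst T' # Ys) = tw_objs (map (On_obj (tw_extend K)) (T' # Ts')) (i' # is')"
    "map_morphisms K (fst T' # Ys) (tw_degs (i' # is') ns') (tw_mors (T' # Ts') (i' # is') fs) =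
      tw_mors (map (On_obj (tw_extend K)) (T' # Ts')) (i' # is')
          (map_morphisms (tw_extend K) (T' # Ts') ns' fs)"
    unfolding Ys by auto
  have "chain (shift_cat C) (replicate i (fst T) @ fst T # fst T' # Ys)
      (replicate i 1 @ n # tw_degs (i' # is') ns')
          (replicate i (snd T) @ f # tw_mors (T' # Ts') (i' # is') fs)"
    by (rule chain_replicate) (use IH(1) T in \<open>simp_all del: shift_cat_simps\<close>)
  moreover have "hd (replicate i (fst T) @ fst T # fst T' # Ys) = fst T"
    by (cases i) auto
  ultimately show ?case
    using IH(2-5) Ys
    by (simp add: eq map_morphisms_replicate sum_list_replicate del: shift_cat_simps)
qed

lemma tw_mu_term_composable:
  assumes "chain (Tw C) Ts ns fs" "length is = length Ts" "fs \<noteq> []"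
  shows "composable (shift_cat C) (tw_objs Ts is) (tw_degs is ns) (tw_mors Ts is fs)"
proof -
  have "tw_mors Ts is fs \<noteq> []"
  proof
    assume "tw_mors Ts is fs = []"
    moreover obtain f fs' where "fs = f # fs'" using assms(3) by (cases fs) auto
    moreover obtain T Ts' i is' where "Ts = T # Ts'" "is = i # is'"
      using assms(1,2) by (auto simp: chain_def length_Suc_conv)
    ultimately show False by simp
  qed
  then show ?thesis
    using tw_word[OF assms(1,2), THEN conjunct1] by (simp add: composable_chain)
qed

text \<open>
  \<open>V X Y\<close> stands for the matrices supported on the index ranges of \<open>X\<close> and \<open>Y\<close>, of no particular
  degree: it contains all values of the operations, while \<open>K\<close> is still injective on it.
\<close>

locale formal_sum_functor = ainf_functor "shift_cat C" "shift_cat D" K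
  for C :: "('k::field, 'o, 'm::ab_group_add) ainf" and D ::
      "('k, 'p, 'n::ab_group_add) ainf" and K +
  fixes V :: "'o formal_sum \<Rightarrow> 'o formal_sum \<Rightarrow> 'm matrix set"
  assumes additive: "On_hom K X Y n (a + b) = On_hom K X Y n a + On_hom K X Y n b"
    and kernel: "\<lbrakk>a \<in> V X Y; On_hom K X Y n a = 0\<rbrakk> \<Longrightarrow> a = 0"
    and V_0: "0 \<in> V X Y"
    and V_diff: "\<lbrakk>a \<in> V X Y; b \<in> V X Y\<rbrakk> \<Longrightarrow> a - b \<in> V X Y"
    and hom_V: "a \<in> Hom (shift_cat C) X Y n \<Longrightarrow> a \<in> V X Y"
    and mu_V: "composable (shift_cat C) Xs ns fs \<Longrightarrow> Mu (shift_cat C) Xs ns fs \<in> V (hd Xs) (last Xs)"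
    and full: "\<lbrakk>X \<in> Obj (shift_cat C); Y \<in> Obj (shift_cat C);
        g \<in> Hom (shift_cat D) (On_obj K X) (On_obj K Y) n\<rbrakk> \<Longrightarrow>
      g \<in> On_hom K X Y n ` Hom (shift_cat C) X Y n"
    and triangular: "\<lbrakk>X \<in> Obj (shift_cat C); \<delta> \<in> Hom (shift_cat C) X X 1;
        strictly_lower_triangular (length X) \<delta>\<rbrakk> \<Longrightarrow>
      strictly_lower_triangular (length (On_obj K X)) (On_hom K X X 1 \<delta>)"
    and lift: "\<lbrakk>Z \<in> Obj (shift_cat D); \<epsilon> \<in> Hom (shift_cat D) Z Z 1;
        strictly_lower_triangular (length Z) \<epsilon>\<rbrakk> \<Longrightarrow>
      \<exists>X \<in> Obj (shift_cat C). \<exists>\<delta> \<in> Hom (shift_cat C) X X 1.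
        On_obj K X = Z \<and> On_hom K X X 1 \<delta> = \<epsilon> \<and> strictly_lower_triangular (length X) \<delta>"
begin

lemma on_0: "On_hom K X Y n 0 = 0"
  using additive[of X Y n 0 0] by simp

lemma V_add: "\<lbrakk>a \<in> V X Y; b \<in> V X Y\<rbrakk> \<Longrightarrow> a + b \<in> V X Y"
  using V_diff[OF _ V_diff[OF V_0], of a X Y b] by simp

lemma inj_V: "inj_on (On_hom K X Y n) (V X Y)"
proof (rule inj_onI)
  fix a b assume "a \<in> V X Y" "b \<in> V X Y" "On_hom K X Y n a = On_hom K X Y n b"
  then show "a = b"
    using kernel[OF V_diff, of a X Y b n] additive[of X Y n "a - b" b] by simp
qed

lemma on_eq_0_iff: "a \<in> V X Y \<Longrightarrow> On_hom K X Y n a = 0 \<longleftrightarrow> a = 0"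
  using kernel on_0 by blast

lemma V_sum: "(\<And>i. i \<in> S \<Longrightarrow> g i \<in> V X Y) \<Longrightarrow> sum g S \<in> V X Y"
  by (induction S rule: infinite_finite_induct) (auto simp: V_0 V_add)

lemma V_Sum_any: "(\<And>i. g i \<in> V X Y) \<Longrightarrow> Sum_any g \<in> V X Y"
  unfolding Sum_any.expand_set by (rule V_sum)

text \<open>
  Injectivity makes the two families have the same support, so that no finiteness is needed here.
\<close>

lemma on_Sum_any:
  assumes "\<And>i. g i \<in> V X Y"
  shows "On_hom K X Y n (Sum_any g) = Sum_any (\<lambda>i. On_hom K X Y n (g i))"
proof -
  have sum: "On_hom K X Y n (sum g S) = (\<Sum>i\<in>S. On_hom K X Y n (g i))" for S
    by (induction S rule: infinite_finite_induct)
      (simp_all only: sum.infinite sum.empty sum.insert on_0 additive not_False_eq_True)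
  have "{i. g i \<noteq> 0} = {i. On_hom K X Y n (g i) \<noteq> 0}"
    using kernel[OF assms] on_0 by auto
  then show ?thesis
    unfolding Sum_any.expand_set sum by simp
qed

section \<open>Maurer-Cartan equation and operations under the extended functor\<close>

lemma maurer_cartan_term:
  assumes "X \<in> Obj (shift_cat C)" "\<delta> \<in> Hom (shift_cat C) X X 1" "d > 0"
  shows "Mu (shift_cat C) (replicate (d + 1) X) (replicate d 1) (replicate d \<delta>) \<in> V X X"
    "On_hom K X X 2 (Mu (shift_cat C) (replicate (d + 1) X) (replicate d 1) (replicate d \<delta>)) =
      Mu (shift_cat D) (replicate (d + 1) (On_obj K X)) (replicate d 1)
        (replicate d (On_hom K X X 1 \<delta>))"
proof -
  have comp: "composable (shift_cat C) (replicate (d + 1) X) (replicate d 1) (replicate d \<delta>)"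
    using assms by (auto simp: composable_def nth_Cons' simp del: shift_cat_simps)
  have [simp]: "replicate (d + 1) X \<noteq> []" by simp
  show "Mu (shift_cat C) (replicate (d + 1) X) (replicate d 1) (replicate d \<delta>) \<in> V X X"
    using mu_V[OF comp] by (simp del: replicate_Suc shift_cat_simps)
  have "map_morphisms K (replicate (d + 1) X) (replicate d 1) (replicate d \<delta>) =
      replicate d (On_hom K X X 1 \<delta>)"
    by (auto simp: map_morphisms_def nth_Cons' intro!: nth_equalityI)
  \<comment> \<open>The degree 2 is \<open>d + 2 - d\<close>, for \<open>d\<close> arguments of
    degree 1.\<close>
  then show "On_hom K X X 2 (Mu (shift_cat C) (replicate (d + 1) X) (replicate d 1)
      (replicate d \<delta>)) =
      Mu (shift_cat D) (replicate (d + 1) (On_obj K X)) (replicate d 1)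
        (replicate d (On_hom K X X 1 \<delta>))"
    using on_mu[OF comp] by (simp add: sum_list_replicate del: replicate_Suc shift_cat_simps)
qed

text \<open>Injectivity on \<open>V\<close> gives the implication towards \<open>C\<close>, by which
  twisted complexes are lifted; the other implication makes the functor preserve twisted
  complexes.\<close>

lemma maurer_cartan_eq_0:
  assumes "X \<in> Obj (shift_cat C)" "\<delta> \<in> Hom (shift_cat C) X X 1"
  shows "maurer_cartan D (On_obj K X) (On_hom K X X 1 \<delta>) = 0 \<longleftrightarrow> maurer_cartan C X \<delta> = 0"
proof -
  let ?g = "\<lambda>d. if d > 0
      then Mu (shift_cat C) (replicate (d + 1) X) (replicate d 1) (replicate d \<delta>) else 0"
  have V: "?g d \<in> V X X" for d
    using maurer_cartan_term(1)[OF assms, of d] V_0 by (simp del: shift_cat_simps replicate_Suc)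
  have "maurer_cartan D (On_obj K X) (On_hom K X X 1 \<delta>) = Sum_any (\<lambda>d. On_hom K X X 2 (?g d))"
    unfolding maurer_cartan_def
    using maurer_cartan_term(2)[OF assms] by (intro Sum_any.cong) (simp add: on_0 del:
        shift_cat_simps replicate_Suc)
  also have "\<dots> = On_hom K X X 2 (maurer_cartan C X \<delta>)"
    unfolding maurer_cartan_def by (rule on_Sum_any[symmetric]) (fact V)
  finally have eq: "maurer_cartan D (On_obj K X) (On_hom K X X 1 \<delta>) =
      On_hom K X X 2 (maurer_cartan C X \<delta>)" .
  have "maurer_cartan C X \<delta> \<in> V X X"
    unfolding maurer_cartan_def by (rule V_Sum_any) (fact V)
  then show ?thesis
    unfolding eq by (rule on_eq_0_iff)
qed

lemma tw_term:
  assumes chain: "chain (Tw C) Ts ns fs" and ne: "fs \<noteq> []" and len: "length is = length Ts"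
  shows "tw_mu_term C Ts ns fs is \<in> V (fst (hd Ts)) (fst (last Ts))"
    "On_hom K (fst (hd Ts)) (fst (last Ts)) (sum_list ns + 2 - int (length fs))
        (tw_mu_term C Ts ns fs is) =
      tw_mu_term D (map (On_obj (tw_extend K)) Ts) ns (map_morphisms (tw_extend K) Ts ns fs) is"
proof -
  note comp = tw_mu_term_composable[OF chain len ne]
  note word = tw_word[OF chain len, of K]
  have ends: "hd (tw_objs Ts is) = fst (hd Ts)" "last (tw_objs Ts is) = fst (last Ts)"
    and maps: "map (On_obj K) (tw_objs Ts is) = tw_objs (map (On_obj (tw_extend K)) Ts) is"
      "map_morphisms K (tw_objs Ts is) (tw_degs is ns) (tw_mors Ts is fs) =
        tw_mors (map (On_obj (tw_extend K)) Ts) is (map_morphisms (tw_extend K) Ts ns fs)"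
    using word by blast+
  show "tw_mu_term C Ts ns fs is \<in> V (fst (hd Ts)) (fst (last Ts))"
    using mu_V[OF comp] unfolding ends tw_mu_term_word .
  have deg: "sum_list (tw_degs is ns) + 2 - int (length (tw_mors Ts is fs)) =
      sum_list ns + 2 - int (length fs)"
    using word by linarith
  show "On_hom K (fst (hd Ts)) (fst (last Ts)) (sum_list ns + 2 - int (length fs))
      (tw_mu_term C Ts ns fs is) =
      tw_mu_term D (map (On_obj (tw_extend K)) Ts) ns (map_morphisms (tw_extend K) Ts ns fs) is"
    using on_mu[OF comp] unfolding tw_mu_term_word deg ends maps .
qed

lemma tw_mu:
  assumes chain: "chain (Tw C) Ts ns fs" and ne: "fs \<noteq> []"
  shows "Mu (Tw C) Ts ns fs \<in> V (fst (hd Ts)) (fst (last Ts))"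
    "On_hom K (fst (hd Ts)) (fst (last Ts)) (sum_list ns + 2 - int (length fs))
        (Mu (Tw C) Ts ns fs) =
      Mu (Tw D) (map (On_obj (tw_extend K)) Ts) ns (map_morphisms (tw_extend K) Ts ns fs)"
proof -
  let ?g = "\<lambda>is. if length is = length Ts then tw_mu_term C Ts ns fs is else 0"
  have V: "?g is \<in> V (fst (hd Ts)) (fst (last Ts))" for "is"
    using tw_term(1)[OF assms] V_0 by simp
  then show "Mu (Tw C) Ts ns fs \<in> V (fst (hd Ts)) (fst (last Ts))"
    by (simp add: V_Sum_any)
  have "On_hom K (fst (hd Ts)) (fst (last Ts)) (sum_list ns + 2 - int (length fs)) (Sum_any ?g) =
      Sum_any (\<lambda>is. On_hom K (fst (hd Ts)) (fst (last Ts)) (sum_list ns + 2 - int (length fs))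
          (?g is))"
    by (rule on_Sum_any) (fact V)
  also have "\<dots> = Mu (Tw D) (map (On_obj (tw_extend K)) Ts) ns
      (map_morphisms (tw_extend K) Ts ns fs)"
    unfolding Tw_simps by (intro Sum_any.cong) (simp add: tw_term(2)[OF assms] on_0 if_distrib)
  finally show "On_hom K (fst (hd Ts)) (fst (last Ts)) (sum_list ns + 2 - int (length fs))
      (Mu (Tw C) Ts ns fs) =
      Mu (Tw D) (map (On_obj (tw_extend K)) Ts) ns (map_morphisms (tw_extend K) Ts ns fs)"
    by simp
qed

lemma tw_functor: "ainf_functor (Tw C) (Tw D) (tw_extend K)"
proof
  fix T assume "T \<in> Obj (Tw C)"
  then have T: "fst T \<in> Obj (shift_cat C)" "snd T \<in> Hom (shift_cat C) (fst T) (fst T) 1"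
    "strictly_lower_triangular (length (fst T)) (snd T)" "maurer_cartan C (fst T) (snd T) = 0"
    by (simp_all del: shift_cat_simps)
  show "On_obj (tw_extend K) T \<in> Obj (Tw D)"
    unfolding Tw_simps tw_extend_simps mem_Collect_eq
    using on_obj[OF T(1)] on_hom[OF T(1,1,2)] triangular[OF T(1-3)] maurer_cartan_eq_0[OF T(1,2)]
        T(4)
    by blast
  show "On_hom (tw_extend K) T T 0 (Unit (Tw C) T) = Unit (Tw D) (On_obj (tw_extend K) T)"
    unfolding Tw_simps tw_extend_simps by (rule on_unit[OF T(1)])
next
  fix S T n f assume "S \<in> Obj (Tw C)" "T \<in> Obj (Tw C)" "f \<in> Hom (Tw C) S T n"
  then have ST: "fst S \<in> Obj (shift_cat C)" "fst T \<in> Obj (shift_cat C)"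
    "f \<in> Hom (shift_cat C) (fst S) (fst T) n"
    by (simp_all del: shift_cat_simps)
  show "On_hom (tw_extend K) S T n f \<in> Hom (Tw D) (On_obj (tw_extend K) S)
      (On_obj (tw_extend K) T) n"
    unfolding Tw_simps tw_extend_simps by (rule on_hom[OF ST])
  show "On_hom (tw_extend K) S T n (Scl (Tw C) c f) = Scl (Tw D) c (On_hom (tw_extend K) S T n f)"
      for c
    unfolding Tw_simps tw_extend_simps by (rule on_hom_scale[OF ST])
next
  fix Ts ns fs assume "composable (Tw C) Ts ns fs"
  then have "chain (Tw C) Ts ns fs" "fs \<noteq> []" by (auto simp: composable_chain)
  then show "On_hom (tw_extend K) (hd Ts) (last Ts) (sum_list ns + 2 - int (length fs))
      (Mu (Tw C) Ts ns fs) =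
      Mu (Tw D) (map (On_obj (tw_extend K)) Ts) ns (map_morphisms (tw_extend K) Ts ns fs)"
    unfolding tw_extend_simps by (rule tw_mu(2))
next
  fix S T n f g
  show "On_hom (tw_extend K) S T n (f + g) = On_hom (tw_extend K) S T n f +
      On_hom (tw_extend K) S T n g"
    unfolding tw_extend_simps by (rule additive)
qed

section \<open>The induced map on cohomology and surjectivity on objects\<close>

lemma tw_hom_image:
  assumes "S \<in> Obj (Tw C)" "T \<in> Obj (Tw C)"
  shows "On_hom K (fst S) (fst T) n ` Hom (Tw C) S T n =
    Hom (Tw D) (On_obj (tw_extend K) S) (On_obj (tw_extend K) T) n"
proof -
  have "fst S \<in> Obj (shift_cat C)" "fst T \<in> Obj (shift_cat C)"
    using assms by (simp_all del: shift_cat_simps)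
  then show ?thesis
    unfolding Tw_simps tw_extend_simps using on_hom full by blast
qed

lemma tw_mu1:
  assumes "S \<in> Obj (Tw C)" "T \<in> Obj (Tw C)" "a \<in> Hom (Tw C) S T n"
  shows "Mu (Tw C) [S, T] [n] [a] \<in> V (fst S) (fst T)"
    "Mu (Tw D) [On_obj (tw_extend K) S, On_obj (tw_extend K) T] [n] [On_hom K (fst S) (fst T) n a] =
      On_hom K (fst S) (fst T) (n + 1) (Mu (Tw C) [S, T] [n] [a])"
proof -
  have chain: "chain (Tw C) [S, T] [n] [a]"
    using assms by (simp del: Tw_simps)
  show "Mu (Tw C) [S, T] [n] [a] \<in> V (fst S) (fst T)"
    using tw_mu(1)[OF chain] by (simp del: Tw_simps)
  show "Mu (Tw D) [On_obj (tw_extend K) S, On_obj (tw_extend K) T] [n]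
      [On_hom K (fst S) (fst T) n a] =
      On_hom K (fst S) (fst T) (n + 1) (Mu (Tw C) [S, T] [n] [a])"
    using tw_mu(2)[OF chain] by (simp add: add.commute del: Tw_simps)
qed

lemma tw_cocycles:
  assumes ST: "S \<in> Obj (Tw C)" "T \<in> Obj (Tw C)"
  shows "cocycles (Tw D) (On_obj (tw_extend K) S) (On_obj (tw_extend K) T) n =
    On_hom K (fst S) (fst T) n ` cocycles (Tw C) S T n"
proof -
  have "Mu (Tw D) [On_obj (tw_extend K) S, On_obj (tw_extend K) T] [n]
      [On_hom K (fst S) (fst T) n a] = 0 \<longleftrightarrow>
      Mu (Tw C) [S, T] [n] [a] = 0" if "a \<in> Hom (Tw C) S T n" for a
    unfolding tw_mu1(2)[OF ST that] by (rule on_eq_0_iff[OF tw_mu1(1)[OF ST that]])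
  then show ?thesis
    unfolding cocycles_def tw_hom_image[OF ST, symmetric]
        by (auto simp del: Tw_simps tw_extend_simps)
qed

text \<open>Coboundaries of \<open>C\<close> are located in \<open>V\<close>, which is enough to
  recover them from their images.\<close>

lemma tw_coboundaries:
  assumes ST: "S \<in> Obj (Tw C)" "T \<in> Obj (Tw C)"
  shows "coboundaries (Tw D) (On_obj (tw_extend K) S) (On_obj (tw_extend K) T) n =
      On_hom K (fst S) (fst T) n ` coboundaries (Tw C) S T n"
    "coboundaries (Tw C) S T n \<subseteq> V (fst S) (fst T)"
proof -
  show "coboundaries (Tw D) (On_obj (tw_extend K) S) (On_obj (tw_extend K) T) n =
      On_hom K (fst S) (fst T) n ` coboundaries (Tw C) S T n"
    unfolding coboundaries_def Setcompr_eq_image tw_hom_image[OF ST, symmetric] image_image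
    using tw_mu1(2)[OF ST, of _ "n - 1"] by (intro image_cong refl) (simp del: Tw_simps)
  show "coboundaries (Tw C) S T n \<subseteq> V (fst S) (fst T)"
    unfolding coboundaries_def using tw_mu1(1)[OF ST] by (auto simp del: Tw_simps)
qed

lemma tw_coh_class:
  assumes ST: "S \<in> Obj (Tw C)" "T \<in> Obj (Tw C)"
  shows "coh_class (Tw D) (On_obj (tw_extend K) S) (On_obj (tw_extend K) T) n
      (On_hom K (fst S) (fst T) n a) =
    On_hom K (fst S) (fst T) n ` coh_class (Tw C) S T n a"
  unfolding coh_class_def Setcompr_eq_image tw_coboundaries(1)[OF ST] image_image additive ..

text \<open>\<open>On_hom K\<close> carries classes to classes by taking images. The two conditions
  on the coboundaries of the target are what reduces the union over representatives in
  \<open>coh_map\<close> to a single class.\<close>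

lemma tw_coh_map_bij:
  assumes ST: "S \<in> Obj (Tw C)" "T \<in> Obj (Tw C)"
    and zero: "0 \<in> coboundaries (Tw D) (On_obj (tw_extend K) S) (On_obj (tw_extend K) T) n"
    and add: "\<And>b b'. \<lbrakk>b \<in> coboundaries (Tw D) (On_obj (tw_extend K) S) (On_obj (tw_extend K) T) n;
        b' \<in> coboundaries (Tw D) (On_obj (tw_extend K) S) (On_obj (tw_extend K) T) n\<rbrakk> \<Longrightarrow>
      b + b' \<in> coboundaries (Tw D) (On_obj (tw_extend K) S) (On_obj (tw_extend K) T) n"
  shows "bij_betw (coh_map (Tw D) (tw_extend K) S T n) (cohomology (Tw C) S T n)
    (cohomology (Tw D) (On_obj (tw_extend K) S) (On_obj (tw_extend K) T) n)"
proof -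
  let ?h = "On_hom K (fst S) (fst T) n"
  let ?cls = "coh_class (Tw D) (On_obj (tw_extend K) S) (On_obj (tw_extend K) T) n"
  define B where "B = coboundaries (Tw D) (On_obj (tw_extend K) S) (On_obj (tw_extend K) T) n"
  have cls: "?cls a = {a + b | b. b \<in> B}" for a
    unfolding coh_class_def B_def ..
  have sub: "coh_class (Tw C) S T n a \<subseteq> V (fst S) (fst T)" if "a \<in> cocycles (Tw C) S T n" for a
  proof -
    have "a \<in> V (fst S) (fst T)"
      using that hom_V unfolding cocycles_def Tw_simps by blast
    then show ?thesis
      unfolding coh_class_def using V_add tw_coboundaries(2)[OF ST] by blast
  qed
  have self: "a \<in> ?cls a" for a
    using zero unfolding cls B_def[symmetric] by force
  have same: "?cls x \<subseteq> ?cls a" if "x \<in> ?cls a" for x a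
    using that add unfolding cls B_def[symmetric] by (auto simp only: add.assoc)
  have map_eq: "coh_map (Tw D) (tw_extend K) S T n (coh_class (Tw C) S T n a) = ?cls (?h a)" for a
  proof -
    have "coh_map (Tw D) (tw_extend K) S T n (coh_class (Tw C) S T n a) =
        (\<Union>x \<in> ?h ` coh_class (Tw C) S T n a. ?cls x)"
      unfolding coh_map_def tw_extend_simps by blast
    also have "\<dots> = (\<Union>x \<in> ?cls (?h a). ?cls x)"
      unfolding tw_coh_class[OF ST] ..
    also have "\<dots> = ?cls (?h a)"
      using self same by blast
    finally show ?thesis .
  qed
  show ?thesis
    unfolding bij_betw_def
  proof
    show "inj_on (coh_map (Tw D) (tw_extend K) S T n) (cohomology (Tw C) S T n)"
    proof (rule inj_onI)
      fix c c' assume "c \<in> cohomology (Tw C) S T n" "c' \<in> cohomology (Tw C) S T n"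
        and eq: "coh_map (Tw D) (tw_extend K) S T n c = coh_map (Tw D) (tw_extend K) S T n c'"
      then obtain a a' where a: "a \<in> cocycles (Tw C) S T n" "a' \<in> cocycles (Tw C) S T n"
        and c: "c = coh_class (Tw C) S T n a" "c' = coh_class (Tw C) S T n a'"
        unfolding cohomology_def by blast
      \<comment> \<open>Both classes lie in \<open>V\<close>, so equal images come from equal
        sets.\<close>
      have "?h ` c = ?h ` c'"
        using eq unfolding c map_eq tw_coh_class[OF ST] .
      then show "c = c'"
        using inj_on_image_eq_iff[OF inj_V sub[OF a(1)] sub[OF a(2)]] unfolding c by blast
    qed
    show "coh_map (Tw D) (tw_extend K) S T n ` cohomology (Tw C) S T n =
        cohomology (Tw D) (On_obj (tw_extend K) S) (On_obj (tw_extend K) T) n"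
      unfolding cohomology_def tw_cocycles[OF ST] image_image map_eq ..
  qed
qed

lemma tw_surj_obj:
  assumes "T \<in> Obj (Tw D)"
  shows "\<exists>S \<in> Obj (Tw C). On_obj (tw_extend K) S = T"
proof -
  have T: "fst T \<in> Obj (shift_cat D)" "snd T \<in> Hom (shift_cat D) (fst T) (fst T) 1"
    "strictly_lower_triangular (length (fst T)) (snd T)" "maurer_cartan D (fst T) (snd T) = 0"
    using assms by (simp_all del: shift_cat_simps)
  obtain X \<delta> where X: "X \<in> Obj (shift_cat C)" "\<delta> \<in> Hom (shift_cat C) X X 1"
    "On_obj K X = fst T" "On_hom K X X 1 \<delta> = snd T" "strictly_lower_triangular (length X) \<delta>"
    using lift[OF T(1-3)] by blast
  have "maurer_cartan C X \<delta> = 0"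
    using maurer_cartan_eq_0[OF X(1,2)] T(4) unfolding X(3,4) by blast
  then have "(X, \<delta>) \<in> Obj (Tw C)"
    using X by (simp del: shift_cat_simps)
  moreover have "On_obj (tw_extend K) (X, \<delta>) = T"
    by (rule prod_eqI) (simp_all only: tw_extend_simps fst_conv snd_conv X)
  ultimately show ?thesis by blast
qed

end

section \<open>Nilpotency of triangular matrices, additivity of the differential, and units\<close>

lemma triangular_run:
  assumes "strictly_lower_triangular n \<delta>"
  obtains N where "\<And>x. x 0 < n \<Longrightarrow> \<exists>k<N. \<delta> (x (Suc k)) (x k) = 0"
proof -
  obtain F N where F: "F 0 = {..<n}" "F N = {}"
    "\<forall>m. \<forall>i \<in> F m. \<forall>j. \<delta> j i \<noteq> 0 \<longrightarrow> j \<in> F m"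
    "\<forall>m. \<forall>i \<in> F m - F (Suc m). \<forall>j \<in> F m - F (Suc m). \<delta> j i = 0"
    using assms unfolding strictly_lower_triangular_def by blast
  have "\<exists>k<N. \<delta> (x (Suc k)) (x k) = 0" if "x 0 < n" for x
  proof (rule ccontr)
    assume "\<not> ?thesis"
    then have nz: "\<delta> (x (Suc k)) (x k) \<noteq> 0" if "k < N" for k
      using that by blast
    \<comment> \<open>Each nonzero entry leads at least one step down the filtration, so a run of
      \<open>N\<close> nonzero entries would end in the empty set \<open>F N\<close>.\<close>
    have "x k \<in> F k" if "k \<le> N" for k
      using that
    proof (induction k)
      case 0
      then show ?case using \<open>x 0 < n\<close> F(1) by simp
    next
      case (Suc k)
      then have "x k \<in> F k" "\<delta> (x (Suc k)) (x k) \<noteq> 0"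
        using nz by auto
      \<comment> \<open>If \<open>x k\<close> already lies in \<open>F (Suc k)\<close>, stability of
        this step keeps the successor there; otherwise vanishing on the graded piece forces the
        successor into it.\<close>
      then show ?case
        using F(3,4) by (cases "x k \<in> F (Suc k)") blast+
    qed
    from this[of N] F(2) show False by simp
  qed
  then show thesis by (rule that)
qed

text \<open>The same filtration works, since only the vanishing of entries enters its
  conditions.\<close>

lemma strictly_lower_triangular_mono:
  assumes "strictly_lower_triangular n \<epsilon>" "\<And>j i. \<epsilon> j i = 0 \<Longrightarrow> \<delta> j i = 0"
  shows "strictly_lower_triangular n \<delta>"
proof -
  obtain F N where "F 0 = {..<n}" "F N = {}" "\<forall>m. F (Suc m) \<subseteq> F m"
    "\<forall>m. \<forall>i \<in> F m. \<forall>j. \<epsilon> j i \<noteq> 0 \<longrightarrow> j \<in> F m"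
    "\<forall>m. \<forall>i \<in> F m - F (Suc m). \<forall>j \<in> F m - F (Suc m). \<epsilon> j i = 0"
    using assms(1) unfolding strictly_lower_triangular_def by blast
  then show ?thesis
    unfolding strictly_lower_triangular_def using assms(2)
    by (intro exI[of _ F] exI[of _ N] conjI) blast+
qed

context multilinear_category
begin

text \<open>Every path meets a zero entry within the run of \<open>N\<close> copies of
  \<open>\<delta>\<close>, so all terms vanish.\<close>

lemma mu_run_zero:
  assumes comp: "composable (shift_cat C) Xs ns fs"
    and N: "\<And>x. x 0 < length (Xs ! p) \<Longrightarrow> \<exists>k<N. \<delta> (x (Suc k)) (x k) = 0"
    and run: "p + N \<le> length fs" "\<And>k. k < N \<Longrightarrow> fs ! (p + k) = \<delta>"
  shows "Mu (shift_cat C) Xs ns fs = 0"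
proof -
  have "shift_mu_term C Xs ns fs is = 0" if path: "is \<in> matrix_paths Xs i j" for "is" i j
  proof -
    have "is ! p < length (Xs ! p)"
      using path comp run(1) by (auto simp: matrix_paths_def composable_def)
    then obtain k where k: "k < N" "\<delta> (is ! (p + Suc k)) (is ! (p + k)) = 0"
      using N[of "\<lambda>k. is ! (p + k)"] by auto
    then show ?thesis
      using mu_zero[OF path_composable[OF comp path], of "p + k"] run
      by (simp add: shift_mu_term_eq del: upt_Suc)
  qed
  then show ?thesis
    by (simp add: fun_eq_iff)
qed

lemma tw_mu1_term:
  "tw_mu_term C [S, T] [n] [a] [i, j] =
    Mu (shift_cat C) (replicate i (fst S) @ fst S # replicate j (fst T) @ [fst T])
      (replicate i 1 @ n # replicate j 1) (replicate i (snd S) @ a # replicate j (snd T))"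
  by (simp add: tw_mu_term_word del: shift_cat_simps)

lemma tw_mu1_composable:
  assumes "S \<in> Obj (Tw C)" "T \<in> Obj (Tw C)" "a \<in> Hom (Tw C) S T n"
  shows "composable (shift_cat C) (replicate i (fst S) @ fst S # replicate j (fst T) @ [fst T])
      (replicate i 1 @ n # replicate j 1) (replicate i (snd S) @ a # replicate j (snd T))"
proof -
  have "chain (Tw C) [S, T] [n] [a]"
    using assms by (simp del: Tw_simps)
  from tw_mu_term_composable[OF this, of "[i, j]"] show ?thesis
    by (simp del: shift_cat_simps Tw_simps)
qed

text \<open>The bounds on the numbers of inserted copies come from the two twisting morphisms alone.
  Hence \<open>A\<close> is uniform in \<open>a\<close> and \<open>n\<close> and serves for several
  morphisms at once.\<close>

lemma tw_mu1_finite: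
  assumes ST: "S \<in> Obj (Tw C)" "T \<in> Obj (Tw C)"
  obtains A where "finite A"
    "\<And>a n. a \<in> Hom (Tw C) S T n \<Longrightarrow>
      {is. (if length is = length [S, T] then tw_mu_term C [S, T] [n] [a] is else 0) \<noteq> 0} \<subseteq> A"
proof -
  have "strictly_lower_triangular (length (fst S)) (snd S)" "strictly_lower_triangular
      (length (fst T)) (snd T)"
    using ST by simp_all
  note tri = this
  obtain N where N: "\<And>x. x 0 < length (fst S) \<Longrightarrow> \<exists>k<N. snd S (x (Suc k)) (x k) = 0"
    by (rule triangular_run[OF tri(1)]) blast
  obtain M where M: "\<And>x. x 0 < length (fst T) \<Longrightarrow> \<exists>k<M. snd T (x (Suc k)) (x k) = 0"
    by (rule triangular_run[OF tri(2)]) blast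
  let ?A = "(\<lambda>(i, j). [i, j]) ` ({..<N} \<times> {..<M})"
  have sub: "{is. (if length is = length [S, T] then tw_mu_term C [S, T] [n] [a] is else 0) \<noteq> 0}
      \<subseteq> ?A"
    if a: "a \<in> Hom (Tw C) S T n" for a n
  proof
    fix "is" assume nz: "is \<in> {is. (if length is =
        length [S, T] then tw_mu_term C [S, T] [n] [a] is else 0) \<noteq> 0}"
    then have "length is = 2"
      by (auto split: if_splits)
    then obtain i j where ij: "is = [i, j]"
      by (auto simp: length_Suc_conv numeral_2_eq_2)
    let ?Xs = "replicate i (fst S) @ fst S # replicate j (fst T) @ [fst T]"
    let ?fs = "replicate i (snd S) @ a # replicate j (snd T)"
    have ne: "Mu (shift_cat C) ?Xs (replicate i 1 @ n # replicate j 1) ?fs \<noteq> 0"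
    proof -
      have "tw_mu_term C [S, T] [n] [a] [i, j] \<noteq> 0"
        using nz unfolding ij by (simp split: if_splits)
      then show ?thesis
        unfolding tw_mu1_term .
    qed
    note comp = tw_mu1_composable[OF ST a, of i j]
    have "i < N"
    proof (rule ccontr)
      assume "\<not> i < N"
      have "?Xs ! 0 = fst S"
        by (cases i) auto
      then have "Mu (shift_cat C) ?Xs (replicate i 1 @ n # replicate j 1) ?fs = 0"
        using N \<open>\<not> i < N\<close> by (intro mu_run_zero[OF comp, of 0 N "snd S"]) (simp_all add: nth_append)
      then show False
        using ne by blast
    qed
    moreover have "j < M"
    proof (rule ccontr)
      assume "\<not> j < M"
      \<comment> \<open>The copies of \<open>snd T\<close> start at \<open>Suc i\<close>, after
        \<open>i\<close> copies of \<open>snd S\<close> and the morphism \<open>a\<close>.\<close>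
      have "?Xs ! Suc i = fst T"
        by (cases j) (auto simp: nth_append)
      then have "Mu (shift_cat C) ?Xs (replicate i 1 @ n # replicate j 1) ?fs = 0"
        using M \<open>\<not> j < M\<close> by (intro mu_run_zero[OF comp, of "Suc i" M "snd T"]) (simp_all add:
            nth_append)
      then show False
        using ne by blast
    qed
    ultimately show "is \<in> ?A"
      by (auto simp: ij)
  qed
  show thesis
    by (rule that[of ?A]) (simp, rule sub)
qed

text \<open>Termwise additivity suffices only because the supports are finite:
  \<open>Sum_any\<close> is 0 by convention on an infinite support and need not be additive
  there.\<close>

lemma tw_mu1_add:
  assumes ST: "S \<in> Obj (Tw C)" "T \<in> Obj (Tw C)"
    and ab: "a \<in> Hom (Tw C) S T n" "b \<in> Hom (Tw C) S T n"
  shows "Mu (Tw C) [S, T] [n] [a + b] = Mu (Tw C) [S, T] [n] [a] + Mu (Tw C) [S, T] [n] [b]"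
proof -
  interpret Z: multilinear_category "shift_cat C" by (rule multilinear_shift_cat)
  let ?g = "\<lambda>a is. if length is = length [S, T] then tw_mu_term C [S, T] [n] [a] is else 0"
  obtain A where A: "finite A" "\<And>a. a \<in> Hom (Tw C) S T n \<Longrightarrow> {is. ?g a is \<noteq> 0} \<subseteq> A"
    by (rule tw_mu1_finite[OF ST]) blast
  have term_add: "?g (a + b) is = ?g a is + ?g b is" for "is"
  proof (cases "length is = length [S, T]")
    case True
    then obtain i j where ij: "is = [i, j]"
      by (auto simp: length_Suc_conv)
    have "b \<in> Hom (shift_cat C) (fst S) (fst T) n"
      using ab(2) unfolding Tw_simps .
    moreover have "(replicate i (fst S) @ fst S # replicate j (fst T) @ [fst T]) ! Suc i = fst T"
      by (cases j) (auto simp: nth_append)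
    ultimately show ?thesis
      using Z.mu_add[OF tw_mu1_composable[OF ST ab(1), of i j], of i b]
      unfolding ij tw_mu1_term
      by (simp add: list_update_append nth_append del: shift_cat_simps)
  next
    case False
    then show ?thesis by (simp only: if_False add_0_right)
  qed
  have "Sum_any (\<lambda>is. ?g a is + ?g b is) = Sum_any (?g a) + Sum_any (?g b)"
    by (rule Sum_any.distrib; rule finite_subset[OF A(2) A(1)]) (fact ab)+
  then show ?thesis
    unfolding Tw_simps term_add[symmetric] .
qed

lemma tw_coboundaries_subgroup:
  assumes ST: "S \<in> Obj (Tw C)" "T \<in> Obj (Tw C)"
  shows "0 \<in> coboundaries (Tw C) S T n"
    "\<lbrakk>b \<in> coboundaries (Tw C) S T n; b' \<in> coboundaries (Tw C) S T n\<rbrakk> \<Longrightarrow>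
      b + b' \<in> coboundaries (Tw C) S T n"
proof -
  interpret Z: multilinear_category "shift_cat C" by (rule multilinear_shift_cat)
  have obj: "fst S \<in> Obj (shift_cat C)" "fst T \<in> Obj (shift_cat C)"
    using ST by (simp_all del: shift_cat_simps)
  have zero: "0 \<in> Hom (Tw C) S T (n - 1)"
    unfolding Tw_simps by (rule Z.hom_zero[OF obj])
  \<comment> \<open>An additive map sends 0 to an element equal to its own double.\<close>
  have "Mu (Tw C) [S, T] [n - 1] [0] + Mu (Tw C) [S, T] [n - 1] [0] =
      Mu (Tw C) [S, T] [n - 1] [0] + 0"
    using tw_mu1_add[OF ST zero zero] unfolding add_0_right ..
  then have "Mu (Tw C) [S, T] [n - 1] [0] = 0"
    by (rule add_left_imp_eq)
  then show "0 \<in> coboundaries (Tw C) S T n"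
    using zero unfolding coboundaries_def by force
  have sum: "a + b \<in> Hom (Tw C) S T (n - 1)" if "a \<in> Hom (Tw C) S T (n - 1)" "b
      \<in> Hom (Tw C) S T (n - 1)" for a b
    using Z.hom_add[OF obj] that unfolding Tw_simps .
  show "b + b' \<in> coboundaries (Tw C) S T n"
    if cob: "b \<in> coboundaries (Tw C) S T n" "b' \<in> coboundaries (Tw C) S T n"
  proof -
    obtain a a' where a: "a \<in> Hom (Tw C) S T (n - 1)" "a' \<in> Hom (Tw C) S T (n - 1)"
      and b: "b = Mu (Tw C) [S, T] [n - 1] [a]" "b' = Mu (Tw C) [S, T] [n - 1] [a']"
      using cob unfolding coboundaries_def by blast
    show ?thesis
      unfolding coboundaries_def b tw_mu1_add[OF ST a, symmetric] using sum[OF a] by blast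
  qed
qed

text \<open>In the differential of the strict unit \<open>e\<close> only the two terms with one
  inserted \<open>\<delta>\<close> survive. The unit laws give \<open>\<delta>\<close> and
  \<open>- \<delta>\<close>, the opposite signs being due to the odd degree of
  \<open>\<delta>\<close>. In the product of \<open>e\<close> with itself every insertion vanishes,
  since a unit kills all operations of at least three arguments.\<close>

lemma tw_unit_coh_isomorphic:
  assumes T: "T \<in> Obj (Tw C)"
  shows "coh_isomorphic (Tw C) T T"
proof -
  interpret Z: multilinear_category "shift_cat C" by (rule multilinear_shift_cat)
  obtain X \<delta> where T_eq: "T = (X, \<delta>)" by (cases T)
  have X: "X \<in> Obj (shift_cat C)" and \<delta>: "\<delta> \<in> Hom (shift_cat C) X X 1"
    using T by (simp_all add: T_eq del: shift_cat_simps)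
  define e where "e = Unit (shift_cat C) X"
  have e: "e \<in> Hom (Tw C) T T 0"
    unfolding Tw_simps e_def T_eq fst_conv by (rule Z.unit_hom[OF X])
  let ?g1 = "\<lambda>is. if length is = length [T, T] then tw_mu_term C [T, T] [0] [e] is else 0"
  have g1: "?g1 is = 0" if "is \<noteq> [0, 1]" "is \<noteq> [1, 0]" for "is"
  proof (cases "length is = length [T, T]")
    case True
    then obtain i j where ij: "is = [i, j]"
      by (auto simp: length_Suc_conv)
    let ?Xs = "replicate i (fst T) @ fst T # replicate j (fst T) @ [fst T]"
    let ?fs = "replicate i (snd T) @ e # replicate j (snd T)"
    have nth: "?Xs ! i = X" "?Xs ! (i + 1) = X"
      by (cases j; simp add: nth_append T_eq)+
    have "Mu (shift_cat C) ?Xs (replicate i 1 @ 0 # replicate j 1) ?fs = 0"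
    proof (cases "i + j = 0")
      case True
      then show ?thesis
        using Z.mu1_unit[OF X] by (simp add: T_eq e_def del: shift_cat_simps)
    next
      case False
      \<comment> \<open>The cases with at most one inserted \<open>\<delta>\<close> are excluded, so
        at least two copies accompany \<open>e\<close>.\<close>
      then have "3 \<le> length ?fs"
        using that ij by (cases i; cases j) auto
      then show ?thesis
        by (rule Z.mu_unit_higher[OF tw_mu1_composable[OF T T e, of i j], of i])
          (simp_all add: nth nth_append e_def T_eq del: shift_cat_simps)
    qed
    then show ?thesis
      unfolding ij tw_mu1_term by simp
  qed simp
  have "Mu (Tw C) [T, T] [0] [e] = (\<Sum>is \<in> {[0, 1], [1, 0]}. ?g1 is)"
    unfolding Tw_simps by (rule Sum_any.expand_superset) (use g1 in blast)+
  also have "\<dots> = tw_mu_term C [T, T] [0] [e] [0, 1] + tw_mu_term C [T, T] [0] [e] [1, 0]"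
    by simp
  also have "tw_mu_term C [T, T] [0] [e] [0, 1] = \<delta>"
    using Z.mu2_unit_right[OF X X \<delta>] by (simp add: tw_mu1_term T_eq e_def del: shift_cat_simps)
  also have "tw_mu_term C [T, T] [0] [e] [1, 0] = - \<delta>"
  proof -
    have "Scl (shift_cat C) (minus_one_pow 1) (tw_mu_term C [T, T] [0] [e] [1, 0]) = \<delta>"
      using Z.mu2_unit_left[OF X X \<delta>] by (simp add: tw_mu1_term T_eq e_def del: shift_cat_simps)
    moreover have "minus_one_pow 1 = (- 1 :: 'k)"
      by (simp add: minus_one_pow_parity)
    ultimately have "- tw_mu_term C [T, T] [0] [e] [1, 0] = \<delta>"
      by (simp only: Z.scale_minus_left Z.scale_one)
    then show ?thesis
      by (metis minus_minus)
  qed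
  finally have "Mu (Tw C) [T, T] [0] [e] = 0"
    by (simp only: add.right_inverse)
  then have cocycle: "e \<in> cocycles (Tw C) T T 0"
    using e unfolding cocycles_def by blast
  have "chain (Tw C) [T, T, T] [0, 0] [e, e]"
    using T e by (simp del: Tw_simps)
  note comp = tw_mu_term_composable[OF this _ list.distinct(2)]
  let ?g2 = "\<lambda>is. if length is = length [T, T, T] then tw_mu_term C [T, T, T] [0, 0]
      [e, e] is else 0"
  have g2: "?g2 is = 0" if "is \<noteq> [0, 0, 0]" for "is"
  proof (cases "length is = length [T, T, T]")
    case True
    then obtain i j k where ijk: "is = [i, j, k]"
      by (auto simp: length_Suc_conv)
    let ?Xs = "tw_objs [T, T, T] is" and ?fs = "tw_mors [T, T, T] is [e, e]"
    have nth: "?Xs ! i = X" "?Xs ! (i + 1) = X"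
      unfolding ijk by (cases j; simp add: nth_append T_eq)+
    have "3 \<le> length ?fs"
      using that unfolding ijk by (cases i; cases j; cases k) auto
    then have "tw_mu_term C [T, T, T] [0, 0] [e, e] is = 0"
      unfolding tw_mu_term_word
      by (rule Z.mu_unit_higher[OF comp[OF True], of i])
        (simp_all only: nth, simp_all add: ijk nth_append e_def del: shift_cat_simps)
    then show ?thesis by simp
  qed simp
  have "Mu (Tw C) [T, T, T] [0, 0] [e, e] = (\<Sum>is \<in> {[0, 0, 0]}. ?g2 is)"
    unfolding Tw_simps by (rule Sum_any.expand_superset) (use g2 in blast)+
  also have "\<dots> = tw_mu_term C [T, T, T] [0, 0] [e, e] [0, 0, 0]"
    by simp
  also have "\<dots> = e"
    using Z.mu2_unit_right[OF X X Z.unit_hom[OF X]]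
    by (simp add: tw_mu_term_word T_eq e_def del: shift_cat_simps)
  finally have "Mu (Tw C) [T, T, T] [0, 0] [e, e] = Unit (Tw C) T"
    unfolding Tw_simps T_eq fst_conv e_def .
  then show ?thesis
    unfolding coh_isomorphic_def by (intro bexI[of _ e] conjI cocycle) (simp_all only:)
qed

end

text \<open>Multilinearity of \<open>D\<close> provides the subgroup of coboundaries for full
  faithfulness and the unit isomorphism between an object and the image of its lift.\<close>

lemma (in formal_sum_functor) tw_quasi_equivalence:
  assumes "multilinear_category D"
  shows "quasi_equivalence (Tw C) (Tw D) (tw_extend K)"
proof -
  interpret D: multilinear_category D by fact
  interpret T: ainf_functor "Tw C" "Tw D" "tw_extend K" by (rule tw_functor)
  show ?thesis
    unfolding quasi_equivalence_def
  proof (intro conjI ballI allI)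
    show "bij_betw (coh_map (Tw D) (tw_extend K) S T n) (cohomology (Tw C) S T n)
        (cohomology (Tw D) (On_obj (tw_extend K) S) (On_obj (tw_extend K) T) n)"
      if "S \<in> Obj (Tw C)" "T \<in> Obj (Tw C)" for S T n
      using that by (intro tw_coh_map_bij D.tw_coboundaries_subgroup T.on_obj)
    show "\<exists>S \<in> Obj (Tw C). coh_isomorphic (Tw D) (On_obj (tw_extend K) S) T"
      if "T \<in> Obj (Tw D)" for T
    proof -
      obtain S where "S \<in> Obj (Tw C)" "On_obj (tw_extend K) S = T"
        using tw_surj_obj[OF \<open>T \<in> Obj (Tw D)\<close>] by blast
      then show ?thesis
        using D.tw_unit_coh_isomorphic[OF \<open>T \<in> Obj (Tw D)\<close>] by blast
    qed
  qed (rule tw_functor)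
qed

section \<open>The induced quasi-equivalence\<close>

lemma shift_cat_hom_entry:
  "\<lbrakk>f \<in> Hom (shift_cat C) X Y n; i < length X; j < length Y\<rbrakk> \<Longrightarrow>
    f j i \<in> Hom C (summand X i) (summand Y j) (n - (shift X i - shift Y j))"
  by (simp add: shift_cat_hom)

text \<open>A preimage is chosen entry by entry; outside the index range the entries of
  \<open>g\<close> and of any image are 0.\<close>

lemma shift_map_full:
  assumes full: "\<And>X Y n g. \<lbrakk>X \<in> Obj C; Y \<in> Obj C; g \<in> Hom D (On_obj F X) (On_obj F Y) n\<rbrakk> \<Longrightarrow>
      g \<in> On_hom F X Y n ` Hom C X Y n"
    and X: "X \<in> Obj (shift_cat C)" and Y: "Y \<in> Obj (shift_cat C)"
    and g: "g \<in> Hom (shift_cat D) (On_obj (shift_map F) X) (On_obj (shift_map F) Y) n"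
  shows "g \<in> On_hom (shift_map F) X Y n ` Hom (shift_cat C) X Y n"
proof -
  let ?H = "\<lambda>j i. Hom C (summand X i) (summand Y j) (n - (shift X i - shift Y j))"
  let ?h = "\<lambda>j i. On_hom F (summand X i) (summand Y j) (n - (shift X i - shift Y j))"
  have mem: "g j i \<in> ?h j i ` ?H j i" if "i < length X" "j < length Y" for j i
  proof (rule full)
    show "g j i \<in> Hom D (On_obj F (summand X i)) (On_obj F (summand Y j))
        (n - (shift X i - shift Y j))"
      using shift_cat_hom_entry[OF g, of i j] that by simp
  qed (use X Y that shift_cat_obj_summand in blast)+
  let ?f = "\<lambda>j i. if i < length X \<and> j < length Y then inv_into (?H j i) (?h j i) (g j i) else 0"
  have "?f \<in> Hom (shift_cat C) X Y n"
    using inv_into_into[OF mem] by (simp add: shift_cat_hom)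
  moreover have "g j i = On_hom (shift_map F) X Y n ?f j i" for j i
    using f_inv_into_f[OF mem] g by (auto simp: shift_cat_hom)
  ultimately show ?thesis
    by (intro image_eqI[of _ _ ?f] ext)
qed

lemma block_index_singletons: "c < length xs \<Longrightarrow> block_index (map (\<lambda>x. [x]) xs) c = (c, 0)"
  by (induction xs arbitrary: c) (auto split: prod.splits)

lemma singleton_blocks:
  assumes "X = map (\<lambda>x. ([x], 0)) Z"
  shows "On_obj (flatten D) X = Z"
    "c < length Z \<Longrightarrow> blk X c = c \<and> pos X c = 0"
  using block_index_singletons[of c Z]
  by (simp_all add: assms flatten_def split_def comp_def blk_def pos_def)

context multilinear_category
begin

lemma flatten_full:
  assumes X: "X \<in> Obj (shift_cat (shift_cat C))" and Y: "Y \<in> Obj (shift_cat (shift_cat C))"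
    and g: "g \<in> Hom (shift_cat C) (On_obj (flatten C) X) (On_obj (flatten C) Y) n"
  shows "g \<in> On_hom (flatten C) X Y n ` Hom (shift_cat (shift_cat C)) X Y n"
proof -
  let ?\<epsilon> = "\<lambda>j i v u. minus_one_pow (shift X i * (shift (summand X i) u - shift (summand Y j) v))
      :: 'k"
  \<comment> \<open>The sign is its own inverse, so the factor used by \<open>flatten\<close> also
    undoes it; \<open>flat_index\<close> finds the flattened entry.\<close>
  define f where "f j i v u =
      (if (i < length X \<and> j < length Y) \<and> u < length (summand X i) \<and> v < length (summand Y j)
       then Scl C (?\<epsilon> j i v u) (g (flat_index Y j v) (flat_index X i u)) else 0)" for j i v u
  have obj: "summand (summand Z i) u \<in> Obj C" if "Z \<in> Obj (shift_cat (shift_cat C))" "i < length Z"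
    "u < length (summand Z i)" for Z i u
    using shift_cat_obj_summand[OF shift_cat_obj_summand[OF that(1,2)] that(3)] .
  have "f j i v u \<in> Hom C (summand (summand X i) u) (summand (summand Y j) v)
      (n - (shift X i - shift Y j) - (shift (summand X i) u - shift (summand Y j) v))"
    if iu: "i < length X" "u < length (summand X i)" and jv:
        "j < length Y" "v < length (summand Y j)" for i j u v
  proof -
    note a = flat_index[OF iu] and b = flat_index[OF jv]
    have "g (flat_index Y j v) (flat_index X i u)
        \<in> Hom C (summand (summand X i) u) (summand (summand Y j) v)
        (n - (shift X i - shift Y j) - (shift (summand X i) u - shift (summand Y j) v))"
      using shift_cat_hom_entry[OF g, of "flat_index X i u" "flat_index Y j v"] a b
      by (simp add: flatten_obj_nth algebra_simps)
    then show ?thesis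
      using hom_scale[OF obj[OF X iu] obj[OF Y jv]] iu jv by (simp add: f_def)
  qed
  then have "f j i \<in> Hom (shift_cat C) (summand X i) (summand Y j) (n - (shift X i - shift Y j))"
    if "i < length X" "j < length Y" for i j
    using that by (auto simp: shift_cat_hom f_def)
  moreover have "f j i = 0" if "\<not> (i < length X \<and> j < length Y)" for i j
    using that by (auto simp: f_def fun_eq_iff)
  ultimately have "f \<in> Hom (shift_cat (shift_cat C)) X Y n"
    by (simp add: shift_cat_hom[of f])
  moreover have "g r c = On_hom (flatten C) X Y n f r c" for r c
  proof (cases "c < length (concat (map fst X)) \<and> r < length (concat (map fst Y))")
    case True
    then show ?thesis
      using blk_pos_range[of c X] blk_pos_range[of r Y] flat_index_blk_pos[of c X]
          flat_index_blk_pos[of r Y]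
      by (simp add: f_def)
  next
    case False
    then show ?thesis
      using g by (auto simp: shift_cat_hom)
  qed
  ultimately show ?thesis
    by (intro image_eqI[of _ _ f] ext)
qed

text \<open>Composing before passing to twisted complexes leaves one functor of formal sums to
  study; by \<open>tw_induced_eq\<close> its extension is the induced functor.\<close>

definition skew_flatten ::
  "('o formal_sum formal_sum, (int \<Rightarrow> 'm matrix) matrix, 'o formal_sum, (int \<Rightarrow> 'm) matrix)
      strict_fun"
  where "skew_flatten = comp_fun (flatten (laurent_cat C)) (shift_map (skew_to_laurent C))"

lemma shift_map_skew_obj [simp]: "On_obj (shift_map (skew_to_laurent C)) X = X"
  by (simp add: shift_map_def skew_to_laurent_def)

lemma skew_flatten_obj: "On_obj skew_flatten X = On_obj (flatten (laurent_cat C)) X"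
  by (simp add: skew_flatten_def comp_fun_def)

lemma skew_flatten_hom:
  "On_hom skew_flatten X Y n f r c l =
    (if c < length (concat (map fst X)) \<and> r < length (concat (map fst Y))
     then Scl C (minus_one_pow (shift X (blk X c) *
         (shift (summand X (blk X c)) (pos X c) - shift (summand Y (blk Y r)) (pos Y r)) +
             choose2 l))
       (f (blk Y r) (blk X c) l (pos Y r) (pos X c))
     else 0)"
  using blk_pos_range[of c X] blk_pos_range[of r Y]
  by (simp add: skew_flatten_def comp_fun_def minus_one_pow_add) (simp add: skew_to_laurent_def)

text \<open>The instance of \<open>V\<close> for \<open>skew_flatten\<close>. It restricts the four
  matrix indices only; degrees and the support in \<open>l\<close> are left free, so that all values
  of the operations belong to it.\<close>

definition skew_supported ::
  "'o formal_sum formal_sum \<Rightarrow> 'o formal_sum formal_sum \<Rightarrow> (int \<Rightarrow> 'm matrix) matrix set" where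
  "skew_supported X Y = {f. \<forall>j i l v u. \<not> ((i < length X \<and> j < length Y) \<and>
      u < length (summand X i) \<and> v < length (summand Y j)) \<longrightarrow> f j i l v u = 0}"

lemma skew_flatten_functor:
  "ainf_functor (shift_cat (skew_shift C)) (shift_cat (laurent_cat C)) skew_flatten"
proof -
  interpret L: multilinear_category "laurent_cat C" by (rule multilinear_laurent_cat)
  interpret Z: multilinear_category "shift_cat (laurent_cat C)" by (rule L.multilinear_shift_cat)
  have "ainf_functor (shift_cat (skew_shift C)) (shift_cat (shift_cat (laurent_cat C)))
      (shift_map (skew_to_laurent C))"
    by (rule shift_map_functor[OF skew_to_laurent_functor Z.scalars])
      (auto simp: skew_to_laurent_def scale_right_distrib fun_eq_iff mult.commute)
  then show ?thesis
    unfolding skew_flatten_def using L.flatten_functor by (rule comp_functor)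
qed

lemma skew_to_laurent_full:
  assumes "X \<in> Obj (skew_shift C)" "Y \<in> Obj (skew_shift C)"
    "g \<in> Hom (shift_cat (laurent_cat C)) (On_obj (skew_to_laurent C) X)
        (On_obj (skew_to_laurent C) Y) n"
  shows "g \<in> On_hom (skew_to_laurent C) X Y n ` Hom (skew_shift C) X Y n"
proof (rule image_eqI)
  show "g = On_hom (skew_to_laurent C) X Y n (On_hom (laurent_to_skew C) X Y n g)"
    by (rule laurent_to_skew_inverse[symmetric])
  show "On_hom (laurent_to_skew C) X Y n g \<in> Hom (skew_shift C) X Y n"
    using assms by (intro laurent_to_skew_hom) (simp_all add: skew_to_laurent_def)
qed

text \<open>The action preserves the number of summands, so no path has end points outside the index
  ranges of the original objects.\<close>

lemma skew_mu_support:
  assumes len: "length Xs = Suc (length fs)" and out: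
      "\<not> (u < length (hd Xs) \<and> v < length (last Xs))"
  shows "Mu (skew_shift C) Xs ns fs l v u = 0"
proof -
  have "matrix_paths (map (\<lambda>k. On_obj (shift_action C (sum_list (drop k ls))) (Xs ! k))
      [0..<length fs + 1]) u v = {}"
    (is "matrix_paths ?Ys u v = {}") for ls
  proof -
    have "?Ys \<noteq> []" "Xs \<noteq> []" using len by auto
    then have "length (hd ?Ys) = length (hd Xs)" "length (last ?Ys) = length (last Xs)"
      using len by (simp_all add: hd_map hd_conv_nth last_conv_nth hd_upt del: upt_Suc)
    then show ?thesis
      using out matrix_paths_range[of _ ?Ys u v] \<open>?Ys \<noteq> []\<close> by auto
  qed
  then show ?thesis
    by (simp add: skew_mu sum_apply)
qed

text \<open>The paths of the outer sums bound the outer indices; for the inner ones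
  \<open>skew_mu_support\<close> is applied to the blocks at the ends of the path.\<close>

lemma skew_mu_supported:
  assumes comp: "composable (shift_cat (skew_shift C)) Xs ns fs"
  shows "Mu (shift_cat (skew_shift C)) Xs ns fs \<in> skew_supported (hd Xs) (last Xs)"
  unfolding skew_supported_def
proof (intro CollectI allI impI)
  fix j i l v u
  assume out: "\<not> ((i < length (hd Xs) \<and> j < length (last Xs)) \<and>
      u < length (summand (hd Xs) i) \<and> v < length (summand (last Xs) j))"
  have len: "length Xs = Suc (length fs)" using comp by (simp add: composable_def)
  have "shift_mu_term (skew_shift C) Xs ns fs is l v u = 0" if path: "is \<in> matrix_paths Xs i j"
      for "is"
  proof -
    note ends = path_ends[OF path len]
    let ?Zs = "map (\<lambda>k. summand (Xs ! k) (is ! k)) [0..<Suc (length fs)]"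
    have "hd ?Zs = summand (hd Xs) i" "last ?Zs = summand (last Xs) j"
      using ends by (auto simp: hd_map last_map hd_upt simp del: upt_Suc)
    moreover have "i < length (hd Xs) \<and> j < length (last Xs)"
      using matrix_paths_range[OF path] len by (auto simp flip: length_greater_0_conv)
    ultimately have "\<not> (u < length (hd ?Zs) \<and> v < length (last ?Zs))"
      using out by auto
    then show ?thesis
      unfolding shift_mu_term_eq by (simp add: skew_mu_support del: upt_Suc)
  qed
  then show "Mu (shift_cat (skew_shift C)) Xs ns fs j i l v u = 0"
    by (simp add: sum_apply)
qed

text \<open>The filtration of the blocks is pulled back along \<open>blk\<close>; a nonzero entry
  after flattening comes from a nonzero matrix entry between the blocks.\<close>

lemma skew_flatten_triangular:
  assumes "strictly_lower_triangular (length X) \<delta>"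
  shows "strictly_lower_triangular (length (On_obj skew_flatten X)) (On_hom skew_flatten X X n \<delta>)"
proof -
  obtain F N where F: "F 0 = {..<length X}" "F N = {}" "\<forall>m. F (Suc m) \<subseteq> F m"
    "\<forall>m. \<forall>i \<in> F m. \<forall>j. \<delta> j i \<noteq> 0 \<longrightarrow> j \<in> F m"
    "\<forall>m. \<forall>i \<in> F m - F (Suc m). \<forall>j \<in> F m - F (Suc m). \<delta> j i = 0"
    using assms unfolding strictly_lower_triangular_def by blast
  let ?L = "length (concat (map fst X))"
  let ?G = "\<lambda>m. {r. r < ?L \<and> blk X r \<in> F m}"
  have nz: "c < ?L \<and> r < ?L \<and> \<delta> (blk X r) (blk X c) \<noteq> 0" if "On_hom skew_flatten X X n \<delta> r c \<noteq> 0"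
      for r c
    using that by (auto simp: skew_flatten_hom fun_eq_iff split: if_splits)
  have G0: "?G 0 = {..<?L}"
    using blk_pos_range(1) F(1) by auto
  have GN: "?G N = {}"
    using F(2) by auto
  have dec: "\<forall>m. ?G (Suc m) \<subseteq> ?G m"
    using F(3) by auto
  have stable: "\<forall>m. \<forall>c \<in> ?G m. \<forall>r. On_hom skew_flatten X X n \<delta> r c \<noteq> 0 \<longrightarrow> r \<in> ?G m"
    using F(4) nz by blast
  have graded: "\<forall>m. \<forall>c \<in> ?G m - ?G (Suc m). \<forall>r \<in> ?G m - ?G (Suc m).
      On_hom skew_flatten X X n \<delta> r c = 0"
    using F(5) nz by blast
  show ?thesis
    unfolding strictly_lower_triangular_def skew_flatten_obj flatten_obj_length
    by (intro exI[of _ ?G] exI[of _ N] conjI) (fact G0 GN dec stable graded)+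
qed

text \<open>One-element blocks give \<open>\<delta>\<close> the index set of
  \<open>\<epsilon>\<close>, and \<open>\<delta>\<close> vanishes wherever \<open>\<epsilon>\<close>
  does, so the filtration for \<open>\<epsilon>\<close> serves for \<open>\<delta>\<close>. With
  larger blocks its steps need not be unions of blocks.\<close>

lemma skew_flatten_lift:
  assumes Z: "Z \<in> Obj (shift_cat (laurent_cat C))"
    and \<epsilon>: "\<epsilon> \<in> Hom (shift_cat (laurent_cat C)) Z Z 1" "strictly_lower_triangular (length Z) \<epsilon>"
    and full: "\<And>X g. \<lbrakk>X \<in> Obj (shift_cat (skew_shift C));
        g \<in> Hom (shift_cat (laurent_cat C)) (On_obj skew_flatten X) (On_obj skew_flatten X) 1\<rbrakk> \<Longrightarrow>
      g \<in> On_hom skew_flatten X X 1 ` Hom (shift_cat (skew_shift C)) X X 1"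
    and supp: "\<And>X f. f \<in> Hom (shift_cat (skew_shift C)) X X 1 \<Longrightarrow> f \<in> skew_supported X X"
  shows "\<exists>X \<in> Obj (shift_cat (skew_shift C)). \<exists>\<delta> \<in> Hom (shift_cat (skew_shift C)) X X 1.
    On_obj skew_flatten X = Z \<and> On_hom skew_flatten X X 1 \<delta> = \<epsilon> \<and>
        strictly_lower_triangular (length X) \<delta>"
proof -
  define X where "X = map (\<lambda>x. ([x], 0 :: int)) Z"
  note blocks = singleton_blocks[OF X_def]
  have X: "X \<in> Obj (shift_cat (skew_shift C))"
    using Z by (auto simp: X_def)
  have obj: "On_obj skew_flatten X = Z"
    unfolding skew_flatten_obj by (rule blocks)
  obtain \<delta> where \<delta>: "\<delta> \<in> Hom (shift_cat (skew_shift C)) X X 1" "On_hom skew_flatten X X 1 \<delta> = \<epsilon>"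
    using full[OF X, of \<epsilon>] \<epsilon>(1) unfolding obj by blast
  have len: "length (concat (map fst X)) = length Z"
    by (simp add: X_def comp_def)
  have zero: "\<delta> j i l v u = 0" if "\<epsilon> j i = 0" for j i l v u
  proof (cases "(i < length X \<and> j < length X) \<and> u < length (summand X i) \<and>
      v < length (summand X j)")
    case True
    then have ij: "i < length Z" "j < length Z" "u = 0" "v = 0"
      by (auto simp: X_def split_def)
    \<comment> \<open>For one-element blocks the flat indices are the block indices, and the
      flattened entry is the only inner entry up to sign.\<close>
    have "On_hom skew_flatten X X 1 \<delta> j i l = 0"
      using \<delta>(2) that by simp
    then show ?thesis
      using ij blocks(2)[of i] blocks(2)[of j]
      by (simp add: skew_flatten_hom len minus_one_pow_parity split: if_splits)
  next
    case False
    then show ?thesis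
      using supp[OF \<delta>(1)] unfolding skew_supported_def by blast
  qed
  have "length X = length Z"
    by (simp add: X_def)
  moreover have "strictly_lower_triangular (length Z) \<delta>"
  proof (rule strictly_lower_triangular_mono[OF \<epsilon>(2)])
    show "\<delta> j i = 0" if "\<epsilon> j i = 0" for j i
      using zero[OF that] by (intro ext) simp
  qed
  ultimately show ?thesis
    by (intro bexI[OF _ X] bexI[OF _ \<delta>(1)] conjI obj \<delta>(2)) simp
qed

lemma skew_flatten_formal_sum_functor:
  "formal_sum_functor (skew_shift C) (laurent_cat C) skew_flatten skew_supported"
proof (rule formal_sum_functor.intro[OF skew_flatten_functor], unfold_locales)
  interpret L: multilinear_category "laurent_cat C" by (rule multilinear_laurent_cat)
  show "On_hom skew_flatten X Y n (a + b) = On_hom skew_flatten X Y n a +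
      On_hom skew_flatten X Y n b"
    for X Y n a b
    by (auto simp: fun_eq_iff skew_flatten_hom scale_right_distrib)
  show "a = 0" if "a \<in> skew_supported X Y" "On_hom skew_flatten X Y n a = 0" for X Y n a
  proof (intro ext)
    fix j i l v u
    show "a j i l v u = 0 j i l v u"
    proof (cases "(i < length X \<and> j < length Y) \<and> u < length (summand X i) \<and>
        v < length (summand Y j)")
      case True
      \<comment> \<open>The flat indices at which the entry of \<open>a\<close> reappears, up to
        sign.\<close>
      have "On_hom skew_flatten X Y n a (flat_index Y j v) (flat_index X i u) l = 0"
        using that(2) by simp
      then show ?thesis
        using True by (simp add: skew_flatten_hom flat_index minus_one_pow_parity split: if_splits)
    next
      case False
      then have "a j i l v u = 0"
        using that(1) unfolding skew_supported_def by blast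
      then show ?thesis by simp
    qed
  qed
  show "0 \<in> skew_supported X Y" for X Y
    by (simp add: skew_supported_def)
  show "a - b \<in> skew_supported X Y" if "a \<in> skew_supported X Y" "b \<in> skew_supported X Y" for X Y a b
    using that by (auto simp: skew_supported_def)
  show supp: "a \<in> skew_supported X Y" if "a \<in> Hom (shift_cat (skew_shift C)) X Y n" for X Y n a
    unfolding skew_supported_def
  proof (intro CollectI allI impI)
    fix j i l v u
    assume out: "\<not> ((i < length X \<and> j < length Y) \<and> u < length (summand X i) \<and>
        v < length (summand Y j))"
    show "a j i l v u = 0"
    proof (cases "i < length X \<and> j < length Y")
      case True
      then have "a j i \<in> Hom (skew_shift C) (summand X i) (summand Y j)
          (n - (shift X i - shift Y j))"
        using that by (simp add: shift_cat_hom[of a])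
      then show ?thesis
        using out True by (auto simp: skew_shift_hom)
    next
      case False
      then have "a j i = 0"
        using that by (simp add: shift_cat_hom[of a])
      then show ?thesis by simp
    qed
  qed
  show "Mu (shift_cat (skew_shift C)) Xs ns fs \<in> skew_supported (hd Xs) (last Xs)"
    if "composable (shift_cat (skew_shift C)) Xs ns fs" for Xs ns fs
    using that by (rule skew_mu_supported)
  show full: "g \<in> On_hom skew_flatten X Y n ` Hom (shift_cat (skew_shift C)) X Y n"
    if "X \<in> Obj (shift_cat (skew_shift C))" "Y \<in> Obj (shift_cat (skew_shift C))"
      "g \<in> Hom (shift_cat (laurent_cat C)) (On_obj skew_flatten X) (On_obj skew_flatten Y) n"
          for X Y n g
  proof -
    have "g \<in> On_hom (flatten (laurent_cat C)) X Y n ` Hom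
        (shift_cat (shift_cat (laurent_cat C))) X Y n"
      using that by (intro L.flatten_full) (simp_all add: skew_flatten_obj)
    then obtain h where h: "h \<in> Hom (shift_cat (shift_cat (laurent_cat C))) X Y n"
      "g = On_hom (flatten (laurent_cat C)) X Y n h" by blast
    have "h \<in> On_hom (shift_map (skew_to_laurent C)) X Y n ` Hom (shift_cat (skew_shift C)) X Y n"
      using that(1,2) h(1) by (intro shift_map_full[OF skew_to_laurent_full]) simp_all
    then show ?thesis
      unfolding h(2) by (auto simp: skew_flatten_def comp_fun_def)
  qed
  show "strictly_lower_triangular (length (On_obj skew_flatten X)) (On_hom skew_flatten X X 1 \<delta>)"
    if "strictly_lower_triangular (length X) \<delta>" for X \<delta>
    using that by (rule skew_flatten_triangular)
  show "\<exists>X \<in> Obj (shift_cat (skew_shift C)). \<exists>\<delta> \<in> Hom (shift_cat (skew_shift C)) X X 1.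
      On_obj skew_flatten X = Z \<and> On_hom skew_flatten X X 1 \<delta> = \<epsilon> \<and>
          strictly_lower_triangular (length X) \<delta>"
    if "Z \<in> Obj (shift_cat (laurent_cat C))" "\<epsilon> \<in> Hom (shift_cat (laurent_cat C)) Z Z 1"
      "strictly_lower_triangular (length Z) \<epsilon>" for Z \<epsilon>
    using that full supp by (rule skew_flatten_lift)
qed

end

text \<open>Extension to twisted complexes respects composition, so the results on a single functor
  of formal sums apply to the induced functor.\<close>

lemma tw_induced_eq: "tw_induced D F = tw_extend (comp_fun (flatten D) (shift_map F))"
  by (simp add: tw_induced_def tw_map_def tw_extend_def comp_fun_def split_def)

theorem mainTheorem3:
  fixes A :: "('k::field, 'o, 'm::ab_group_add) ainf"
  assumes "ainf_category A"
  shows "\<exists>\<Phi>. ainf_isomorphism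
                (skew_cat (shift_cat A) (shift_action A)) (shift_cat (laurent_cat A)) \<Phi> \<and>
             quasi_equivalence
                (Tw (skew_cat (shift_cat A) (shift_action A))) (Tw (laurent_cat A))
                (tw_induced (laurent_cat A) \<Phi>)"
proof -
  interpret multilinear_category A
    using assms by (rule ainf_category.multilinear)
  show ?thesis
    using skew_to_laurent_isomorphism
      formal_sum_functor.tw_quasi_equivalence[OF skew_flatten_formal_sum_functor
          multilinear_laurent_cat]
    unfolding skew_flatten_def tw_induced_eq by (intro exI[of _ "skew_to_laurent A"] conjI)
qed

end
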